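(* There is an absolute constant $C>0$ such that the following holds. Let $d\in\mathbb{N}$ be a power of $2$, let $\delta,\varepsilon\in(0,1/2)$, let $f:\mathbb{R}\to\mathbb{R}$ be a $1$-Lipschitz function, and let $m\in\mathbb{N}$ satisfy $m\ge C\,\varepsilon^{-2}\,\log^5(d/\varepsilon)\,\log(1/\delta)$. Let $\widetilde h:\mathbb{R}^d\to\mathbb{R}^{md}$ be the randomized Hadamard transform with $m$ blocks and entries $\widetilde h_{j,k}(z)=(HD^jz)_k$. Then with probability at least $1-\delta$ over the random matrices $D^1,\dots,D^m$, $$\forall z\in\mathbb{R}^d \text{ with } \|z\|\le 1:\qquad \left|\frac{1}{md}\sum_{j=1}^m\sum_{k=1}^d f\big(\widetilde h_{j,k}(z)\big)-\mathbb{E}_{Z\sim\mathcal{N}(0,\|z\|^2)}[f(Z)]\right|\le\varepsilon .$$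
   Context: $\|\cdot\|$ is the Euclidean norm. $\mathcal{N}(0,\sigma^2)$ is the Gaussian with mean $0$ and variance $\sigma^2$ (a point mass at $0$ if $\sigma=0$). For $d$ a power of $2$, the (unnormalized) Hadamard matrix $H=H_d\in\{\pm1\}^{d\times d}$ is defined recursively by $H_1=[1]$ and $H_d=\begin{bmatrix}H_{d/2}&H_{d/2}\\H_{d/2}&-H_{d/2}\end{bmatrix}$. $D^1,\dots,D^m\in\mathbb{R}^{d\times d}$ are independent random diagonal matrices whose diagonal entries are i.i.d. $\mathcal{N}(0,1)$. The randomized Hadamard transform is $\widetilde h(z)=(HD^1z,HD^2z,\dots,HD^mz)\in\mathbb{R}^{md}$, and $\widetilde h_{j,k}(z)=(HD^jz)_k$ for $j\in\{1,\dots,m\}$, $k\in\{1,\dots,d\}$. *)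

theory Defs
  imports "HOL-Probability.Probability" "Jordan_Normal_Form.Matrix"
begin

(* H_d; only meaningful when d is a power of 2. *)
fun hadamard_mat :: "nat \<Rightarrow> real mat" where
  "hadamard_mat d =
     (if d \<le> 1 then 1\<^sub>m 1
      else four_block_mat (hadamard_mat (d div 2)) (hadamard_mat (d div 2))
                          (hadamard_mat (d div 2)) (- hadamard_mat (d div 2)))"

(* The defining equation would make the simplifier loop. *)
declare hadamard_mat.simps [simp del]

definition gaussian_measure :: "real \<Rightarrow> real measure" where
  "gaussian_measure \<sigma> =
     (if \<sigma> = 0 then return borel 0
      else density lborel (\<lambda>x. ennreal (normal_density 0 \<sigma> x)))"

(* Joint law of the diagonals: a sample \<omega> assigns to (j, k) the k-th diagonal entry of D^j.
   Blocks and coordinates are numbered from 0. *)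
definition diag_space :: "nat \<Rightarrow> nat \<Rightarrow> (nat \<times> nat \<Rightarrow> real) measure" where
  "diag_space m d = PiM ({..<m} \<times> {..<d}) (\<lambda>_. gaussian_measure 1)"

definition rand_diag :: "nat \<Rightarrow> (nat \<times> nat \<Rightarrow> real) \<Rightarrow> nat \<Rightarrow> real mat" where
  "rand_diag d \<omega> j = mat_diag d (\<lambda>k. \<omega> (j, k))"

(* The entry (H D^j z)_k of the randomized Hadamard transform of z. *)
definition rand_hadamard ::
    "nat \<Rightarrow> (nat \<times> nat \<Rightarrow> real) \<Rightarrow> nat \<Rightarrow> nat \<Rightarrow> real Matrix.vec \<Rightarrow> real" where
  "rand_hadamard d \<omega> j k z =
     vec_index (hadamard_mat d *\<^sub>v (rand_diag d \<omega> j *\<^sub>v z)) k"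

definition euclid_norm :: "real Matrix.vec \<Rightarrow> real" where
  "euclid_norm z = L2_set (vec_index z) {..<dim_vec z}"

end

theory Submission
  imports Defs
begin

text \<open>
  Split a vector \<open>z\<close> by the dyadic magnitudes of its entries. For the entries of size at most \<open>2^-l\<close>,
  the orthogonality of the rows of \<open>H\<close> makes the empirical mean of \<open>f\<close> over all \<open>(HD\<^sup>jz)\<^sub>k\<close> a Lipschitz
  function of the corresponding diagonal entries with constant \<open>2^-l / sqrt m\<close>. By Gaussian
  concentration, replacing these entries by their average, that is, replacing \<open>f\<close> by its convolution
  with a Gaussian, costs more than \<open>t\<close> with probability at most \<open>2 exp (- m t^2 4^l / 8)\<close>. A vector of
  norm at most 1 has at most \<open>4^(l+1)\<close> entries larger than \<open>2^-(l+1)\<close>, so on a fine grid this survives a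
  union bound over all vectors that matter at level \<open>l\<close>. Since Gaussian convolution keeps \<open>f\<close> Lipschitz
  and forms a semigroup, removing the levels one after the other ends at the mean of \<open>f\<close> under
  \<open>N(0, \<parallel>z\<parallel>^2)\<close>. There are \<open>O(log (d/\<epsilon>))\<close> levels, each of which may contribute an error
  \<open>t\<close> of order \<open>\<epsilon> / log (d/\<epsilon>)\<close>.

  The concentration inequality is proved by the rotation argument of Maurey and Pisier, with the path
  from a Gaussian vector to an independent copy cut into \<open>n\<close> equal rotations and \<open>n\<close> tending to infinity.
\<close>

section \<open>Gaussian measures and rotations\<close>

text \<open>A union bound over a net of the whole ball would have to beat about exp(d
  log(d/\<epsilon>)) vectors, which forces m to grow with d. Level by level the two sides match:
  entries of size at most 2^-l give a tail exponent proportional to 4^l, and what is left of the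
  vector has at most 4^(l+1) nonzero entries, so the entropy scales like 4^l as well. For this the
  smallest entries have to go first. The price is that the function smoothed at a level depends on
  the vector through the variance removed so far; on a grid of step s this variance is s^2 times an
  integer n, so only finitely many functions occur. Rounding to the grid is cheap because one event
  on the diagonals bounds the mean of |h| by twice the norm of z, for all z at once. The limit in
  the rotation argument produces a derivative, so f is first replaced by a moving average, which is
  differentiable with slope at most 1; smoothing preserves this class. Since the entries of H are
  signs, every coordinate of the transform sees the same removed variance, and a single convolution
  serves them all.\<close>

abbreviation std_gauss :: "real measure" where
  "std_gauss \<equiv> gaussian_measure 1"

lemma gaussian_measure_pos:
  "\<sigma> \<noteq> 0 \<Longrightarrow> gaussian_measure \<sigma> = density lborel (\<lambda>x. ennreal (normal_density 0 \<sigma> x))"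
  by (simp add: gaussian_measure_def)

lemma sets_gaussian_measure [measurable_cong, simp]: "sets (gaussian_measure \<sigma>) = sets borel"
  by (simp add: gaussian_measure_def)

lemma space_gaussian_measure [simp]: "space (gaussian_measure \<sigma>) = UNIV"
  by (simp add: gaussian_measure_def)

lemma prob_space_std_gauss: "prob_space std_gauss"
  by (simp add: gaussian_measure_pos prob_space_normal_density)

interpretation std_gauss: prob_space std_gauss
  by (rule prob_space_std_gauss)

interpretation std_gauss_pair: pair_prob_space std_gauss std_gauss
  by standard

lemma nn_integral_std_gauss:
  assumes "f \<in> borel_measurable borel"
  shows "(\<integral>\<^sup>+x. f x \<partial>std_gauss) = (\<integral>\<^sup>+x. ennreal (std_normal_density x) * f x \<partial>lborel)"
  using assms by (simp add: gaussian_measure_pos nn_integral_density)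

text \<open>A rotation with c \<noteq> 0 factors into two affine substitutions, one in x for fixed y
  and one in y for fixed x, with Fubini in between. The factor 1/|c| produced by the first is
  absorbed by the second, so no multidimensional change of variables is involved.\<close>

lemma nn_integral_rotate_lborel:
  fixes c s :: real and K :: "real \<Rightarrow> real \<Rightarrow> ennreal"
  assumes K [measurable]: "(\<lambda>p. K (fst p) (snd p)) \<in> borel_measurable (borel \<Otimes>\<^sub>M borel)"
    and cs: "c\<^sup>2 + s\<^sup>2 = 1" and c: "c \<noteq> 0"
  shows "(\<integral>\<^sup>+x. \<integral>\<^sup>+y. K (c * x + s * y) (c * y - s * x) \<partial>lborel \<partial>lborel) =
    (\<integral>\<^sup>+x. \<integral>\<^sup>+y. K x y \<partial>lborel \<partial>lborel)"
proof -
  \<comment> \<open>This lets the measurability prover handle the curried \<open>K\<close> at any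
    two measurable arguments. The same device recurs below for \<open>F\<close>, \<open>G\<close>
    and \<open>H\<close>.\<close>
  have K2: "(\<lambda>x. K (f x) (g x)) \<in> borel_measurable M"
    if "f \<in> borel_measurable M" "g \<in> borel_measurable M" for f g and M :: "'z measure"
    using measurable_compose[OF measurable_Pair[OF that] K] by simp
  note [measurable] = K2
  have "(\<integral>\<^sup>+x. \<integral>\<^sup>+y. K (c * x + s * y) (c * y - s * x) \<partial>lborel \<partial>lborel) =
      (\<integral>\<^sup>+y. \<integral>\<^sup>+x. K (c * x + s * y) (c * y - s * x) \<partial>lborel \<partial>lborel)"
    by (rule lborel_pair.Fubini') measurable
  also have "\<dots> = (\<integral>\<^sup>+y. \<bar>1/c\<bar> * (\<integral>\<^sup>+x. K x (-(s/c) * x + (1/c) * y) \<partial>lborel) \<partial>lborel)"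
  proof (rule nn_integral_cong)
    fix y :: real
    have "c * y - s * (- (s * y / c) + (1/c) * x) = -(s/c) * x + (1/c) * ((c\<^sup>2 + s\<^sup>2) * y)" for x
      using c by (simp add: field_simps power2_eq_square)
    then have "c * y - s * (- (s * y / c) + (1/c) * x) = -(s/c) * x + (1/c) * y" for x
      by (simp add: cs)
    moreover have "c * (- (s * y / c) + (1/c) * x) + s * y = x" for x
      using c by (simp add: field_simps)
    ultimately show "(\<integral>\<^sup>+x. K (c * x + s * y) (c * y - s * x) \<partial>lborel) =
      \<bar>1/c\<bar> * (\<integral>\<^sup>+x. K x (-(s/c) * x + (1/c) * y) \<partial>lborel)"
      using c by (subst nn_integral_real_affine[where t = "-(s * y / c)" and c = "1/c"]) simp_all
  qed
  also have "\<dots> = \<bar>1/c\<bar> * (\<integral>\<^sup>+y. \<integral>\<^sup>+x. K x (-(s/c) * x + (1/c) * y) \<partial>lborel \<partial>lborel)"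
    by (rule nn_integral_cmult) measurable
  also have "(\<integral>\<^sup>+y. \<integral>\<^sup>+x. K x (-(s/c) * x + (1/c) * y) \<partial>lborel \<partial>lborel) =
     (\<integral>\<^sup>+x. \<integral>\<^sup>+y. K x (-(s/c) * x + (1/c) * y) \<partial>lborel \<partial>lborel)"
    by (rule lborel_pair.Fubini') measurable
  also have "\<bar>1/c\<bar> * \<dots> = (\<integral>\<^sup>+x. \<bar>1/c\<bar> * (\<integral>\<^sup>+y. K x (-(s/c) * x + (1/c) * y) \<partial>lborel) \<partial>lborel)"
    by (rule nn_integral_cmult[symmetric]) measurable
  also have "\<dots> = (\<integral>\<^sup>+x. \<integral>\<^sup>+y. K x y \<partial>lborel \<partial>lborel)"
    using c by (intro nn_integral_cong nn_integral_real_affine[symmetric]) simp_all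
  finally show ?thesis .
qed

text \<open>The product of two standard normal densities depends on x^2 + y^2 only, hence is
  invariant under the rotation and can be carried along with \<open>F\<close>.\<close>

lemma nn_integral_rotate_nz:
  fixes c s :: real and F :: "real \<Rightarrow> real \<Rightarrow> ennreal"
  assumes F [measurable]: "(\<lambda>p. F (fst p) (snd p)) \<in> borel_measurable (borel \<Otimes>\<^sub>M borel)"
    and cs: "c\<^sup>2 + s\<^sup>2 = 1" and c: "c \<noteq> 0"
  shows "(\<integral>\<^sup>+x. \<integral>\<^sup>+y. F (c * x + s * y) (c * y - s * x) \<partial>std_gauss \<partial>std_gauss) =
    (\<integral>\<^sup>+x. \<integral>\<^sup>+y. F x y \<partial>std_gauss \<partial>std_gauss)"
proof -
  have F2: "(\<lambda>x. F (f x) (g x)) \<in> borel_measurable M"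
    if "f \<in> borel_measurable M" "g \<in> borel_measurable M" for f g and M :: "'z measure"
    using measurable_compose[OF measurable_Pair[OF that] F] by simp
  note [measurable] = F2
  define w where "w u v = ennreal (std_normal_density u * std_normal_density v)" for u v
  have expand: "(\<integral>\<^sup>+x. \<integral>\<^sup>+y. G x y \<partial>std_gauss \<partial>std_gauss) =
      (\<integral>\<^sup>+x. \<integral>\<^sup>+y. w x y * G x y \<partial>lborel \<partial>lborel)"
    if [measurable]: "(\<lambda>p. G (fst p) (snd p)) \<in> borel_measurable (borel \<Otimes>\<^sub>M borel)" for G :: "real \<Rightarrow> real \<Rightarrow> ennreal"
  proof -
    have G2 [measurable]: "(\<lambda>x. G (f x) (g x)) \<in> borel_measurable M"
      if "f \<in> borel_measurable M" "g \<in> borel_measurable M" for f g and M :: "'z measure"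
      using measurable_compose[OF measurable_Pair[OF that], of "\<lambda>p. G (fst p) (snd p)"] \<open>(\<lambda>p. G (fst p) (snd p)) \<in> borel_measurable (borel \<Otimes>\<^sub>M borel)\<close> by simp
    have "(\<integral>\<^sup>+x. \<integral>\<^sup>+y. G x y \<partial>std_gauss \<partial>std_gauss) =
       (\<integral>\<^sup>+x. std_normal_density x * (\<integral>\<^sup>+y. std_normal_density y * G x y \<partial>lborel) \<partial>lborel)"
      by (simp add: nn_integral_std_gauss)
    also have "\<dots> = (\<integral>\<^sup>+x. \<integral>\<^sup>+y. w x y * G x y \<partial>lborel \<partial>lborel)"
      unfolding w_def
      by (intro nn_integral_cong, subst nn_integral_cmult[symmetric])
         (simp_all add: ennreal_mult' mult.assoc)
    finally show ?thesis .
  qed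
  have w: "w (c * x + s * y) (c * y - s * x) = w x y" for x y
  proof -
    have "(c * x + s * y)\<^sup>2 + (c * y - s * x)\<^sup>2 = (c\<^sup>2 + s\<^sup>2) * (x\<^sup>2 + y\<^sup>2)"
      by (simp add: power2_eq_square algebra_simps)
    with cs have e: "- (c * x + s * y)\<^sup>2 / 2 + - (c * y - s * x)\<^sup>2 / 2 = - x\<^sup>2 / 2 + - y\<^sup>2 / 2"
      by (simp add: field_simps)
    have "exp (- (c * x + s * y)\<^sup>2 / 2) * exp (- (c * y - s * x)\<^sup>2 / 2) = exp (- x\<^sup>2 / 2) * exp (- y\<^sup>2 / 2)"
      by (subst (1 2) exp_add[symmetric]) (simp only: e)
    then show ?thesis unfolding w_def std_normal_density_def by simp
  qed
  have [measurable]: "(\<lambda>p. w (f p) (g p)) \<in> borel_measurable M"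
    if [measurable]: "f \<in> borel_measurable M" "g \<in> borel_measurable M" for f g and M :: "'z measure"
    unfolding w_def by measurable
  have "(\<integral>\<^sup>+x. \<integral>\<^sup>+y. F (c * x + s * y) (c * y - s * x) \<partial>std_gauss \<partial>std_gauss) =
    (\<integral>\<^sup>+x. \<integral>\<^sup>+y. w (c * x + s * y) (c * y - s * x) * F (c * x + s * y) (c * y - s * x) \<partial>lborel \<partial>lborel)"
    unfolding w by (rule expand) measurable
  also have "\<dots> = (\<integral>\<^sup>+x. \<integral>\<^sup>+y. w x y * F x y \<partial>lborel \<partial>lborel)"
    by (rule nn_integral_rotate_lborel[where K = "\<lambda>x y. w x y * F x y"]) (use cs c in auto)
  also have "\<dots> = (\<integral>\<^sup>+x. \<integral>\<^sup>+y. F x y \<partial>std_gauss \<partial>std_gauss)"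
    by (rule expand[symmetric]) measurable
  finally show ?thesis .
qed

lemma nn_integral_std_gauss_rotate:
  fixes c s :: real and F :: "real \<Rightarrow> real \<Rightarrow> ennreal"
  assumes F [measurable]: "(\<lambda>p. F (fst p) (snd p)) \<in> borel_measurable (borel \<Otimes>\<^sub>M borel)"
    and cs: "c\<^sup>2 + s\<^sup>2 = 1"
  shows "(\<integral>\<^sup>+x. \<integral>\<^sup>+y. F (c * x + s * y) (c * y - s * x) \<partial>std_gauss \<partial>std_gauss) =
    (\<integral>\<^sup>+x. \<integral>\<^sup>+y. F x y \<partial>std_gauss \<partial>std_gauss)"
proof (cases "c = 0")
  case True
  \<comment> \<open>a quarter turn is the composition of two eighth turns\<close>
  define c' where "c' = 1 / sqrt 2"
  define s' where "s' = s / sqrt 2"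
  have s2: "s\<^sup>2 = 1" using cs True by simp
  have cs': "c'\<^sup>2 + s'\<^sup>2 = 1" "c' \<noteq> 0" and e: "c' * c' = s' * s'" "2 * (c' * s') = s"
    using s2 by (simp_all add: c'_def s'_def power2_eq_square field_simps)
  have F2: "(\<lambda>x. F (f x) (g x)) \<in> borel_measurable M"
    if "f \<in> borel_measurable M" "g \<in> borel_measurable M" for f g and M :: "'z measure"
    using measurable_compose[OF measurable_Pair[OF that] F] by simp
  note [measurable] = F2
  have 1: "c' * (c' * x + s' * y) + s' * (c' * y - s' * x) = c * x + s * y" for x y
  proof -
    have "c' * (c' * x + s' * y) + s' * (c' * y - s' * x) = (c' * c' - s' * s') * x + 2 * (c' * s') * y"
      by (simp add: algebra_simps)
    then show ?thesis using e True by simp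
  qed
  have 2: "c' * (c' * y - s' * x) - s' * (c' * x + s' * y) = c * y - s * x" for x y
  proof -
    have "c' * (c' * y - s' * x) - s' * (c' * x + s' * y) = (c' * c' - s' * s') * y - 2 * (c' * s') * x"
      by (simp add: algebra_simps)
    then show ?thesis using e True by simp
  qed
  have "(\<integral>\<^sup>+x. \<integral>\<^sup>+y. F x y \<partial>std_gauss \<partial>std_gauss) = 
    (\<integral>\<^sup>+x. \<integral>\<^sup>+y. F (c' * x + s' * y) (c' * y - s' * x) \<partial>std_gauss \<partial>std_gauss)"
    by (rule nn_integral_rotate_nz[symmetric]) (use cs' in auto)
  also have "\<dots> = (\<integral>\<^sup>+x. \<integral>\<^sup>+y. F (c * x + s * y) (c * y - s * x) \<partial>std_gauss \<partial>std_gauss)"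
    unfolding 1[symmetric] 2[symmetric]
    by (rule nn_integral_rotate_nz[where F = "\<lambda>x y. F (c' * x + s' * y) (c' * y - s' * x)", symmetric])
       (use cs' in auto)
  finally show ?thesis by simp
qed (use assms nn_integral_rotate_nz in blast)

section \<open>Moments of a single Gaussian variable\<close>

lemma std_gauss_abs: "integrable std_gauss (\<lambda>x. \<bar>x\<bar>)" "(\<integral>x. \<bar>x\<bar> \<partial>std_gauss) \<le> 1"
proof -
  have "has_bochner_integral lborel (\<lambda>x. std_normal_density x * \<bar>x\<bar>) (sqrt (2/pi))"
    using std_normal_moment_abs_odd[of 0] by simp
  then have *: "has_bochner_integral std_gauss (\<lambda>x. \<bar>x\<bar>) (sqrt (2/pi))"
    unfolding gaussian_measure_pos[OF one_neq_zero]
    by (intro has_bochner_integral_density) auto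
  \<comment> \<open>Bounding the first absolute moment by 1 is what later makes the smoothing
    1-Lipschitz in its standard deviation.\<close>
  have "sqrt (2/pi) \<le> 1" using pi_ge_two by simp
  with * show "integrable std_gauss (\<lambda>x. \<bar>x\<bar>)" "(\<integral>x. \<bar>x\<bar> \<partial>std_gauss) \<le> 1"
    by (auto dest: has_bochner_integral_integral_eq intro: integrable.intros)
qed

lemma nn_integral_std_gauss_exp:
  "(\<integral>\<^sup>+x. ennreal (exp (b * x)) \<partial>std_gauss) = ennreal (exp (b\<^sup>2 / 2))"
proof -
  have "(\<integral>\<^sup>+x. ennreal (exp (b * x)) \<partial>std_gauss) =
      (\<integral>\<^sup>+x. ennreal (exp (b\<^sup>2 / 2)) * ennreal (normal_density b 1 x) \<partial>lborel)"
  proof (subst nn_integral_std_gauss, simp, rule nn_integral_cong)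
    fix x :: real
    have "- x\<^sup>2 / 2 + b * x = b\<^sup>2 / 2 + - (x - b)\<^sup>2 / 2"
      by (simp add: power2_eq_square field_simps)
    then have "exp (- x\<^sup>2 / 2) * exp (b * x) = exp (b\<^sup>2 / 2) * exp (- (x - b)\<^sup>2 / 2)"
      by (subst (1 2) exp_add[symmetric]) (simp only:)
    then show "ennreal (std_normal_density x) * ennreal (exp (b * x)) = 
        ennreal (exp (b\<^sup>2 / 2)) * ennreal (normal_density b 1 x)"
      by (simp add: ennreal_mult'[symmetric] normal_density_def)
  qed
  also have "\<dots> = ennreal (exp (b\<^sup>2 / 2)) * (\<integral>\<^sup>+x. ennreal (normal_density b 1 x) \<partial>lborel)"
    by (rule nn_integral_cmult) simp
  also have "(\<integral>\<^sup>+x. ennreal (normal_density b 1 x) \<partial>lborel) = 1"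
    by (subst nn_integral_eq_integral) (auto simp: one_ennreal.rep_eq)
  finally show ?thesis by simp
qed

text \<open>Multiplying the standard density by exp(x^2/4) yields sqrt 2 times the density of
  variance 2. This feeds the Chernoff bound for sums of squares of diagonal entries.\<close>

lemma nn_integral_std_gauss_exp_square:
  "(\<integral>\<^sup>+x. ennreal (exp (x\<^sup>2 / 4)) \<partial>std_gauss) = ennreal (sqrt 2)"
proof -
  have "(\<integral>\<^sup>+x. ennreal (exp (x\<^sup>2 / 4)) \<partial>std_gauss) =
      (\<integral>\<^sup>+x. ennreal (sqrt 2) * ennreal (normal_density 0 (sqrt 2) x) \<partial>lborel)"
  proof (subst nn_integral_std_gauss, simp, rule nn_integral_cong)
    fix x :: real
    have "exp (- x\<^sup>2 / 2) * exp (x\<^sup>2 / 4) = exp (- x\<^sup>2 / 4)"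
      by (subst exp_add[symmetric]) (simp add: field_simps)
    moreover have "sqrt (2 * pi * (sqrt 2)\<^sup>2) = sqrt 2 * sqrt (2 * pi)"
      by (simp add: real_sqrt_mult)
    ultimately show "ennreal (std_normal_density x) * ennreal (exp (x\<^sup>2 / 4)) = 
        ennreal (sqrt 2) * ennreal (normal_density 0 (sqrt 2) x)"
      by (simp add: ennreal_mult'[symmetric] normal_density_def field_simps)
  qed
  also have "\<dots> = ennreal (sqrt 2) * (\<integral>\<^sup>+x. ennreal (normal_density 0 (sqrt 2) x) \<partial>lborel)"
    by (rule nn_integral_cmult) simp
  also have "(\<integral>\<^sup>+x. ennreal (normal_density 0 (sqrt 2) x) \<partial>lborel) = 1"
    by (subst nn_integral_eq_integral) (auto simp: one_ennreal.rep_eq)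
  finally show ?thesis by simp
qed

text \<open>Only finiteness matters: products of these integrals provide the integrable majorant for
  the limit in the rotation argument.\<close>

lemma nn_integral_std_gauss_exp_abs_finite:
  "(\<integral>\<^sup>+x. ennreal (exp (b * \<bar>x\<bar>)) \<partial>std_gauss) < \<infinity>"
proof -
  have "(\<integral>\<^sup>+x. ennreal (exp (b * \<bar>x\<bar>)) \<partial>std_gauss) \<le>
     (\<integral>\<^sup>+x. ennreal (exp (b * x)) + ennreal (exp (- b * x)) \<partial>std_gauss)"
    by (intro nn_integral_mono) (auto simp: abs_if)
  also have "\<dots> = ennreal (exp (b\<^sup>2 / 2)) + ennreal (exp ((- b)\<^sup>2 / 2))"
    by (subst nn_integral_add, simp, simp, simp only: nn_integral_std_gauss_exp)
  also have "\<dots> < \<infinity>" by simp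
  finally show ?thesis .
qed

abbreviation gauss_prod :: "'i set \<Rightarrow> ('i \<Rightarrow> real) measure" where
  "gauss_prod I \<equiv> Pi\<^sub>M I (\<lambda>_. std_gauss)"

interpretation gauss_prod: product_prob_space "\<lambda>_. std_gauss" for I
  by standard

lemma prob_std_gauss_UNIV [simp]: "measure std_gauss UNIV = 1"
  using std_gauss.prob_space by simp

lemma prob_space_gauss_prod: "prob_space (gauss_prod I)"
  by (rule prob_space_PiM) (rule prob_space_std_gauss)

section \<open>Gaussian smoothing of Lipschitz functions\<close>

text \<open>The convolution of f with the Gaussian of variance \<sigma>^2, evaluated at a. Scaling a
  standard variable instead of using the density of N(0, \<sigma>^2) covers \<sigma> = 0 without a
  case distinction and couples different values of \<sigma> on one space.\<close>

definition gauss_smooth :: "(real \<Rightarrow> real) \<Rightarrow> real \<Rightarrow> real \<Rightarrow> real" where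
  "gauss_smooth f \<sigma> a = (\<integral>x. f (a + \<sigma> * x) \<partial>std_gauss)"

lemma lip_abs: "1-lipschitz_on UNIV f \<Longrightarrow> \<bar>f x - f y\<bar> \<le> \<bar>x - y\<bar>" for f :: "real \<Rightarrow> real"
  using lipschitz_onD[of 1 UNIV f x y] by (simp add: dist_real_def)

lemma lip_I: "(\<And>x y. \<bar>f x - f y\<bar> \<le> \<bar>x - y\<bar>) \<Longrightarrow> 1-lipschitz_on UNIV f" for f :: "real \<Rightarrow> real"
  by (intro lipschitz_onI) (auto simp: dist_real_def)

lemma lip_measurable: "1-lipschitz_on UNIV f \<Longrightarrow> f \<in> borel_measurable borel" for f :: "real \<Rightarrow> real"
  by (intro borel_measurable_continuous_onI lipschitz_on_continuous_on)

lemma gauss_smooth_integrable: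
  fixes f :: "real \<Rightarrow> real"
  assumes f: "1-lipschitz_on UNIV f"
  shows "integrable std_gauss (\<lambda>x. f (a + \<sigma> * x))"
proof (rule Bochner_Integration.integrable_bound)
  show "integrable std_gauss (\<lambda>x. \<bar>f a\<bar> + \<bar>\<sigma>\<bar> * \<bar>x\<bar>)"
    using std_gauss_abs(1) by simp
  show "(\<lambda>x. f (a + \<sigma> * x)) \<in> borel_measurable std_gauss"
    using lip_measurable[OF f] by simp
  show "AE x in std_gauss. norm (f (a + \<sigma> * x)) \<le> norm (\<bar>f a\<bar> + \<bar>\<sigma>\<bar> * \<bar>x\<bar>)"
  proof (rule AE_I2)
    fix x
    have "\<bar>f (a + \<sigma> * x) - f a\<bar> \<le> \<bar>\<sigma>\<bar> * \<bar>x\<bar>"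
      using lip_abs[OF f, of "a + \<sigma> * x" a] by (simp add: abs_mult)
    then show "norm (f (a + \<sigma> * x)) \<le> norm (\<bar>f a\<bar> + \<bar>\<sigma>\<bar> * \<bar>x\<bar>)" by simp
  qed
qed

lemma gauss_smooth_0 [simp]: "gauss_smooth f 0 = f"
  by (simp add: gauss_smooth_def fun_eq_iff)

lemma gauss_smooth_close:
  assumes f: "1-lipschitz_on UNIV f" and g: "1-lipschitz_on UNIV g"
    and fg: "\<And>x. \<bar>f x - g x\<bar> \<le> e"
  shows "\<bar>gauss_smooth f \<sigma> a - gauss_smooth g \<sigma> a\<bar> \<le> e"
proof -
  have "gauss_smooth f \<sigma> a - gauss_smooth g \<sigma> a = (\<integral>x. f (a + \<sigma> * x) - g (a + \<sigma> * x) \<partial>std_gauss)"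
    unfolding gauss_smooth_def using f g by (simp add: gauss_smooth_integrable)
  also have "\<bar>\<dots>\<bar> \<le> (\<integral>x. \<bar>f (a + \<sigma> * x) - g (a + \<sigma> * x)\<bar> \<partial>std_gauss)"
    by (rule integral_abs_bound)
  also have "\<dots> \<le> (\<integral>x. e \<partial>std_gauss)"
    using f g fg by (intro integral_mono) (auto simp: gauss_smooth_integrable)
  finally show ?thesis by simp
qed

lemma gauss_smooth_lip:
  assumes f: "1-lipschitz_on UNIV f"
  shows "1-lipschitz_on UNIV (gauss_smooth f \<sigma>)"
proof (rule lip_I)
  fix a b
  have "gauss_smooth f \<sigma> a - gauss_smooth f \<sigma> b = (\<integral>x. f (a + \<sigma> * x) - f (b + \<sigma> * x) \<partial>std_gauss)"
    unfolding gauss_smooth_def using f by (simp add: gauss_smooth_integrable)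
  also have "\<bar>\<dots>\<bar> \<le> (\<integral>x. \<bar>f (a + \<sigma> * x) - f (b + \<sigma> * x)\<bar> \<partial>std_gauss)"
    by (rule integral_abs_bound)
  also have "\<dots> \<le> (\<integral>x. \<bar>a - b\<bar> \<partial>std_gauss)"
  proof (intro integral_mono)
    show "\<bar>f (a + \<sigma> * x) - f (b + \<sigma> * x)\<bar> \<le> \<bar>a - b\<bar>" for x
      using lip_abs[OF f, of "a + \<sigma> * x" "b + \<sigma> * x"] by simp
  qed (use f in \<open>auto simp: gauss_smooth_integrable\<close>)
  finally show "\<bar>gauss_smooth f \<sigma> a - gauss_smooth f \<sigma> b\<bar> \<le> \<bar>a - b\<bar>" by simp
qed

text \<open>Both Gaussians are realized as multiples of the same standard variable, whose mean
  absolute value is at most 1. This controls the change of the target mean when the norm of z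
  changes.\<close>

lemma gauss_smooth_diff:
  assumes f: "1-lipschitz_on UNIV f"
  shows "\<bar>gauss_smooth f \<sigma> a - gauss_smooth f \<tau> a\<bar> \<le> \<bar>\<sigma> - \<tau>\<bar>"
proof -
  have "gauss_smooth f \<sigma> a - gauss_smooth f \<tau> a = (\<integral>x. f (a + \<sigma> * x) - f (a + \<tau> * x) \<partial>std_gauss)"
    unfolding gauss_smooth_def using f by (simp add: gauss_smooth_integrable)
  also have "\<bar>\<dots>\<bar> \<le> (\<integral>x. \<bar>f (a + \<sigma> * x) - f (a + \<tau> * x)\<bar> \<partial>std_gauss)"
    by (rule integral_abs_bound)
  also have "\<dots> \<le> (\<integral>x. \<bar>\<sigma> - \<tau>\<bar> * \<bar>x\<bar> \<partial>std_gauss)"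
  proof (intro integral_mono)
    show "\<bar>f (a + \<sigma> * x) - f (a + \<tau> * x)\<bar> \<le> \<bar>\<sigma> - \<tau>\<bar> * \<bar>x\<bar>" for x
      using lip_abs[OF f, of "a + \<sigma> * x" "a + \<tau> * x"]
      by (simp add: abs_mult[symmetric] algebra_simps)
  qed (use f std_gauss_abs in \<open>auto simp: gauss_smooth_integrable\<close>)
  also have "\<dots> = \<bar>\<sigma> - \<tau>\<bar> * (\<integral>x. \<bar>x\<bar> \<partial>std_gauss)" by simp
  also have "\<dots> \<le> \<bar>\<sigma> - \<tau>\<bar> * 1" by (intro mult_left_mono std_gauss_abs) auto
  finally show ?thesis by simp
qed

text \<open>Invariance is needed for the measure itself, because the semigroup law below integrates
  functions of arbitrary sign.\<close>

lemma distr_std_gauss_rotate: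
  fixes c s :: real
  assumes "c\<^sup>2 + s\<^sup>2 = 1"
  defines "P \<equiv> std_gauss \<Otimes>\<^sub>M std_gauss"
  shows "distr P P (\<lambda>p. (c * fst p + s * snd p, c * snd p - s * fst p)) = P"
proof (rule measure_eqI)
  let ?R = "\<lambda>p. (c * fst p + s * snd p, c * snd p - s * fst p)"
  have [measurable]: "?R \<in> measurable P P" unfolding P_def by measurable
  fix A assume "A \<in> sets (distr P P ?R)"
  then have A [measurable]: "A \<in> sets P" by simp
  have "sets P = sets (borel \<Otimes>\<^sub>M borel)"
    unfolding P_def by (intro sets_pair_measure_cong) auto
  with A have [measurable]: "A \<in> sets (borel \<Otimes>\<^sub>M borel)" by simp
  have "emeasure (distr P P ?R) A = (\<integral>\<^sup>+p. indicator A p \<partial>(distr P P ?R))"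
    by simp
  also have "\<dots> = (\<integral>\<^sup>+p. indicator A (?R p) \<partial>P)"
    by (rule nn_integral_distr) simp_all
  also have "\<dots> = (\<integral>\<^sup>+x. \<integral>\<^sup>+y. indicator A (?R (x, y)) \<partial>std_gauss \<partial>std_gauss)"
    unfolding P_def by (rule std_gauss.nn_integral_fst[symmetric]) (simp_all flip: P_def)
  also have "\<dots> = (\<integral>\<^sup>+x. \<integral>\<^sup>+y. indicator A (x, y) \<partial>std_gauss \<partial>std_gauss)"
    using nn_integral_std_gauss_rotate[of "\<lambda>x y. indicator A (x, y)" c s] assms by simp
  also have "\<dots> = (\<integral>\<^sup>+p. indicator A p \<partial>P)"
    unfolding P_def by (rule std_gauss.nn_integral_fst) (simp_all flip: P_def)
  finally show "emeasure (distr P P ?R) A = emeasure P A" by simp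
qed simp

text \<open>With (c, s) the unit vector in direction (\<sigma>, \<tau>), the sum \<sigma>x + \<tau>y
  is r times the first coordinate of the rotated pair, which is again standard Gaussian. Without a
  direction, that is for \<sigma> = \<tau> = 0, both sides are f.\<close>

lemma gauss_smooth_semigroup:
  assumes f: "1-lipschitz_on UNIV f"
  shows "gauss_smooth (gauss_smooth f \<tau>) \<sigma> = gauss_smooth f (sqrt (\<sigma>\<^sup>2 + \<tau>\<^sup>2))"
proof (cases "\<sigma>\<^sup>2 + \<tau>\<^sup>2 = 0")
  case True
  then show ?thesis by (simp add: sum_power2_eq_zero_iff)
next
  case False
  define r where "r = sqrt (\<sigma>\<^sup>2 + \<tau>\<^sup>2)"
  define c s where "c = \<sigma> / r" and "s = \<tau> / r"
  have r: "r > 0" using False unfolding r_def by (simp add: sum_power2_gt_zero_iff sum_power2_eq_zero_iff)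
  have r2: "r\<^sup>2 = \<sigma>\<^sup>2 + \<tau>\<^sup>2" by (simp add: r_def)
  have cs: "c\<^sup>2 + s\<^sup>2 = 1"
    unfolding c_def s_def power_divide add_divide_distrib[symmetric] r2[symmetric] using r by simp
  have rc: "r * c = \<sigma>" "r * s = \<tau>" using r by (simp_all add: c_def s_def)
  note fm [measurable] = lip_measurable[OF f]
  let ?P = "std_gauss \<Otimes>\<^sub>M std_gauss"
  let ?R = "\<lambda>p. (c * fst p + s * snd p, c * snd p - s * fst p)"
  show ?thesis
  proof
    fix a
    have int: "integrable ?P (\<lambda>p. f (a + r * fst p))"
    proof (rule std_gauss_pair.Fubini_integrable)
      show "integrable std_gauss (\<lambda>x. \<integral>y. norm (f (a + r * fst (x, y))) \<partial>std_gauss)"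
        using gauss_smooth_integrable[OF f, of a r] by simp
    qed simp_all
    have int': "integrable ?P (\<lambda>p. f (a + r * fst (?R p)))"
      by (rule integrable_distr[where M = ?P and M' = ?P and T = ?R])
         (simp_all add: distr_std_gauss_rotate[OF cs] int)
    have "gauss_smooth f r a = (\<integral>x. \<integral>y. f (a + r * fst (x, y)) \<partial>std_gauss \<partial>std_gauss)"
      by (simp add: gauss_smooth_def)
    also have "\<dots> = (\<integral>p. f (a + r * fst p) \<partial>?P)"
      by (rule std_gauss_pair.integral_fst'[OF int])
    also have "\<dots> = (\<integral>p. f (a + r * fst p) \<partial>(distr ?P ?P ?R))"
      by (simp add: distr_std_gauss_rotate[OF cs])
    also have "\<dots> = (\<integral>p. f (a + r * fst (?R p)) \<partial>?P)"
      by (rule integral_distr) simp_all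
    also have "\<dots> = (\<integral>x. \<integral>y. f (a + r * fst (?R (x, y))) \<partial>std_gauss \<partial>std_gauss)"
      by (rule std_gauss_pair.integral_fst'[OF int', symmetric])
    also have "\<dots> = gauss_smooth (gauss_smooth f \<tau>) \<sigma> a"
    proof -
      have "a + r * fst (?R (x, y)) = a + \<sigma> * x + \<tau> * y" for x y
        unfolding rc[symmetric] by (simp add: algebra_simps)
      then show ?thesis unfolding gauss_smooth_def by (simp only:)
    qed
    finally show "gauss_smooth (gauss_smooth f \<tau>) \<sigma> a = gauss_smooth f (sqrt (\<sigma>\<^sup>2 + \<tau>\<^sup>2)) a" by (simp add: r_def)
  qed
qed

lemma integral_gaussian_measure:
  assumes f: "f \<in> borel_measurable borel" and "\<sigma> \<ge> 0"
  shows "integral\<^sup>L (gaussian_measure \<sigma>) f = gauss_smooth f \<sigma> 0"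
proof (cases "\<sigma> = 0")
  case True
  with f show ?thesis by (simp add: gaussian_measure_def integral_return)
next
  case False
  with \<open>\<sigma> \<ge> 0\<close> have s: "\<sigma> > 0" by simp
  have "integral\<^sup>L (gaussian_measure \<sigma>) f = (\<integral>x. normal_density 0 \<sigma> x * f x \<partial>lborel)"
    using f s by (simp add: gaussian_measure_pos integral_density)
  also have "\<dots> = \<sigma> * (\<integral>x. normal_density 0 \<sigma> (\<sigma> * x) * f (\<sigma> * x) \<partial>lborel)"
    using s by (subst lborel_integral_real_affine[where c = \<sigma> and t = 0]) simp_all
  also have "\<dots> = (\<integral>x. \<sigma> * (normal_density 0 \<sigma> (\<sigma> * x) * f (\<sigma> * x)) \<partial>lborel)"
    by simp
  also have "\<dots> = (\<integral>x. std_normal_density x * f (\<sigma> * x) \<partial>lborel)"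
  proof (rule Bochner_Integration.integral_cong[OF refl])
    fix x
    have "\<sigma> * normal_density 0 \<sigma> (\<sigma> * x) = std_normal_density x"
      using s by (simp add: normal_density_def real_sqrt_mult power_mult_distrib)
    then show "\<sigma> * (normal_density 0 \<sigma> (\<sigma> * x) * f (\<sigma> * x)) = std_normal_density x * f (\<sigma> * x)"
      by (metis mult.assoc)
  qed
  also have "\<dots> = gauss_smooth f \<sigma> 0"
    unfolding gauss_smooth_def using f by (simp add: gaussian_measure_pos integral_density)
  finally show ?thesis .
qed

text \<open>The derivative may be discontinuous: the rotation argument uses it only pointwise, as
  the limit of difference quotients, and integrates expressions in it. This class is closed under
  negation and under Gaussian smoothing.\<close>

definition diff_lip :: "(real \<Rightarrow> real) \<Rightarrow> bool" where
  "diff_lip f \<longleftrightarrow> (\<exists>f'. f' \<in> borel_measurable borel \<and>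
     (\<forall>x. (f has_real_derivative f' x) (at x) \<and> \<bar>f' x\<bar> \<le> 1))"

lemma diff_lip_imp_lip:
  assumes "diff_lip f"
  shows "1-lipschitz_on UNIV f"
proof (rule lip_I)
  fix x y
  obtain f' where f': "\<And>x. (f has_real_derivative f' x) (at x)" "\<And>x. \<bar>f' x\<bar> \<le> 1"
    using assms unfolding diff_lip_def by auto
  have "norm (f x - f y) \<le> 1 * norm (x - y)"
    by (rule field_differentiable_bound[where S = UNIV and f' = f'])
       (use f' in auto)
  then show "\<bar>f x - f y\<bar> \<le> \<bar>x - y\<bar>" by simp
qed

lemma diff_lip_uminus: "diff_lip f \<Longrightarrow> diff_lip (\<lambda>x. - f x)"
  unfolding diff_lip_def
  apply (elim exE)
  subgoal for f' by (rule exI[of _ "\<lambda>x. - f' x"]) (auto intro!: DERIV_minus)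
  done

text \<open>Differentiation under the integral: the difference quotients of f are bounded by 1, so
  dominated convergence applies and the derivative is the smoothed f'.\<close>

lemma diff_lip_gauss_smooth:
  assumes "diff_lip f"
  shows "diff_lip (gauss_smooth f \<sigma>)"
proof -
  obtain f' where f' [measurable]: "f' \<in> borel_measurable borel"
    and d: "\<And>x. (f has_real_derivative f' x) (at x)" and b: "\<And>x. \<bar>f' x\<bar> \<le> 1"
    using assms unfolding diff_lip_def by auto
  have lip: "1-lipschitz_on UNIV f" by (rule diff_lip_imp_lip[OF assms])
  note fm [measurable] = lip_measurable[OF lip]
  have [measurable]: "gauss_smooth f' \<sigma> \<in> borel_measurable borel"
    unfolding gauss_smooth_def[abs_def] by measurable
  have "\<bar>gauss_smooth f' \<sigma> a\<bar> \<le> 1" for a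
  proof -
    have "\<bar>gauss_smooth f' \<sigma> a\<bar> \<le> (\<integral>x. \<bar>f' (a + \<sigma> * x)\<bar> \<partial>std_gauss)"
      unfolding gauss_smooth_def by (rule integral_abs_bound)
    also have "\<dots> \<le> (\<integral>x. 1 \<partial>std_gauss)"
      using b by (intro integral_mono std_gauss.integrable_const_bound[where B = 1]) auto
    finally show ?thesis by simp
  qed
  moreover have "(gauss_smooth f \<sigma> has_real_derivative gauss_smooth f' \<sigma> a) (at a)" for a
    unfolding has_field_derivative_iff tendsto_at_iff_sequentially comp_def
  proof (intro allI impI)
    fix X assume X: "\<forall>i. X i \<in> UNIV - {a}" "X \<longlonglongrightarrow> a"
    have "(\<lambda>i. \<integral>x. (f (X i + \<sigma> * x) - f (a + \<sigma> * x)) / (X i - a) \<partial>std_gauss) \<longlonglongrightarrow> gauss_smooth f' \<sigma> a"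
      unfolding gauss_smooth_def
    proof (rule integral_dominated_convergence[where w = "\<lambda>_. 1"])
      show "AE x in std_gauss. (\<lambda>i. (f (X i + \<sigma> * x) - f (a + \<sigma> * x)) / (X i - a)) \<longlonglongrightarrow> f' (a + \<sigma> * x)"
      proof (rule AE_I2)
        fix x
        have "(\<lambda>i. X i + \<sigma> * x) \<longlonglongrightarrow> a + \<sigma> * x" using X by (intro tendsto_intros) auto
        moreover have "\<forall>i. X i + \<sigma> * x \<in> UNIV - {a + \<sigma> * x}" using X by auto
        ultimately have "((\<lambda>y. (f y - f (a + \<sigma> * x)) / (y - (a + \<sigma> * x))) \<circ> (\<lambda>i. X i + \<sigma> * x)) \<longlonglongrightarrow> f' (a + \<sigma> * x)"
          using d[of "a + \<sigma> * x"] unfolding has_field_derivative_iff tendsto_at_iff_sequentially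
          by (elim allE[of _ "\<lambda>i. X i + \<sigma> * x"]) simp
        then show "(\<lambda>i. (f (X i + \<sigma> * x) - f (a + \<sigma> * x)) / (X i - a)) \<longlonglongrightarrow> f' (a + \<sigma> * x)"
          by (simp add: comp_def)
      qed
      show "AE x in std_gauss. norm ((f (X i + \<sigma> * x) - f (a + \<sigma> * x)) / (X i - a)) \<le> 1" for i
        using lip_abs[OF lip, of "X i + \<sigma> * x" "a + \<sigma> * x" for x] X
        by (intro AE_I2) (simp add: divide_le_eq_1)
    qed simp_all
    then show "(\<lambda>i. (gauss_smooth f \<sigma> (X i) - gauss_smooth f \<sigma> a) / (X i - a)) \<longlonglongrightarrow> gauss_smooth f' \<sigma> a"
      by (simp add: gauss_smooth_def gauss_smooth_integrable[OF lip])
  qed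
  ultimately show ?thesis unfolding diff_lip_def by (intro exI[of _ "gauss_smooth f' \<sigma>"]) auto
qed

lemma diff_lip_approx:
  fixes f :: "real \<Rightarrow> real"
  assumes f: "1-lipschitz_on UNIV f" and e: "e > 0"
  obtains g where "diff_lip g" "\<And>x. \<bar>f x - g x\<bar> \<le> e"
proof -
  have cont: "continuous_on UNIV f" by (rule lipschitz_on_continuous_on[OF f])
  have "\<exists>F. \<forall>x. -\<infinity> < ereal x \<longrightarrow> ereal x < \<infinity> \<longrightarrow> (F has_vector_derivative f x) (at x)"
    by (rule einterval_antiderivative)
       (use cont in \<open>auto simp: continuous_on_eq_continuous_at\<close>)
  then obtain F where F: "\<And>x. (F has_real_derivative f x) (at x)"
    by (auto simp: has_real_derivative_iff_has_vector_derivative)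
  \<comment> \<open>The average of f over [x, x + e]. Its derivative is a difference quotient of f,
    hence at most 1 in absolute value, and by the mean value theorem g x is a value of f at distance
    less than e from x.\<close>
  define g where "g x = (F (x + e) - F x) / e" for x
  show ?thesis
  proof
    have "(g has_real_derivative (f (x + e) - f x) / e) (at x)" for x
      unfolding g_def using e by (auto intro!: derivative_eq_intros DERIV_chain'[OF _ F] F)
    moreover have "\<bar>(f (x + e) - f x) / e\<bar> \<le> 1" for x
      using lip_abs[OF f, of "x + e" x] e by simp
    moreover have "(\<lambda>x. (f (x + e) - f x) / e) \<in> borel_measurable borel"
      using lip_measurable[OF f] by simp
    ultimately show "diff_lip g" unfolding diff_lip_def by blast
    fix x
    obtain z where z: "x < z" "z < x + e" "F (x + e) - F x = e * f z"
      using MVT2[of x "x + e" F f] F e by auto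
    then have "g x = f z" using e by (simp add: g_def)
    with z lip_abs[OF f, of x z] show "\<bar>f x - g x\<bar> \<le> e" by simp
  qed
qed

section \<open>Rotations of a pair of Gaussian vectors\<close>

text \<open>
  The new first vector when \<open>(x, y)\<close> is rotated in the coordinates in \<open>S\<close>; the new second vector
  is \<open>rot S c (-s) y x\<close>.
\<close>

definition rot :: "'i set \<Rightarrow> real \<Rightarrow> real \<Rightarrow> ('i \<Rightarrow> real) \<Rightarrow> ('i \<Rightarrow> real) \<Rightarrow> 'i \<Rightarrow> real" where
  "rot S c s x y = (\<lambda>i. if i \<in> S then c * x i + s * y i else x i)"

lemma measurable_rot:
  assumes "S \<subseteq> I" "f \<in> measurable M (gauss_prod I)" "g \<in> measurable M (gauss_prod I)"
  shows "(\<lambda>p. rot S c s (f p) (g p)) \<in> measurable M (gauss_prod I)"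
proof (rule measurable_PiM_single')
  have eq: "measurable M std_gauss = borel_measurable M"
    by (rule measurable_cong_sets) simp_all
  have f: "(\<lambda>p. f p i) \<in> borel_measurable M" if "i \<in> I" for i
    unfolding eq[symmetric] using measurable_compose[OF assms(2) measurable_component_singleton[OF that]] .
  have g: "(\<lambda>p. g p i) \<in> borel_measurable M" if "i \<in> I" for i
    unfolding eq[symmetric] using measurable_compose[OF assms(3) measurable_component_singleton[OF that]] .
  show "(\<lambda>p. rot S c s (f p) (g p) i) \<in> measurable M std_gauss" if "i \<in> I" for i
  proof -
    note [measurable] = f[OF that] g[OF that]
    show ?thesis unfolding rot_def eq by (cases "i \<in> S"; simp only: if_True if_False; measurable)
  qed
  have "f p \<in> extensional I" if "p \<in> space M" for p
    using measurable_space[OF assms(2) that] by (auto simp: space_PiM PiE_def)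
  then show "(\<lambda>p. rot S c s (f p) (g p)) \<in> space M \<rightarrow> (\<Pi>\<^sub>E i\<in>I. space std_gauss)"
    using assms(1) by (auto simp: rot_def PiE_def extensional_def)
qed

text \<open>Moves the two copies of coordinate i to the innermost integrals, where the planar
  rotation invariance can be applied with all other coordinates fixed.\<close>

lemma nn_integral_gauss_prod_insert2:
  assumes J: "finite J" "i \<notin> J"
    and H [measurable]: "(\<lambda>p. H (fst p) (snd p)) \<in> borel_measurable (gauss_prod (insert i J) \<Otimes>\<^sub>M gauss_prod (insert i J))"
  shows "(\<integral>\<^sup>+x. \<integral>\<^sup>+y. H x y \<partial>gauss_prod (insert i J) \<partial>gauss_prod (insert i J)) =
    (\<integral>\<^sup>+x. \<integral>\<^sup>+y. \<integral>\<^sup>+a. \<integral>\<^sup>+b. H (x(i := a)) (y(i := b)) \<partial>std_gauss \<partial>std_gauss \<partial>gauss_prod J \<partial>gauss_prod J)"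
proof -
  interpret J: prob_space "gauss_prod J" by (rule prob_space_gauss_prod)
  interpret IJ: prob_space "gauss_prod (insert i J)" by (rule prob_space_gauss_prod)
  interpret Q: pair_sigma_finite std_gauss "gauss_prod J" by standard
  have H2 [measurable]: "(\<lambda>x. H (f x) (g x)) \<in> borel_measurable M"
    if "f \<in> measurable M (gauss_prod (insert i J))" "g \<in> measurable M (gauss_prod (insert i J))" for f g and M :: "'z measure"
    using measurable_compose[OF measurable_Pair[OF that] H] by simp
  have upd [measurable]: "(\<lambda>x. (f x)(i := g x)) \<in> measurable M (gauss_prod (insert i J))"
    if "f \<in> measurable M (gauss_prod J)" "g \<in> measurable M std_gauss" for f g and M :: "'z measure"
    using that by (intro measurable_fun_upd[where J = J]) auto
  have "(\<integral>\<^sup>+x. \<integral>\<^sup>+y. H x y \<partial>gauss_prod (insert i J) \<partial>gauss_prod (insert i J)) =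
    (\<integral>\<^sup>+x. \<integral>\<^sup>+a. \<integral>\<^sup>+y. H (x(i := a)) y \<partial>gauss_prod (insert i J) \<partial>std_gauss \<partial>gauss_prod J)"
    by (rule gauss_prod.product_nn_integral_insert[OF J]) measurable
  also have "\<dots> = (\<integral>\<^sup>+x. \<integral>\<^sup>+a. \<integral>\<^sup>+y. \<integral>\<^sup>+b. H (x(i := a)) (y(i := b)) \<partial>std_gauss \<partial>gauss_prod J \<partial>std_gauss \<partial>gauss_prod J)"
    by (intro nn_integral_cong gauss_prod.product_nn_integral_insert[OF J]) measurable
  also have "\<dots> = (\<integral>\<^sup>+x. \<integral>\<^sup>+y. \<integral>\<^sup>+a. \<integral>\<^sup>+b. H (x(i := a)) (y(i := b)) \<partial>std_gauss \<partial>std_gauss \<partial>gauss_prod J \<partial>gauss_prod J)"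
    by (intro nn_integral_cong Q.Fubini'[symmetric]) measurable
  finally show ?thesis .
qed

lemma nn_integral_rot_single:
  assumes J: "finite J" "i \<notin> J" and cs: "c\<^sup>2 + s\<^sup>2 = 1"
    and F [measurable]: "(\<lambda>p. F (fst p) (snd p)) \<in> borel_measurable (gauss_prod (insert i J) \<Otimes>\<^sub>M gauss_prod (insert i J))"
  shows "(\<integral>\<^sup>+x. \<integral>\<^sup>+y. F (rot {i} c s x y) (rot {i} c (-s) y x) \<partial>gauss_prod (insert i J) \<partial>gauss_prod (insert i J)) =
    (\<integral>\<^sup>+x. \<integral>\<^sup>+y. F x y \<partial>gauss_prod (insert i J) \<partial>gauss_prod (insert i J))"
proof -
  have F2 [measurable]: "(\<lambda>x. F (f x) (g x)) \<in> borel_measurable M"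
    if "f \<in> measurable M (gauss_prod (insert i J))" "g \<in> measurable M (gauss_prod (insert i J))" for f g and M :: "'z measure"
    using measurable_compose[OF measurable_Pair[OF that] F] by simp
  have upd [measurable]: "(\<lambda>x. (f x)(i := g x)) \<in> measurable M (gauss_prod (insert i J))"
    if "f \<in> measurable M (gauss_prod J)" "g \<in> measurable M std_gauss" for f g and M :: "'z measure"
    using that by (intro measurable_fun_upd[where J = J]) auto
  have r: "rot {i} c s' (x(i := a)) (y(i := b)) = x(i := c * a + s' * b)" for x y :: "'a \<Rightarrow> real" and a b s'
    by (auto simp: rot_def)
  have "(\<integral>\<^sup>+x. \<integral>\<^sup>+y. F (rot {i} c s x y) (rot {i} c (-s) y x) \<partial>gauss_prod (insert i J) \<partial>gauss_prod (insert i J)) =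
     (\<integral>\<^sup>+x. \<integral>\<^sup>+y. \<integral>\<^sup>+a. \<integral>\<^sup>+b. F (x(i := c * a + s * b)) (y(i := c * b - s * a)) \<partial>std_gauss \<partial>std_gauss \<partial>gauss_prod J \<partial>gauss_prod J)"
    by (subst nn_integral_gauss_prod_insert2[OF J]) (auto simp: r intro!: measurable_rot F2)
  also have "\<dots> = (\<integral>\<^sup>+x. \<integral>\<^sup>+y. \<integral>\<^sup>+a. \<integral>\<^sup>+b. F (x(i := a)) (y(i := b)) \<partial>std_gauss \<partial>std_gauss \<partial>gauss_prod J \<partial>gauss_prod J)"
    by (intro nn_integral_cong nn_integral_std_gauss_rotate cs) measurable
  also have "\<dots> = (\<integral>\<^sup>+x. \<integral>\<^sup>+y. F x y \<partial>gauss_prod (insert i J) \<partial>gauss_prod (insert i J))"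
    by (rule nn_integral_gauss_prod_insert2[OF J F, symmetric])
  finally show ?thesis .
qed

text \<open>The rotation in all coordinates of S is a composition of rotations in single
  coordinates, each of which preserves the law of the pair.\<close>

lemma nn_integral_rot:
  assumes I: "finite I" "S \<subseteq> I" and cs: "c\<^sup>2 + s\<^sup>2 = 1"
    and F: "(\<lambda>p. F (fst p) (snd p)) \<in> borel_measurable (gauss_prod I \<Otimes>\<^sub>M gauss_prod I)"
  shows "(\<integral>\<^sup>+x. \<integral>\<^sup>+y. F (rot S c s x y) (rot S c (-s) y x) \<partial>gauss_prod I \<partial>gauss_prod I) =
    (\<integral>\<^sup>+x. \<integral>\<^sup>+y. F x y \<partial>gauss_prod I \<partial>gauss_prod I)"
proof -
  have "finite S" using I finite_subset by blast
  then show ?thesis using \<open>S \<subseteq> I\<close> F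
  proof (induction S arbitrary: F)
    case empty
    show ?case by (simp add: rot_def)
  next
    case (insert i S)
    define F' where "F' x y = F (rot {i} c s x y) (rot {i} c (-s) y x)" for x y
    have m: "(\<lambda>p. F' (fst p) (snd p)) \<in> borel_measurable (gauss_prod I \<Otimes>\<^sub>M gauss_prod I)"
      unfolding F'_def using insert.prems(1)
      using measurable_compose[OF measurable_Pair[OF measurable_rot measurable_rot] insert.prems(2), 
         of "{i}" fst "gauss_prod I \<Otimes>\<^sub>M gauss_prod I" snd "{i}" snd fst c s c "-s"] by auto
    have r: "rot {i} c s' (rot S c s' x y) (rot S c (-s') y x) = rot (insert i S) c s' x y" for s' x y
      using insert.hyps by (auto simp: rot_def)
    have "(\<integral>\<^sup>+x. \<integral>\<^sup>+y. F (rot (insert i S) c s x y) (rot (insert i S) c (-s) y x) \<partial>gauss_prod I \<partial>gauss_prod I) =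
      (\<integral>\<^sup>+x. \<integral>\<^sup>+y. F' (rot S c s x y) (rot S c (-s) y x) \<partial>gauss_prod I \<partial>gauss_prod I)"
      unfolding F'_def r using r[of "-s"] by simp
    also have "\<dots> = (\<integral>\<^sup>+x. \<integral>\<^sup>+y. F' x y \<partial>gauss_prod I \<partial>gauss_prod I)"
      using insert.prems by (intro insert.IH m) auto
    also have "\<dots> = (\<integral>\<^sup>+x. \<integral>\<^sup>+y. F x y \<partial>gauss_prod I \<partial>gauss_prod I)"
    proof -
      have "insert i (I - {i}) = I" using insert.prems by auto
      then show ?thesis unfolding F'_def
        using nn_integral_rot_single[of "I - {i}" i c s F] I cs insert.prems by simp
    qed
    finally show ?case .
  qed
qed

section \<open>Linear functions of Gaussian vectors\<close>

text \<open>Integrate the tangent of exp at the mean of U, which lies below exp. In the extended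
  reals the case of an infinite right-hand side is covered too.\<close>

lemma jensen_exp:
  assumes "prob_space M" and U: "integrable M U"
  shows "ennreal (exp (\<integral>x. U x \<partial>M)) \<le> (\<integral>\<^sup>+x. ennreal (exp (U x)) \<partial>M)"
proof (cases "(\<integral>\<^sup>+x. ennreal (exp (U x)) \<partial>M) = \<infinity>")
  case False
  interpret prob_space M by fact
  note [measurable] = borel_measurable_integrable[OF U]
  define u where "u = (\<integral>x. U x \<partial>M)"
  have int: "integrable M (\<lambda>x. exp (U x))"
    using False by (intro integrableI_nonneg) (auto simp: top.not_eq_extremum)
  have "exp u = (\<integral>x. exp u * (1 + (U x - u)) \<partial>M)"
    using U by (simp add: prob_space u_def)
  also have "\<dots> \<le> (\<integral>x. exp (U x) \<partial>M)"
  proof (intro integral_mono int)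
    show "exp u * (1 + (U x - u)) \<le> exp (U x)" for x
      using mult_left_mono[OF exp_ge_add_one_self[of "U x - u"], of "exp u"]
      by (simp flip: exp_add)
  qed (use U in simp)
  finally show ?thesis
    unfolding u_def using int by (subst nn_integral_eq_integral) (auto intro: ennreal_leI)
qed simp

lemma exp_sum_eq_prod:
  "finite I \<Longrightarrow> ennreal (exp (\<Sum>i\<in>I. f i)) = (\<Prod>i\<in>I. ennreal (exp (f i)))"
  by (simp add: exp_sum prod_ennreal)

lemma measurable_gauss_prod_component:
  assumes "f \<in> measurable M (gauss_prod I)" "i \<in> I"
  shows "(\<lambda>x. f x i) \<in> borel_measurable M"
  using measurable_compose[OF assms(1) measurable_component_singleton[OF assms(2)]]
  by (simp cong: measurable_cong_sets)

lemma borel_measurable_gauss_prod_linear: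
  assumes "f \<in> measurable M (gauss_prod I)" "J \<subseteq> I"
  shows "(\<lambda>x. \<Sum>i\<in>J. c i * f x i) \<in> borel_measurable M"
  using assms by (intro borel_measurable_sum borel_measurable_times measurable_gauss_prod_component[OF assms(1)]) auto

lemma integrable_gauss_prod_abs:
  assumes "i \<in> I"
  shows "integrable (gauss_prod I) (\<lambda>y. \<bar>y i\<bar>)"
proof (rule integrable_distr[where T = "\<lambda>y. y i" and M' = std_gauss])
  show "(\<lambda>y. y i) \<in> measurable (gauss_prod I) std_gauss"
    using assms by (rule measurable_component_singleton)
  show "integrable (distr (gauss_prod I) std_gauss (\<lambda>y. y i)) abs"
    using gauss_prod.PiM_component[OF assms] std_gauss_abs(1) by simp
qed

lemma integrable_lip_linear:
  fixes f :: "real \<Rightarrow> real"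
  assumes f: "1-lipschitz_on UNIV f" and I: "finite I"
  shows "integrable (gauss_prod I) (\<lambda>y. f (a + (\<Sum>i\<in>I. c i * y i)))"
proof (rule Bochner_Integration.integrable_bound)
  interpret I: prob_space "gauss_prod I" by (rule prob_space_gauss_prod)
  show "integrable (gauss_prod I) (\<lambda>y. \<bar>f a\<bar> + (\<Sum>i\<in>I. \<bar>c i\<bar> * \<bar>y i\<bar>))"
    by (intro Bochner_Integration.integrable_add Bochner_Integration.integrable_sum integrable_mult_right integrable_gauss_prod_abs) auto
  note [measurable] = lip_measurable[OF f]
  show "(\<lambda>y. f (a + (\<Sum>i\<in>I. c i * y i))) \<in> borel_measurable (gauss_prod I)"
    by measurable
  show "AE y in gauss_prod I. norm (f (a + (\<Sum>i\<in>I. c i * y i))) \<le> norm (\<bar>f a\<bar> + (\<Sum>i\<in>I. \<bar>c i\<bar> * \<bar>y i\<bar>))"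
  proof (rule AE_I2)
    fix y :: "'a \<Rightarrow> real"
    have "\<bar>f (a + (\<Sum>i\<in>I. c i * y i)) - f a\<bar> \<le> \<bar>\<Sum>i\<in>I. c i * y i\<bar>"
      using lip_abs[OF f, of "a + (\<Sum>i\<in>I. c i * y i)" a] by simp
    also have "\<dots> \<le> (\<Sum>i\<in>I. \<bar>c i\<bar> * \<bar>y i\<bar>)"
      using sum_abs[of "\<lambda>i. c i * y i" I] by (simp add: abs_mult)
    finally show "norm (f (a + (\<Sum>i\<in>I. c i * y i))) \<le> norm (\<bar>f a\<bar> + (\<Sum>i\<in>I. \<bar>c i\<bar> * \<bar>y i\<bar>))"
      by simp
  qed
qed

text \<open>Integrating out one coordinate turns f into its convolution with variance (c i)^2, and
  the semigroup law adds the variances. The function changes along the way, hence f is arbitrary in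
  the induction.\<close>

lemma integral_lip_linear:
  fixes f :: "real \<Rightarrow> real"
  assumes "1-lipschitz_on UNIV f" and "finite I"
  shows "(\<integral>y. f (a + (\<Sum>i\<in>I. c i * y i)) \<partial>gauss_prod I) = gauss_smooth f (sqrt (\<Sum>i\<in>I. (c i)\<^sup>2)) a"
  using assms(2,1)
proof (induction I arbitrary: f rule: finite_induct)
  case empty
  show ?case using prob_space.prob_space[OF prob_space_gauss_prod, of "{} :: 'a set"] by (simp add: space_PiM)
next
  case (insert i J)
  have "(\<integral>y. f (a + (\<Sum>i\<in>insert i J. c i * y i)) \<partial>gauss_prod (insert i J)) =
    (\<integral>x. \<integral>y. f (a + (\<Sum>j\<in>insert i J. c j * (x(i := y)) j)) \<partial>std_gauss \<partial>gauss_prod J)"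
    using insert by (intro gauss_prod.product_integral_insert integrable_lip_linear) auto
  also have "(\<lambda>x. \<integral>y. f (a + (\<Sum>j\<in>insert i J. c j * (x(i := y)) j)) \<partial>std_gauss) =
    (\<lambda>x. gauss_smooth f (c i) (a + (\<Sum>j\<in>J. c j * x j)))"
  proof
    fix x :: "'a \<Rightarrow> real"
    have "a + (\<Sum>j\<in>insert i J. c j * (x(i := y)) j) = a + (\<Sum>j\<in>J. c j * x j) + c i * y" for y
    proof -
      have "(\<Sum>j\<in>J. c j * (x(i := y)) j) = (\<Sum>j\<in>J. c j * x j)"
        using insert.hyps by (intro sum.cong) auto
      then show ?thesis using insert.hyps by simp
    qed
    then show "(\<integral>y. f (a + (\<Sum>j\<in>insert i J. c j * (x(i := y)) j)) \<partial>std_gauss) = gauss_smooth f (c i) (a + (\<Sum>j\<in>J. c j * x j))"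
      unfolding gauss_smooth_def by presburger
  qed
  also have "(\<integral>x. gauss_smooth f (c i) (a + (\<Sum>j\<in>J. c j * x j)) \<partial>gauss_prod J) = gauss_smooth (gauss_smooth f (c i)) (sqrt (\<Sum>i\<in>J. (c i)\<^sup>2)) a"
    using insert by (intro insert.IH gauss_smooth_lip)
  also have "\<dots> = gauss_smooth f (sqrt (\<Sum>i\<in>insert i J. (c i)\<^sup>2)) a"
    using insert by (simp add: gauss_smooth_semigroup sum_nonneg add.commute)
  finally show ?case .
qed

lemma nn_integral_gauss_prod_exp_linear:
  assumes "finite I" "S \<subseteq> I"
  shows "(\<integral>\<^sup>+y. ennreal (exp (\<Sum>i\<in>S. c i * y i)) \<partial>gauss_prod I) = ennreal (exp ((\<Sum>i\<in>S. (c i)\<^sup>2) / 2))"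
proof -
  define c' where "c' i = (if i \<in> S then c i else 0)" for i
  have s: "(\<Sum>i\<in>S. g i) = (\<Sum>i\<in>I. if i \<in> S then g i else 0)" for g :: "'a \<Rightarrow> real"
    using assms by (simp add: sum.If_cases Int_absorb1)
  have "(\<integral>\<^sup>+y. ennreal (exp (\<Sum>i\<in>S. c i * y i)) \<partial>gauss_prod I) =
     (\<integral>\<^sup>+y. (\<Prod>i\<in>I. ennreal (exp (c' i * y i))) \<partial>gauss_prod I)"
  proof -
    have "(\<Sum>i\<in>S. c i * y i) = (\<Sum>i\<in>I. c' i * y i)" for y
      unfolding s by (intro sum.cong) (auto simp: c'_def)
    then show ?thesis using assms by (simp add: exp_sum_eq_prod)
  qed
  also have "\<dots> = (\<Prod>i\<in>I. ennreal (exp ((c' i)\<^sup>2 / 2)))"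
    using assms by (subst gauss_prod.product_nn_integral_prod) (measurable, simp_all add: nn_integral_std_gauss_exp)
  also have "\<dots> = ennreal (exp ((\<Sum>i\<in>I. (c' i)\<^sup>2 / 2)))"
    using assms by (simp add: exp_sum_eq_prod)
  also have "(\<Sum>i\<in>I. (c' i)\<^sup>2 / 2) = (\<Sum>i\<in>S. (c i)\<^sup>2) / 2"
    unfolding s sum_divide_distrib by (intro sum.cong) (auto simp: c'_def)
  finally show ?thesis .
qed

lemma nn_integral_gauss_prod_exp_abs_finite:
  assumes "finite I"
  shows "(\<integral>\<^sup>+y. ennreal (exp (\<Sum>i\<in>I. b i * \<bar>y i\<bar>)) \<partial>gauss_prod I) < \<infinity>"
proof -
  have "(\<integral>\<^sup>+y. ennreal (exp (\<Sum>i\<in>I. b i * \<bar>y i\<bar>)) \<partial>gauss_prod I) = (\<Prod>i\<in>I. \<integral>\<^sup>+x. ennreal (exp (b i * \<bar>x\<bar>)) \<partial>std_gauss)"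
    using assms by (subst gauss_prod.product_nn_integral_prod[symmetric]) (measurable, simp_all add: exp_sum_eq_prod)
  also have "\<dots> < \<infinity>"
    using nn_integral_std_gauss_exp_abs_finite
    by (simp add: less_top[symmetric] ennreal_prod_eq_top)
  finally show ?thesis .
qed

section \<open>Gaussian concentration\<close>

text \<open>Convexity of exp with equal weights 1/n. The factor n inside the exponent is harmless
  for a path of n steps, since each increment is of order 1/n.\<close>

lemma exp_mean_le:
  fixes f :: "nat \<Rightarrow> real"
  assumes "n > 0"
  shows "exp (\<Sum>r<n. f r) \<le> (\<Sum>r<n. exp (real n * f r)) / real n"
proof -
  have "exp (\<Sum>r<n. (1 / real n) *\<^sub>R (real n * f r)) \<le> (\<Sum>r<n. (1 / real n) * exp (real n * f r))"
    using assms by (intro convex_on_sum[OF _ _ exp_convex]) auto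
  then show ?thesis using assms by (simp add: sum_divide_distrib)
qed

lemma abs_one_minus_cos_le: "\<bar>cos x - 1\<bar> \<le> \<bar>x\<bar>" for x :: real
proof -
  have "norm (cos x - cos 0) \<le> 1 * norm (x - 0)"
    by (rule field_differentiable_bound[where S = UNIV and f' = "\<lambda>x. - sin x"])
       (auto intro!: derivative_eq_intros)
  then show ?thesis by simp
qed

lemmas nn_integral_gauss_prod_fst =
  sigma_finite_measure.nn_integral_fst[OF prob_space_imp_sigma_finite[OF prob_space_gauss_prod]]

text \<open>The functions \<phi>, applied to the linear forms with rows \<open>A k\<close>, are
  summed over K, and only the coordinates in S are resampled. The gradient of this sum in S is the
  transpose of A, restricted to S, applied to the vector of derivatives of \<phi>. Hence
  \<open>op\<close> bounds the transpose: \<Lambda> dominates its squared operator norm.\<close>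

locale lip_linear_statistic =
  fixes I :: "'i set" and K :: "'k set" and S :: "'i set" and A :: "'k \<Rightarrow> 'i \<Rightarrow> real"
    and \<phi> :: "real \<Rightarrow> real" and \<Lambda> :: real
  assumes fin: "finite I" "finite K" and S: "S \<subseteq> I" and diff_lip: "diff_lip \<phi>"
    and op: "\<And>p. (\<Sum>i\<in>S. (\<Sum>k\<in>K. A k i * p k)\<^sup>2) \<le> \<Lambda> * (\<Sum>k\<in>K. (p k)\<^sup>2)"
begin

definition lin :: "'k \<Rightarrow> ('i \<Rightarrow> real) \<Rightarrow> real" where
  "lin k x = (\<Sum>i\<in>I. A k i * x i)"

definition G :: "('i \<Rightarrow> real) \<Rightarrow> real" where
  "G x = (\<Sum>k\<in>K. \<phi> (lin k x))"

lemmas lip = diff_lip_imp_lip[OF diff_lip]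

lemma measurable_lin:
  "f \<in> measurable M (gauss_prod I) \<Longrightarrow> (\<lambda>x. lin k (f x)) \<in> borel_measurable M"
  unfolding lin_def by (rule borel_measurable_gauss_prod_linear) auto

lemma measurable_G:
  "f \<in> measurable M (gauss_prod I) \<Longrightarrow> (\<lambda>x. G (f x)) \<in> borel_measurable M"
  unfolding G_def using lip_measurable[OF lip]
  by (intro borel_measurable_sum measurable_compose[OF measurable_lin]) auto

lemma lin_rot_minus:
  "lin k (rot S c s x y) - lin k x = (\<Sum>i\<in>S. A k i * ((c - 1) * x i + s * y i))"
proof -
  have "lin k (rot S c s x y) - lin k x = (\<Sum>i\<in>I. if i \<in> S then A k i * ((c - 1) * x i + s * y i) else 0)"
    unfolding lin_def sum_subtractf[symmetric] by (intro sum.cong) (auto simp: rot_def algebra_simps)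
  then show ?thesis using S fin by (simp add: sum.If_cases Int_absorb1)
qed

text \<open>
  Each of the \<open>n\<close> rotations maps a pair with the law of \<open>(x, y)\<close> to another such pair, so that after
  Jensen's inequality all \<open>n\<close> summands have the same expectation.
\<close>

lemma telescope:
  assumes "n > 0"
  defines "\<eta> \<equiv> pi / (2 * real n)"
  shows "(\<integral>\<^sup>+x. \<integral>\<^sup>+y. ennreal (exp (\<theta> * (G (rot S 0 1 x y) - G x))) \<partial>gauss_prod I \<partial>gauss_prod I) \<le>
    (\<integral>\<^sup>+x. \<integral>\<^sup>+y. ennreal (exp (\<theta> * (real n * (G (rot S (cos \<eta>) (sin \<eta>) x y) - G x)))) \<partial>gauss_prod I \<partial>gauss_prod I)"
    (is "?lhs \<le> ?rhs")
proof -
  define D where "D x y = ennreal (exp (\<theta> * (real n * (G (rot S (cos \<eta>) (sin \<eta>) x y) - G x))))" for x y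
  define X where "X r x y = rot S (cos (real r * \<eta>)) (sin (real r * \<eta>)) x y" for r x y
  define Y where "Y r x y = rot S (cos (real r * \<eta>)) (- sin (real r * \<eta>)) y x" for r x y
  \<comment> \<open>By the addition theorems, turning the r-th rotated pair by one more angle \<eta>
    gives the first component of the next one.\<close>
  have XS: "rot S (cos \<eta>) (sin \<eta>) (X r x y) (Y r x y) = X (Suc r) x y" for r x y
    by (auto simp: X_def Y_def rot_def fun_eq_iff cos_add sin_add algebra_simps)
  have X0: "X 0 x y = x" and Xn: "X n x y = rot S 0 1 x y" for x y
    using \<open>n > 0\<close> by (auto simp: X_def rot_def \<eta>_def)
  have mX: "(\<lambda>p. X r (f p) (g p)) \<in> measurable M (gauss_prod I)"
    if "f \<in> measurable M (gauss_prod I)" "g \<in> measurable M (gauss_prod I)" for r f g and M :: "'z measure"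
    unfolding X_def using that by (intro measurable_rot S)
  have mY: "(\<lambda>p. Y r (f p) (g p)) \<in> measurable M (gauss_prod I)"
    if "f \<in> measurable M (gauss_prod I)" "g \<in> measurable M (gauss_prod I)" for r f g and M :: "'z measure"
    unfolding Y_def using that by (intro measurable_rot S)
  have mD: "(\<lambda>p. D (f p) (g p)) \<in> borel_measurable M"
    if [measurable]: "f \<in> measurable M (gauss_prod I)" "g \<in> measurable M (gauss_prod I)" for f g and M :: "'z measure"
  proof -
    have [measurable]: "(\<lambda>p. G (f p)) \<in> borel_measurable M"
      "(\<lambda>p. G (rot S (cos \<eta>) (sin \<eta>) (f p) (g p))) \<in> borel_measurable M"
      by (intro measurable_G measurable_rot S that)+
    show ?thesis unfolding D_def by measurable
  qed
  note [measurable] = mX mY mD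
  have "?lhs \<le> (\<integral>\<^sup>+x. \<integral>\<^sup>+y. ennreal (1 / real n) * (\<Sum>r<n. D (X r x y) (Y r x y)) \<partial>gauss_prod I \<partial>gauss_prod I)"
  proof (intro nn_integral_mono)
    fix x y
    have "\<theta> * (G (rot S 0 1 x y) - G x) = (\<Sum>r<n. \<theta> * (G (X (Suc r) x y) - G (X r x y)))"
      unfolding sum_distrib_left[symmetric] sum_lessThan_telescope[of "\<lambda>r. G (X r x y)"] X0 Xn ..
    then have "exp (\<theta> * (G (rot S 0 1 x y) - G x)) \<le> (\<Sum>r<n. exp (real n * (\<theta> * (G (X (Suc r) x y) - G (X r x y))))) / real n"
      using exp_mean_le[OF \<open>n > 0\<close>, of "\<lambda>r. \<theta> * (G (X (Suc r) x y) - G (X r x y))"] by simp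
    also have "\<dots> = (1 / real n) * (\<Sum>r<n. exp (\<theta> * (real n * (G (rot S (cos \<eta>) (sin \<eta>) (X r x y) (Y r x y)) - G (X r x y)))))"
      by (simp add: XS mult_ac)
    finally show "ennreal (exp (\<theta> * (G (rot S 0 1 x y) - G x))) \<le> ennreal (1 / real n) * (\<Sum>r<n. D (X r x y) (Y r x y))"
      unfolding D_def by (simp add: sum_ennreal ennreal_mult'[symmetric] ennreal_leI del: times_divide_eq_left)
  qed
  also have "\<dots> = ennreal (1 / real n) * (\<Sum>r<n. \<integral>\<^sup>+x. \<integral>\<^sup>+y. D (X r x y) (Y r x y) \<partial>gauss_prod I \<partial>gauss_prod I)"
  proof -
    have "(\<integral>\<^sup>+y. ennreal (1 / real n) * (\<Sum>r<n. D (X r x y) (Y r x y)) \<partial>gauss_prod I) =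
      ennreal (1 / real n) * (\<Sum>r<n. \<integral>\<^sup>+y. D (X r x y) (Y r x y) \<partial>gauss_prod I)" if "x \<in> space (gauss_prod I)" for x
      using that by (subst nn_integral_cmult, measurable, subst nn_integral_sum, measurable)
    then have "(\<integral>\<^sup>+x. \<integral>\<^sup>+y. ennreal (1 / real n) * (\<Sum>r<n. D (X r x y) (Y r x y)) \<partial>gauss_prod I \<partial>gauss_prod I) =
      (\<integral>\<^sup>+x. ennreal (1 / real n) * (\<Sum>r<n. \<integral>\<^sup>+y. D (X r x y) (Y r x y) \<partial>gauss_prod I) \<partial>gauss_prod I)"
      by (intro nn_integral_cong)
    also have "\<dots> = ennreal (1 / real n) * (\<Sum>r<n. \<integral>\<^sup>+x. \<integral>\<^sup>+y. D (X r x y) (Y r x y) \<partial>gauss_prod I \<partial>gauss_prod I)"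
      by (subst nn_integral_cmult, measurable, subst nn_integral_sum, measurable)
    finally show ?thesis .
  qed
  also have "\<dots> = ennreal (1 / real n) * (\<Sum>r<n. \<integral>\<^sup>+x. \<integral>\<^sup>+y. D x y \<partial>gauss_prod I \<partial>gauss_prod I)"
    unfolding X_def Y_def
    by (subst nn_integral_rot[OF fin(1) S]) (simp_all add: mD)
  also have "\<dots> = ?rhs"
    using \<open>n > 0\<close> by (simp add: D_def[abs_def] mult.assoc[symmetric] ennreal_mult'[symmetric] flip: ennreal_of_nat_eq_real_of_nat)
       (simp add: ennreal_of_nat_eq_real_of_nat ennreal_mult'[symmetric])
  finally show ?thesis .
qed

text \<open>
  As \<open>n\<close> tends to infinity, the exponent tends to \<open>\<pi>/2\<close> times the derivative of \<open>G\<close> at \<open>x\<close> in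
  direction \<open>y\<close>, which for fixed \<open>x\<close> is a centred Gaussian.
\<close>

lemma maurey_pisier:
  "(\<integral>\<^sup>+x. \<integral>\<^sup>+y. ennreal (exp (\<theta> * (G (rot S 0 1 x y) - G x))) \<partial>gauss_prod I \<partial>gauss_prod I) \<le>
    ennreal (exp (\<theta>\<^sup>2 * pi\<^sup>2 * \<Lambda> * real (card K) / 8))"
    (is "?lhs \<le> _")
proof -
  let ?P = "gauss_prod I \<Otimes>\<^sub>M gauss_prod I"
  obtain \<phi>' where \<phi>' [measurable]: "\<phi>' \<in> borel_measurable borel"
    and d: "\<And>x. (\<phi> has_real_derivative \<phi>' x) (at x)" and b: "\<And>x. \<bar>\<phi>' x\<bar> \<le> 1"
    using diff_lip unfolding diff_lip_def by auto
  \<comment> \<open>The quarter turn is cut into \<open>Suc n\<close> steps, so that the angle is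
    defined for n = 0 as well.\<close>
  define \<eta> where "\<eta> n = pi / (2 * real (Suc n))" for n
  have \<eta>: "\<eta> n > 0" "real (Suc n) * \<eta> n = pi / 2" for n
    by (auto simp: \<eta>_def field_simps)
  have \<eta>0: "\<eta> \<longlonglongrightarrow> 0"
    unfolding \<eta>_def[abs_def] 
    using tendsto_mult_right_zero[OF LIMSEQ_inverse_real_of_nat, of "pi/2"] by (simp add: field_simps)
  define D where "D n x y = \<theta> * (real (Suc n) * (G (rot S (cos (\<eta> n)) (sin (\<eta> n)) x y) - G x))" for n x y
  define L where "L x y = \<theta> * (pi / 2 * (\<Sum>k\<in>K. \<phi>' (lin k x) * (\<Sum>i\<in>S. A k i * y i)))" for x y
  define B where "B i = \<bar>\<theta>\<bar> * (pi / 2 * (\<Sum>k\<in>K. \<bar>A k i\<bar>))" for i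
  define W where "W x = (\<Sum>i\<in>I. B i * \<bar>x i\<bar>)" for x
  have mD: "(\<lambda>p. D n (fst p) (snd p)) \<in> borel_measurable ?P" for n
    unfolding D_def
    by (intro borel_measurable_times borel_measurable_diff borel_measurable_const measurable_G measurable_rot S
          measurable_fst measurable_snd)
  have mW: "W \<in> borel_measurable (gauss_prod I)"
    unfolding W_def by measurable
  note [measurable] = mD mW mW[THEN measurable_compose[rotated]]
  have mL: "(\<lambda>p. L (fst p) (snd p)) \<in> borel_measurable ?P"
  proof -
    have [measurable]: "(\<lambda>p. lin k (fst p)) \<in> borel_measurable ?P"
      "(\<lambda>p. \<Sum>i\<in>S. A k i * snd p i) \<in> borel_measurable ?P" for k
      by (rule measurable_lin[OF measurable_fst] borel_measurable_gauss_prod_linear[OF measurable_snd S])+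
    show ?thesis unfolding L_def by measurable
  qed
  have lim: "(\<lambda>n. D n x y) \<longlonglongrightarrow> L x y" for x y
    unfolding D_def L_def
  proof (rule tendsto_mult_left)
    define u where "u k t = lin k (rot S (cos t) (sin t) x y)" for k t
    have u: "u k t = lin k x + (\<Sum>i\<in>S. A k i * ((cos t - 1) * x i + sin t * y i))" for k t
      using lin_rot_minus[of k "cos t" "sin t" x y] unfolding u_def by simp
    have u0: "u k 0 = lin k x" for k by (simp add: u)
    have du: "(u k has_real_derivative (\<Sum>i\<in>S. A k i * y i)) (at 0)" for k
      unfolding u[abs_def] by (auto intro!: derivative_eq_intros sum.cong)
    have "((\<lambda>t. \<phi> (u k t)) has_real_derivative \<phi>' (lin k x) * (\<Sum>i\<in>S. A k i * y i)) (at 0)" for k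
      using DERIV_chain2[of \<phi> "\<phi>' (lin k x)" "u k" 0, OF _ du] d[of "lin k x"] by (simp add: u0)
    then have "((\<lambda>t. \<Sum>k\<in>K. \<phi> (u k t)) has_real_derivative (\<Sum>k\<in>K. \<phi>' (lin k x) * (\<Sum>i\<in>S. A k i * y i))) (at 0)"
      by (intro DERIV_sum)
    then have "((\<lambda>t. ((\<Sum>k\<in>K. \<phi> (u k t)) - (\<Sum>k\<in>K. \<phi> (u k 0))) / (t - 0)) \<circ> \<eta>) \<longlonglongrightarrow> (\<Sum>k\<in>K. \<phi>' (lin k x) * (\<Sum>i\<in>S. A k i * y i))"
      unfolding has_field_derivative_iff tendsto_at_iff_sequentially
      by (elim allE[of _ \<eta>]) (use \<eta> \<eta>0 in \<open>auto simp: less_imp_neq[THEN not_sym]\<close>)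
    then have "(\<lambda>n. (pi / 2) * (((\<Sum>k\<in>K. \<phi> (u k (\<eta> n))) - (\<Sum>k\<in>K. \<phi> (u k 0))) / \<eta> n)) \<longlonglongrightarrow> (pi / 2) * (\<Sum>k\<in>K. \<phi>' (lin k x) * (\<Sum>i\<in>S. A k i * y i))"
      by (intro tendsto_mult_left) (simp add: comp_def)
    \<comment> \<open>Multiplying by the number of steps is the same as dividing by the angle and
      multiplying by \<pi>/2: the scaled increment is a difference quotient at angle 0.\<close>
    moreover have "(pi / 2) * (z / \<eta> n) = real (Suc n) * z" for z n
      using \<eta>(1)[of n] unfolding \<eta>(2)[symmetric, of n] by simp
    ultimately show "(\<lambda>n. real (Suc n) * (G (rot S (cos (\<eta> n)) (sin (\<eta> n)) x y) - G x)) \<longlonglongrightarrow> (pi / 2) * (\<Sum>k\<in>K. \<phi>' (lin k x) * (\<Sum>i\<in>S. A k i * y i))"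
      unfolding G_def u_def[symmetric] by (simp only: u0)
  qed
  \<comment> \<open>Domination uniform in n: both |cos \<eta> - 1| and |sin \<eta>| are at most
    \<eta>, and the number of steps times \<eta> is always \<pi>/2.\<close>
  have bound: "D n x y \<le> W x + W y" for n x y
  proof -
    have "\<bar>G (rot S (cos (\<eta> n)) (sin (\<eta> n)) x y) - G x\<bar> \<le> (\<Sum>k\<in>K. \<bar>\<phi> (lin k (rot S (cos (\<eta> n)) (sin (\<eta> n)) x y)) - \<phi> (lin k x)\<bar>)"
      unfolding G_def sum_subtractf[symmetric] by (rule sum_abs)
    also have "\<dots> \<le> (\<Sum>k\<in>K. \<Sum>i\<in>S. \<bar>A k i\<bar> * (\<eta> n * (\<bar>x i\<bar> + \<bar>y i\<bar>)))"
    proof (rule sum_mono)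
      fix k
      have "\<bar>\<phi> (lin k (rot S (cos (\<eta> n)) (sin (\<eta> n)) x y)) - \<phi> (lin k x)\<bar> \<le> \<bar>lin k (rot S (cos (\<eta> n)) (sin (\<eta> n)) x y) - lin k x\<bar>"
        by (rule lip_abs[OF lip])
      also have "\<dots> \<le> (\<Sum>i\<in>S. \<bar>A k i * ((cos (\<eta> n) - 1) * x i + sin (\<eta> n) * y i)\<bar>)"
        unfolding lin_rot_minus by (rule sum_abs)
      also have "\<dots> \<le> (\<Sum>i\<in>S. \<bar>A k i\<bar> * (\<eta> n * (\<bar>x i\<bar> + \<bar>y i\<bar>)))"
      proof (rule sum_mono)
        fix i
        have "\<bar>(cos (\<eta> n) - 1) * x i + sin (\<eta> n) * y i\<bar> \<le> \<bar>cos (\<eta> n) - 1\<bar> * \<bar>x i\<bar> + \<bar>sin (\<eta> n)\<bar> * \<bar>y i\<bar>"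
          unfolding abs_mult[symmetric] by (rule abs_triangle_ineq)
        also have "\<dots> \<le> \<eta> n * \<bar>x i\<bar> + \<eta> n * \<bar>y i\<bar>"
          using abs_one_minus_cos_le[of "\<eta> n"] abs_sin_x_le_abs_x[of "\<eta> n"] \<eta>(1)[of n]
          by (intro add_mono mult_right_mono) auto
        finally show "\<bar>A k i * ((cos (\<eta> n) - 1) * x i + sin (\<eta> n) * y i)\<bar> \<le> \<bar>A k i\<bar> * (\<eta> n * (\<bar>x i\<bar> + \<bar>y i\<bar>))"
          unfolding abs_mult[of "A k i"] by (intro mult_left_mono) (simp_all add: distrib_left[of "\<eta> n"])
      qed
      finally show "\<bar>\<phi> (lin k (rot S (cos (\<eta> n)) (sin (\<eta> n)) x y)) - \<phi> (lin k x)\<bar> \<le> (\<Sum>i\<in>S. \<bar>A k i\<bar> * (\<eta> n * (\<bar>x i\<bar> + \<bar>y i\<bar>)))" .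
    qed
    also have "\<dots> \<le> (\<Sum>k\<in>K. \<Sum>i\<in>I. \<bar>A k i\<bar> * (\<eta> n * (\<bar>x i\<bar> + \<bar>y i\<bar>)))"
      using \<eta>(1)[of n] S fin by (intro sum_mono sum_mono2) auto
    finally have g: "\<bar>G (rot S (cos (\<eta> n)) (sin (\<eta> n)) x y) - G x\<bar> \<le> (\<Sum>k\<in>K. \<Sum>i\<in>I. \<bar>A k i\<bar> * (\<eta> n * (\<bar>x i\<bar> + \<bar>y i\<bar>)))" .
    have "D n x y \<le> \<bar>D n x y\<bar>" by simp
    also have "\<dots> = \<bar>\<theta>\<bar> * (real (Suc n) * \<bar>G (rot S (cos (\<eta> n)) (sin (\<eta> n)) x y) - G x\<bar>)"
      by (simp add: D_def abs_mult)
    also have "\<dots> \<le> \<bar>\<theta>\<bar> * (real (Suc n) * (\<Sum>k\<in>K. \<Sum>i\<in>I. \<bar>A k i\<bar> * (\<eta> n * (\<bar>x i\<bar> + \<bar>y i\<bar>))))"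
      by (intro mult_left_mono g) auto
    also have "\<dots> = (\<Sum>k\<in>K. \<Sum>i\<in>I. \<bar>\<theta>\<bar> * (real (Suc n) * \<eta> n) * \<bar>A k i\<bar> * (\<bar>x i\<bar> + \<bar>y i\<bar>))"
      by (simp add: sum_distrib_left mult_ac)
    also have "\<dots> = (\<Sum>i\<in>I. \<Sum>k\<in>K. \<bar>\<theta>\<bar> * (pi / 2) * \<bar>A k i\<bar> * (\<bar>x i\<bar> + \<bar>y i\<bar>))"
      unfolding \<eta>(2) by (rule sum.swap)
    also have "\<dots> = (\<Sum>i\<in>I. B i * (\<bar>x i\<bar> + \<bar>y i\<bar>))"
      unfolding B_def by (simp add: sum_distrib_left sum_distrib_right mult_ac)
    also have "\<dots> = W x + W y"
      unfolding W_def by (simp add: distrib_left sum.distrib)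
    finally show ?thesis .
  qed
  have "(\<lambda>n. \<integral>\<^sup>+p. ennreal (exp (D n (fst p) (snd p))) \<partial>?P) \<longlonglongrightarrow> (\<integral>\<^sup>+p. ennreal (exp (L (fst p) (snd p))) \<partial>?P)"
  proof (rule nn_integral_dominated_convergence[where w = "\<lambda>p. ennreal (exp (W (fst p) + W (snd p)))"])
    show "AE p in ?P. ennreal (exp (D n (fst p) (snd p))) \<le> ennreal (exp (W (fst p) + W (snd p)))" for n
      using bound by (intro AE_I2 ennreal_leI) simp
    show "AE p in ?P. (\<lambda>n. ennreal (exp (D n (fst p) (snd p)))) \<longlonglongrightarrow> ennreal (exp (L (fst p) (snd p)))"
      using lim by (intro AE_I2 tendsto_ennrealI tendsto_exp)
    have "(\<integral>\<^sup>+p. ennreal (exp (W (fst p) + W (snd p))) \<partial>?P) = (\<integral>\<^sup>+x. \<integral>\<^sup>+y. ennreal (exp (W x)) * ennreal (exp (W y)) \<partial>gauss_prod I \<partial>gauss_prod I)"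
      by (subst nn_integral_gauss_prod_fst[symmetric]) (simp_all add: exp_add ennreal_mult')
    also have "\<dots> = (\<integral>\<^sup>+x. ennreal (exp (W x)) \<partial>gauss_prod I) * (\<integral>\<^sup>+x. ennreal (exp (W x)) \<partial>gauss_prod I)"
      by (simp add: nn_integral_cmult nn_integral_multc)
    also have "\<dots> < \<infinity>"
      using nn_integral_gauss_prod_exp_abs_finite[OF fin(1), of B] by (simp add: W_def ennreal_mult_less_top)
    finally show "(\<integral>\<^sup>+p. ennreal (exp (W (fst p) + W (snd p))) \<partial>?P) < \<infinity>" .
  qed (use mL in measurable)
  moreover have "?lhs \<le> (\<integral>\<^sup>+p. ennreal (exp (D n (fst p) (snd p))) \<partial>?P)" for n
    using telescope[of "Suc n" \<theta>] unfolding \<eta>_def[symmetric] D_def[symmetric]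
    by (subst nn_integral_gauss_prod_fst[symmetric]) simp_all
  ultimately have "?lhs \<le> (\<integral>\<^sup>+p. ennreal (exp (L (fst p) (snd p))) \<partial>?P)"
    by (intro LIMSEQ_le_const) auto
  also have "\<dots> = (\<integral>\<^sup>+x. \<integral>\<^sup>+y. ennreal (exp (L x y)) \<partial>gauss_prod I \<partial>gauss_prod I)"
    using mL by (subst nn_integral_gauss_prod_fst[symmetric]) simp_all
  also have "\<dots> \<le> (\<integral>\<^sup>+x. ennreal (exp (\<theta>\<^sup>2 * pi\<^sup>2 * \<Lambda> * real (card K) / 8)) \<partial>gauss_prod I)"
  proof (rule nn_integral_mono)
    fix x
    \<comment> \<open>For fixed x the limiting exponent is linear in y with coefficients c, a
      Gaussian of variance at most \<theta>^2 (\<pi>^2/4) \<Lambda> |K| because |\<phi>'| \<le> 1.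
      Half of this variance is the exponent in the claim.\<close>
    define c where "c i = \<theta> * (pi / 2) * (\<Sum>k\<in>K. A k i * \<phi>' (lin k x))" for i
    have "L x y = (\<Sum>i\<in>S. c i * y i)" for y
    proof -
      have "L x y = (\<Sum>k\<in>K. \<Sum>i\<in>S. \<theta> * (pi / 2) * (A k i * \<phi>' (lin k x)) * y i)"
        unfolding L_def by (simp add: sum_distrib_left mult_ac)
      also have "\<dots> = (\<Sum>i\<in>S. \<Sum>k\<in>K. \<theta> * (pi / 2) * (A k i * \<phi>' (lin k x)) * y i)"
        by (rule sum.swap)
      finally show ?thesis unfolding c_def by (simp add: sum_distrib_left sum_distrib_right)
    qed
    then have "(\<integral>\<^sup>+y. ennreal (exp (L x y)) \<partial>gauss_prod I) = ennreal (exp ((\<Sum>i\<in>S. (c i)\<^sup>2) / 2))"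
      using nn_integral_gauss_prod_exp_linear[OF fin(1) S] by simp
    also have "\<dots> \<le> ennreal (exp (\<theta>\<^sup>2 * pi\<^sup>2 * \<Lambda> * real (card K) / 8))"
    proof (cases "S = {}")
      case True
      have "0 \<le> \<Lambda> * real (card K)" using op[of "\<lambda>_. 1"] True by simp
      then show ?thesis using True by (simp add: mult.assoc mult_nonneg_nonneg)
    next
      case False
      have "(\<Sum>i\<in>S. (c i)\<^sup>2) = \<theta>\<^sup>2 * pi\<^sup>2 / 4 * (\<Sum>i\<in>S. (\<Sum>k\<in>K. A k i * \<phi>' (lin k x))\<^sup>2)"
        unfolding c_def power_mult_distrib sum_distrib_left[symmetric] by (simp add: power_divide)
      also have "\<dots> \<le> \<theta>\<^sup>2 * pi\<^sup>2 / 4 * (\<Lambda> * real (card K))"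
      proof (intro mult_left_mono)
        \<comment> \<open>The sign of \<Lambda> follows from \<open>op\<close> at the all-ones
          vector.\<close>
        have "0 \<le> \<Lambda>" if "K \<noteq> {}"
        proof -
          have "0 \<le> (\<Sum>i\<in>S. (\<Sum>k\<in>K. A k i * 1)\<^sup>2)" by (intro sum_nonneg) auto
          also have "\<dots> \<le> \<Lambda> * (\<Sum>k\<in>K. 1\<^sup>2)" by (rule op)
          finally show ?thesis using that fin by (simp add: zero_le_mult_iff card_gt_0_iff)
        qed
        moreover have "(\<Sum>k\<in>K. (\<phi>' (lin k x))\<^sup>2) \<le> (\<Sum>k\<in>K. 1)"
          using b by (intro sum_mono) (simp add: abs_square_le_1)
        ultimately have "\<Lambda> * (\<Sum>k\<in>K. (\<phi>' (lin k x))\<^sup>2) \<le> \<Lambda> * real (card K)"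
          by (cases "K = {}") (auto intro: mult_left_mono)
        then show "(\<Sum>i\<in>S. (\<Sum>k\<in>K. A k i * \<phi>' (lin k x))\<^sup>2) \<le> \<Lambda> * real (card K)"
          using op[of "\<lambda>k. \<phi>' (lin k x)"] by linarith
      qed auto
      finally show ?thesis by (intro ennreal_leI) simp
    qed
    finally show "(\<integral>\<^sup>+y. ennreal (exp (L x y)) \<partial>gauss_prod I) \<le> ennreal (exp (\<theta>\<^sup>2 * pi\<^sup>2 * \<Lambda> * real (card K) / 8))" .
  qed
  also have "\<dots> = ennreal (exp (\<theta>\<^sup>2 * pi\<^sup>2 * \<Lambda> * real (card K) / 8))"
    by (simp add: prob_space.emeasure_space_1[OF prob_space_gauss_prod])
  finally show ?thesis .
qed

lemma exp_moment:
  assumes \<sigma>: "\<sigma> \<ge> 0" "\<And>k. k \<in> K \<Longrightarrow> (\<Sum>i\<in>S. (A k i)\<^sup>2) = \<sigma>\<^sup>2"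
  shows "(\<integral>\<^sup>+x. ennreal (exp (\<theta> * (\<Sum>k\<in>K. \<phi> (lin k x) - gauss_smooth \<phi> \<sigma> (\<Sum>i\<in>I - S. A k i * x i)))) \<partial>gauss_prod I) \<le>
    ennreal (exp (\<theta>\<^sup>2 * pi\<^sup>2 * \<Lambda> * real (card K) / 8))"
proof -
  have "(\<integral>\<^sup>+x. ennreal (exp (\<theta> * (\<Sum>k\<in>K. \<phi> (lin k x) - gauss_smooth \<phi> \<sigma> (\<Sum>i\<in>I - S. A k i * x i)))) \<partial>gauss_prod I) \<le>
    (\<integral>\<^sup>+x. \<integral>\<^sup>+y. ennreal (exp ((-\<theta>) * (G (rot S 0 1 x y) - G x))) \<partial>gauss_prod I \<partial>gauss_prod I)"
  proof (rule nn_integral_mono)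
    fix x
      define c where "c k i = (if i \<in> S then A k i else 0)" for k i
    define a where "a k = (\<Sum>i\<in>I - S. A k i * x i)" for k
    have l: "lin k (rot S 0 1 x y) = a k + (\<Sum>i\<in>I. c k i * y i)" for k y
    proof -
      have "lin k (rot S 0 1 x y) = (\<Sum>i\<in>I - S. A k i * rot S 0 1 x y i) + (\<Sum>i\<in>S. A k i * rot S 0 1 x y i)"
        unfolding lin_def by (rule sum.subset_diff[OF S fin(1)])
      also have "(\<Sum>i\<in>I - S. A k i * rot S 0 1 x y i) = a k"
        unfolding a_def by (intro sum.cong) (auto simp: rot_def)
      also have "(\<Sum>i\<in>S. A k i * rot S 0 1 x y i) = (\<Sum>i\<in>S. A k i * y i)"
        by (intro sum.cong) (auto simp: rot_def)
      also have "\<dots> = (\<Sum>i\<in>I. if i \<in> S then A k i * y i else 0)"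
        using fin S by (simp add: sum.If_cases Int_absorb1)
      also have "\<dots> = (\<Sum>i\<in>I. c k i * y i)"
        by (intro sum.cong) (auto simp: c_def)
      finally show ?thesis .
    qed
    have c2: "sqrt (\<Sum>i\<in>I. (c k i)\<^sup>2) = \<sigma>" if "k \<in> K" for k
    proof -
      have "(\<Sum>i\<in>I. (c k i)\<^sup>2) = (\<Sum>i\<in>I. if i \<in> S then (A k i)\<^sup>2 else 0)"
        by (intro sum.cong) (auto simp: c_def)
      also have "\<dots> = \<sigma>\<^sup>2" using fin S \<sigma>(2)[OF that] by (simp add: sum.If_cases Int_absorb1)
      finally show ?thesis using \<sigma>(1) by simp
    qed
    have int: "integrable (gauss_prod I) (\<lambda>y. \<phi> (lin k (rot S 0 1 x y)))" for k
      unfolding l by (rule integrable_lip_linear[OF lip fin(1)])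
    have intG: "integrable (gauss_prod I) (\<lambda>y. (-\<theta>) * (G (rot S 0 1 x y) - G x))"
      unfolding G_def by (intro integrable_mult_right Bochner_Integration.integrable_diff Bochner_Integration.integrable_sum int) simp
    have "(\<integral>y. (-\<theta>) * (G (rot S 0 1 x y) - G x) \<partial>gauss_prod I) = (-\<theta>) * ((\<Sum>k\<in>K. \<integral>y. \<phi> (lin k (rot S 0 1 x y)) \<partial>gauss_prod I) - G x)"
      unfolding G_def using int by (simp add: prob_space.prob_space[OF prob_space_gauss_prod])
    also have "(\<Sum>k\<in>K. \<integral>y. \<phi> (lin k (rot S 0 1 x y)) \<partial>gauss_prod I) = (\<Sum>k\<in>K. gauss_smooth \<phi> \<sigma> (a k))"
      unfolding l by (intro sum.cong refl) (simp add: integral_lip_linear[OF lip fin(1)] c2)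
    finally have "\<theta> * (\<Sum>k\<in>K. \<phi> (lin k x) - gauss_smooth \<phi> \<sigma> (a k)) = (\<integral>y. (-\<theta>) * (G (rot S 0 1 x y) - G x) \<partial>gauss_prod I)"
      unfolding G_def by (simp add: sum_subtractf algebra_simps)
    then show "ennreal (exp (\<theta> * (\<Sum>k\<in>K. \<phi> (lin k x) - gauss_smooth \<phi> \<sigma> (\<Sum>i\<in>I - S. A k i * x i)))) \<le>
      (\<integral>\<^sup>+y. ennreal (exp ((-\<theta>) * (G (rot S 0 1 x y) - G x))) \<partial>gauss_prod I)"
      using jensen_exp[OF prob_space_gauss_prod intG] unfolding a_def by simp
  qed
  also have "\<dots> \<le> ennreal (exp ((-\<theta>)\<^sup>2 * pi\<^sup>2 * \<Lambda> * real (card K) / 8))"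
    by (rule maurey_pisier)
  finally show ?thesis by simp
qed

end

section \<open>Concentration at one magnitude level\<close>

text \<open>The three properties of the Hadamard matrix on which the argument rests. Unit entries
  give every row the same conditional variance, the identity \<open>rows\<close> bounds the operator
  norm in the concentration step, and \<open>cols\<close> computes the Euclidean size of the
  transform.\<close>

locale flat_orthogonal =
  fixes d :: nat and H :: "nat \<Rightarrow> nat \<Rightarrow> real"
  assumes d_pos: "d > 0"
    and flat: "\<And>k i. k < d \<Longrightarrow> i < d \<Longrightarrow> (H k i)\<^sup>2 = 1"
    and cols: "\<And>y. (\<Sum>k<d. (\<Sum>i<d. H k i * y i)\<^sup>2) = real d * (\<Sum>i<d. (y i)\<^sup>2)"
    and rows: "\<And>y. (\<Sum>i<d. (\<Sum>k<d. H k i * y k)\<^sup>2) = real d * (\<Sum>k<d. (y k)\<^sup>2)"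
begin

definition h :: "(nat \<times> nat \<Rightarrow> real) \<Rightarrow> (nat \<Rightarrow> real) \<Rightarrow> nat \<Rightarrow> nat \<Rightarrow> real" where
  "h \<omega> z j k = (\<Sum>i<d. H k i * (z i * \<omega> (j, i)))"

text \<open>The matrix of the map from the diagonals to the transform of the fixed vector z. It is
  block diagonal, since block j of the transform involves the j-th diagonal only.\<close>

definition coef :: "(nat \<Rightarrow> real) \<Rightarrow> nat \<times> nat \<Rightarrow> nat \<times> nat \<Rightarrow> real" where
  "coef z = (\<lambda>(j, k) (j', i). if j = j' then H k i * z i else 0)"

text \<open>The generic g covers both the linear forms and the sums of squared coefficients; in
  either use g vanishes at coefficient 0, and so does the contribution of the foreign
  blocks.\<close>

lemma sum_coef:
  assumes "j < m" "U \<subseteq> {..<d}"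
  shows "(\<Sum>p\<in>{..<m} \<times> U. g (coef z (j, k) p) p) =
    (\<Sum>i\<in>U. g (H k i * z i) (j, i)) + (\<Sum>j'\<in>{..<m} - {j}. \<Sum>i\<in>U. g 0 (j', i))"
proof -
  have "(\<Sum>p\<in>{..<m} \<times> U. g (coef z (j, k) p) p) = (\<Sum>j'<m. \<Sum>i\<in>U. g (coef z (j, k) (j', i)) (j', i))"
    by (subst sum.cartesian_product) (simp add: case_prod_unfold)
  also have "\<dots> = (\<Sum>i\<in>U. g (coef z (j, k) (j, i)) (j, i)) + (\<Sum>j'\<in>{..<m} - {j}. \<Sum>i\<in>U. g (coef z (j, k) (j', i)) (j', i))"
    using assms by (subst sum.remove[of _ j]) auto
  also have "\<dots> = (\<Sum>i\<in>U. g (H k i * z i) (j, i)) + (\<Sum>j'\<in>{..<m} - {j}. \<Sum>i\<in>U. g 0 (j', i))"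
    by (intro arg_cong2[of _ _ _ _ "(+)"] sum.cong refl) (auto simp: coef_def)
  finally show ?thesis .
qed

text \<open>On block j' the transposed matrix multiplies by the transpose of H and then by the
  entries of z. The former scales squared norms by d, the latter by at most b^2 on U.\<close>

lemma lip_linear_statistic_coef:
  assumes U: "U \<subseteq> {..<d}" and "diff_lip \<phi>" and b: "\<And>i. i \<in> U \<Longrightarrow> \<bar>z i\<bar> \<le> b"
  shows "lip_linear_statistic ({..<m} \<times> {..<d}) ({..<m} \<times> {..<d}) ({..<m} \<times> U) (coef z) \<phi> (b\<^sup>2 * real d)"
proof
  fix p :: "nat \<times> nat \<Rightarrow> real"
  have inner: "(\<Sum>q\<in>{..<m} \<times> {..<d}. coef z q (j', i) * p q) = z i * (\<Sum>k<d. H k i * p (j', k))" if "j' < m" for j' i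
  proof -
    have "(\<Sum>q\<in>{..<m} \<times> {..<d}. coef z q (j', i) * p q) = (\<Sum>j<m. \<Sum>k<d. coef z (j, k) (j', i) * p (j, k))"
      by (subst sum.cartesian_product) (simp add: case_prod_unfold)
    also have "\<dots> = (\<Sum>k<d. coef z (j', k) (j', i) * p (j', k)) + (\<Sum>j\<in>{..<m} - {j'}. \<Sum>k<d. coef z (j, k) (j', i) * p (j, k))"
      using that by (subst sum.remove[of _ j']) auto
    also have "(\<Sum>j\<in>{..<m} - {j'}. \<Sum>k<d. coef z (j, k) (j', i) * p (j, k)) = 0"
      by (intro sum.neutral ballI) (auto simp: coef_def)
    finally show ?thesis by (simp add: coef_def sum_distrib_left mult_ac)
  qed
  have "(\<Sum>i\<in>{..<m} \<times> U. (\<Sum>k\<in>{..<m} \<times> {..<d}. coef z k i * p k)\<^sup>2) =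
      (\<Sum>j'<m. \<Sum>i\<in>U. (\<Sum>k\<in>{..<m} \<times> {..<d}. coef z k (j', i) * p k)\<^sup>2)"
    by (subst sum.cartesian_product) (simp add: case_prod_unfold)
  also have "\<dots> = (\<Sum>j'<m. \<Sum>i\<in>U. (z i)\<^sup>2 * (\<Sum>k<d. H k i * p (j', k))\<^sup>2)"
    by (simp add: inner power_mult_distrib)
  also have "\<dots> \<le> (\<Sum>j'<m. \<Sum>i<d. b\<^sup>2 * (\<Sum>k<d. H k i * p (j', k))\<^sup>2)"
  proof (rule sum_mono)
    fix j'
    have "(\<Sum>i\<in>U. (z i)\<^sup>2 * (\<Sum>k<d. H k i * p (j', k))\<^sup>2) \<le> (\<Sum>i\<in>U. b\<^sup>2 * (\<Sum>k<d. H k i * p (j', k))\<^sup>2)"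
    proof (intro sum_mono mult_right_mono)
      fix i assume "i \<in> U"
      then have "\<bar>z i\<bar>\<^sup>2 \<le> b\<^sup>2" by (intro power_mono b) auto
      then show "(z i)\<^sup>2 \<le> b\<^sup>2" by simp
    qed auto
    also have "\<dots> \<le> (\<Sum>i<d. b\<^sup>2 * (\<Sum>k<d. H k i * p (j', k))\<^sup>2)"
      using U by (intro sum_mono2) auto
    finally show "(\<Sum>i\<in>U. (z i)\<^sup>2 * (\<Sum>k<d. H k i * p (j', k))\<^sup>2) \<le> (\<Sum>i<d. b\<^sup>2 * (\<Sum>k<d. H k i * p (j', k))\<^sup>2)" .
  qed
  also have "\<dots> = b\<^sup>2 * real d * (\<Sum>j'<m. \<Sum>k<d. (p (j', k))\<^sup>2)"
    by (simp add: sum_distrib_left[symmetric] rows mult.assoc)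
  also have "(\<Sum>j'<m. \<Sum>k<d. (p (j', k))\<^sup>2) = (\<Sum>k\<in>{..<m} \<times> {..<d}. (p k)\<^sup>2)"
    by (subst sum.cartesian_product) (simp add: case_prod_unfold)
  finally show "(\<Sum>i\<in>{..<m} \<times> U. (\<Sum>k\<in>{..<m} \<times> {..<d}. coef z k i * p k)\<^sup>2) \<le> b\<^sup>2 * real d * (\<Sum>k\<in>{..<m} \<times> {..<d}. (p k)\<^sup>2)" .
qed (use assms in auto)

abbreviation "diags m \<equiv> gauss_prod ({..<m} \<times> {..<d}) :: (nat \<times> nat \<Rightarrow> real) measure"

lemma measurable_h:
  assumes "j < m"
  shows "(\<lambda>\<omega>. h \<omega> z j k) \<in> borel_measurable (diags m)"
proof -
  have [measurable]: "(\<lambda>\<omega>. \<omega> (j, i)) \<in> borel_measurable (diags m)" if "i < d" for i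
    using that assms by (intro measurable_gauss_prod_component[where I = "{..<m} \<times> {..<d}" and f = "\<lambda>\<omega>. \<omega>"]) auto
  show ?thesis unfolding h_def
    by (intro borel_measurable_sum borel_measurable_times borel_measurable_const) measurable
qed

definition cutoff :: "real \<Rightarrow> (nat \<Rightarrow> real) \<Rightarrow> nat \<Rightarrow> real" where
  "cutoff r z = (\<lambda>i. if \<bar>z i\<bar> \<le> r then 0 else z i)"

definition small_norm :: "real \<Rightarrow> (nat \<Rightarrow> real) \<Rightarrow> real" where
  "small_norm r z = sqrt (\<Sum>i | i < d \<and> \<bar>z i\<bar> \<le> r. (z i)\<^sup>2)"

text \<open>
  The smoothed term is the conditional expectation of the first one, given the diagonal entries that
  meet a coordinate of \<open>z\<close> larger than \<open>r\<close>.
\<close>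

definition level_dev :: "nat \<Rightarrow> (real \<Rightarrow> real) \<Rightarrow> (nat \<Rightarrow> real) \<Rightarrow> real \<Rightarrow> (nat \<times> nat \<Rightarrow> real) \<Rightarrow> real" where
  "level_dev m \<phi> z r \<omega> = (\<Sum>j<m. \<Sum>k<d. \<phi> (h \<omega> z j k) -
     gauss_smooth \<phi> (small_norm r z) (h \<omega> (cutoff r z) j k))"

lemma measurable_level_dev:
  assumes "diff_lip \<phi>"
  shows "level_dev m \<phi> z r \<in> borel_measurable (diags m)"
  unfolding level_dev_def[abs_def]
  by (intro borel_measurable_sum borel_measurable_diff measurable_compose[OF measurable_h]
       lip_measurable gauss_smooth_lip diff_lip_imp_lip assms) auto

text \<open>The resampled coordinates are the diagonal entries, in all m blocks, that meet an entry
  of z of size at most r. Then \<Lambda> = r^2 d and there are m d linear forms; the constant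
  \<pi>^2/8 is rounded up to 2.\<close>

lemma level_dev_exp_moment:
  assumes "diff_lip \<phi>" "r \<ge> 0"
  shows "(\<integral>\<^sup>+\<omega>. ennreal (exp (\<theta> * level_dev m \<phi> z r \<omega>)) \<partial>diags m) \<le> ennreal (exp (2 * \<theta>\<^sup>2 * r\<^sup>2 * real m * (real d)\<^sup>2))"
proof -
  define U where "U = {i. i < d \<and> \<bar>z i\<bar> \<le> r}"
  define \<sigma> where "\<sigma> = small_norm r z"
  define I where "I = {..<m} \<times> {..<d}"
  have U: "U \<subseteq> {..<d}" by (auto simp: U_def)
  interpret lip_linear_statistic I I "{..<m} \<times> U" "coef z" \<phi> "r\<^sup>2 * real d"
    unfolding I_def by (rule lip_linear_statistic_coef) (use assms in \<open>auto simp: U_def\<close>)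
  have \<sigma>2: "(\<Sum>i\<in>{..<m} \<times> U. (coef z q i)\<^sup>2) = \<sigma>\<^sup>2" if "q \<in> I" for q
  proof -
    obtain j k where q: "q = (j, k)" "j < m" "k < d" using \<open>q \<in> I\<close> by (auto simp: I_def)
    have "(\<Sum>i\<in>{..<m} \<times> U. (coef z q i)\<^sup>2) = (\<Sum>i\<in>U. (H k i * z i)\<^sup>2)"
      using sum_coef[OF q(2) U, of "\<lambda>c _. c\<^sup>2" z k] by (simp add: q)
    also have "\<dots> = (\<Sum>i\<in>U. (z i)\<^sup>2)"
      using q U by (intro sum.cong refl) (auto simp: power_mult_distrib flat)
    finally show ?thesis by (simp add: \<sigma>_def small_norm_def U_def sum_nonneg)
  qed
  have lin: "lin (j, k) \<omega> = h \<omega> z j k" if "j < m" for j k \<omega>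
    unfolding lin_def unfolding I_def h_def
    using sum_coef[OF that, of "{..<d}" "\<lambda>c p. c * \<omega> p" z k] by (simp add: mult_ac)
  have rest: "(\<Sum>i\<in>I - {..<m} \<times> U. coef z (j, k) i * \<omega> i) = h \<omega> (cutoff r z) j k"
    if "j < m" for j k \<omega>
  proof -
    have "I - {..<m} \<times> U = {..<m} \<times> ({..<d} - U)" by (auto simp: I_def)
    then have "(\<Sum>i\<in>I - {..<m} \<times> U. coef z (j, k) i * \<omega> i) = (\<Sum>i\<in>{..<d} - U. H k i * z i * \<omega> (j, i))"
      using sum_coef[OF that, of "{..<d} - U" "\<lambda>c p. c * \<omega> p" z k] by simp
    also have "\<dots> = h \<omega> (cutoff r z) j k"
      unfolding h_def by (intro sum.mono_neutral_cong_left) (auto simp: U_def cutoff_def)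
    finally show ?thesis .
  qed
  have "level_dev m \<phi> z r \<omega> = (\<Sum>q\<in>I. \<phi> (lin q \<omega>) - gauss_smooth \<phi> \<sigma> (\<Sum>i\<in>I - {..<m} \<times> U. coef z q i * \<omega> i))" for \<omega>
  proof -
    have "(\<Sum>q\<in>I. \<phi> (lin q \<omega>) - gauss_smooth \<phi> \<sigma> (\<Sum>i\<in>I - {..<m} \<times> U. coef z q i * \<omega> i)) =
      (\<Sum>j<m. \<Sum>k<d. \<phi> (lin (j, k) \<omega>) - gauss_smooth \<phi> \<sigma> (\<Sum>i\<in>I - {..<m} \<times> U. coef z (j, k) i * \<omega> i))"
      by (subst (2) I_def, subst sum.cartesian_product) (simp only: case_prod_unfold prod.collapse)
    also have "\<dots> = (\<Sum>j<m. \<Sum>k<d. \<phi> (h \<omega> z j k) - gauss_smooth \<phi> \<sigma> (h \<omega> (cutoff r z) j k))"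
      by (intro sum.cong refl) (simp only: lin rest lessThan_iff)
    finally show ?thesis unfolding level_dev_def \<sigma>_def by (rule sym)
  qed
  then have "(\<integral>\<^sup>+\<omega>. ennreal (exp (\<theta> * level_dev m \<phi> z r \<omega>)) \<partial>diags m) \<le> ennreal (exp (\<theta>\<^sup>2 * pi\<^sup>2 * (r\<^sup>2 * real d) * real (card I) / 8))"
    using exp_moment[of \<sigma> \<theta>] \<sigma>2 by (simp add: I_def[symmetric] \<sigma>_def small_norm_def sum_nonneg)
  also have "\<dots> \<le> ennreal (exp (2 * \<theta>\<^sup>2 * r\<^sup>2 * real m * (real d)\<^sup>2))"
  proof -
    have "pi\<^sup>2 \<le> 4\<^sup>2" using pi_less_4 pi_gt_zero by (intro power_mono) auto
    then have "pi\<^sup>2 / 8 * (\<theta>\<^sup>2 * r\<^sup>2 * real m * (real d)\<^sup>2) \<le> 2 * (\<theta>\<^sup>2 * r\<^sup>2 * real m * (real d)\<^sup>2)"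
      by (intro mult_right_mono) auto
    then show ?thesis
      by (intro ennreal_leI) (simp add: I_def mult_ac power2_eq_square)
  qed
  finally show ?thesis .
qed

lemma level_dev_tail1:
  assumes "diff_lip \<phi>" "r > 0" "t > 0"
  shows "emeasure (diags m) {\<omega> \<in> space (diags m). real m * real d * t \<le> level_dev m \<phi> z r \<omega>} \<le>
    ennreal (exp (- (real m * t\<^sup>2 / (8 * r\<^sup>2))))"
proof -
  \<comment> \<open>The minimizer of - \<theta> m d t + 2 \<theta>^2 r^2 m d^2.\<close>
  define \<theta> where "\<theta> = t / (4 * r\<^sup>2 * real d)"
  have \<theta>: "\<theta> > 0" using assms d_pos by (simp add: \<theta>_def)
  note [measurable] = measurable_level_dev[OF assms(1), of m z r]
  have "emeasure (diags m) {\<omega> \<in> space (diags m). real m * real d * t \<le> level_dev m \<phi> z r \<omega>} \<le>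
    ennreal (exp (- \<theta> * (real m * real d * t))) * (\<integral>\<^sup>+\<omega>. ennreal (exp (\<theta> * level_dev m \<phi> z r \<omega>)) * indicator (space (diags m)) \<omega> \<partial>diags m)"
    by (rule Chernoff_ineq_nn_integral_ge[OF \<theta>]) measurable
  also have "\<dots> = ennreal (exp (- \<theta> * (real m * real d * t))) * (\<integral>\<^sup>+\<omega>. ennreal (exp (\<theta> * level_dev m \<phi> z r \<omega>)) \<partial>diags m)"
    by (intro arg_cong2[where f = "(*)"] refl nn_integral_cong) simp
  also have "\<dots> \<le> ennreal (exp (- \<theta> * (real m * real d * t))) * ennreal (exp (2 * \<theta>\<^sup>2 * r\<^sup>2 * real m * (real d)\<^sup>2))"
    using assms by (intro mult_left_mono level_dev_exp_moment) auto
  also have "\<dots> = ennreal (exp (- \<theta> * (real m * real d * t) + 2 * \<theta>\<^sup>2 * r\<^sup>2 * real m * (real d)\<^sup>2))"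
    unfolding exp_add by (simp add: ennreal_mult')
  also have "- \<theta> * (real m * real d * t) + 2 * \<theta>\<^sup>2 * r\<^sup>2 * real m * (real d)\<^sup>2 = - (real m * t\<^sup>2 / (8 * r\<^sup>2))"
    using assms d_pos unfolding \<theta>_def by (simp add: field_simps power2_eq_square)
  finally show ?thesis .
qed

lemma gauss_smooth_uminus: "gauss_smooth (\<lambda>x. - \<phi> x) \<sigma> a = - gauss_smooth \<phi> \<sigma> a"
  by (simp add: gauss_smooth_def)

lemma level_dev_tail:
  assumes "diff_lip \<phi>" "r > 0" "t > 0"
  shows "emeasure (diags m) {\<omega> \<in> space (diags m). real m * real d * t \<le> \<bar>level_dev m \<phi> z r \<omega>\<bar>} \<le>
    ennreal (2 * exp (- (real m * t\<^sup>2 / (8 * r\<^sup>2))))"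
proof -
  have neg: "level_dev m (\<lambda>x. - \<phi> x) z r \<omega> = - level_dev m \<phi> z r \<omega>" for \<omega>
    by (simp add: level_dev_def gauss_smooth_uminus sum_negf[symmetric])
  note [measurable] = measurable_level_dev[OF assms(1), of m z r]
  let ?A = "{\<omega> \<in> space (diags m). real m * real d * t \<le> level_dev m \<phi> z r \<omega>}"
  let ?B = "{\<omega> \<in> space (diags m). real m * real d * t \<le> - level_dev m \<phi> z r \<omega>}"
  have "{\<omega> \<in> space (diags m). real m * real d * t \<le> \<bar>level_dev m \<phi> z r \<omega>\<bar>} = ?A \<union> ?B"
    by auto
  moreover have "emeasure (diags m) (?A \<union> ?B) \<le> emeasure (diags m) ?A + emeasure (diags m) ?B"
    by (rule emeasure_subadditive) measurable
  moreover have "emeasure (diags m) ?A + emeasure (diags m) ?B \<le>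
    ennreal (exp (- (real m * t\<^sup>2 / (8 * r\<^sup>2)))) + ennreal (exp (- (real m * t\<^sup>2 / (8 * r\<^sup>2))))"
    by (intro add_mono level_dev_tail1[OF assms] level_dev_tail1[OF diff_lip_uminus[OF assms(1)] assms(2,3), of m z, unfolded neg])
  moreover have "ennreal x + ennreal x = ennreal (2 * x)" if "x \<ge> 0" for x
    using ennreal_plus[OF that that] by (simp only: mult_2)
  moreover note this[OF exp_ge_zero, of "- (real m * t\<^sup>2 / (8 * r\<^sup>2))"]
  ultimately show ?thesis by (simp only:)
qed


section \<open>Chaining and the union bound\<close>

lemma h_cong: "(\<And>i. i < d \<Longrightarrow> z i = z' i) \<Longrightarrow> h \<omega> z j k = h \<omega> z' j k"
  unfolding h_def by (intro sum.cong) auto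

lemma h_zero: "(\<And>i. i < d \<Longrightarrow> z i = 0) \<Longrightarrow> h \<omega> z j k = 0"
  unfolding h_def by (intro sum.neutral) auto

text \<open>Let V l be the empirical sum in which all entries of size at most 2^-l have been
  replaced by their Gaussian average. Each deviation is an increment of V. By \<open>small\<close>
  nothing has been averaged in V L, and as all entries are at most 1 in size, everything has been
  averaged in V 0.\<close>

lemma chain:
  assumes f: "1-lipschitz_on UNIV f"
    and z: "(\<Sum>i<d. (z i)\<^sup>2) \<le> 1"
    and small: "\<And>i. i < d \<Longrightarrow> z i \<noteq> 0 \<Longrightarrow> \<bar>z i\<bar> > (1/2) ^ L"
    and good: "\<And>l. l < L \<Longrightarrow>
      \<bar>level_dev m (gauss_smooth f (small_norm ((1/2) ^ Suc l) z)) (cutoff ((1/2) ^ Suc l) z) ((1/2) ^ l) \<omega>\<bar> \<le> T"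
  shows "\<bar>(\<Sum>j<m. \<Sum>k<d. f (h \<omega> z j k)) - real m * real d * gauss_smooth f (sqrt (\<Sum>i<d. (z i)\<^sup>2)) 0\<bar> \<le> real L * T"
proof -
  define V where "V l = (\<Sum>j<m. \<Sum>k<d. gauss_smooth f (small_norm ((1/2) ^ l) z) (h \<omega> (cutoff ((1/2) ^ l) z) j k))" for l
  have step: "level_dev m (gauss_smooth f (small_norm ((1/2) ^ Suc l) z)) (cutoff ((1/2) ^ Suc l) z) ((1/2) ^ l) \<omega> = V (Suc l) - V l" for l
  proof -
    define a b :: real where "a = (1/2) ^ Suc l" and "b = (1/2) ^ l"
    have ab: "0 < a" "a \<le> b" by (auto simp: a_def b_def)
    have "cutoff b (cutoff a z) = cutoff b z"
      using ab by (auto simp: cutoff_def fun_eq_iff)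
    \<comment> \<open>The entries up to a and those between a and b form a partition of the entries
      up to b, so their variances add up as the semigroup law demands.\<close>
    moreover have "gauss_smooth (gauss_smooth f (small_norm a z)) (small_norm b (cutoff a z)) = gauss_smooth f (small_norm b z)"
    proof -
      have "(small_norm b (cutoff a z))\<^sup>2 + (small_norm a z)\<^sup>2 =
        (\<Sum>i | i < d \<and> \<bar>cutoff a z i\<bar> \<le> b. (cutoff a z i)\<^sup>2) + (\<Sum>i | i < d \<and> \<bar>z i\<bar> \<le> a. (z i)\<^sup>2)"
        by (simp add: small_norm_def sum_nonneg)
      also have "(\<Sum>i | i < d \<and> \<bar>cutoff a z i\<bar> \<le> b. (cutoff a z i)\<^sup>2) = (\<Sum>i | i < d \<and> a < \<bar>z i\<bar> \<and> \<bar>z i\<bar> \<le> b. (z i)\<^sup>2)"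
        using ab by (intro sum.mono_neutral_cong_right) (auto simp: cutoff_def)
      also have "\<dots> + (\<Sum>i | i < d \<and> \<bar>z i\<bar> \<le> a. (z i)\<^sup>2) = (\<Sum>i | i < d \<and> \<bar>z i\<bar> \<le> b. (z i)\<^sup>2)"
        using ab by (subst sum.union_disjoint[symmetric]) (auto intro!: sum.cong)
      finally show ?thesis
        unfolding gauss_smooth_semigroup[OF f] by (simp add: small_norm_def)
    qed
    ultimately show ?thesis
      unfolding level_dev_def V_def a_def[symmetric] b_def[symmetric] by (simp add: sum_subtractf)
  qed
  have "V L - V 0 = (\<Sum>l<L. V (Suc l) - V l)" by (rule sum_lessThan_telescope[symmetric])
  also have "\<bar>\<dots>\<bar> \<le> (\<Sum>l<L. \<bar>V (Suc l) - V l\<bar>)" by (rule sum_abs)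
  also have "\<dots> \<le> (\<Sum>l<L. T)" using good unfolding step by (intro sum_mono) auto
  finally have "\<bar>V L - V 0\<bar> \<le> real L * T" by simp
  moreover have "V L = (\<Sum>j<m. \<Sum>k<d. f (h \<omega> z j k))"
  proof -
    have "(z i)\<^sup>2 = 0" if "i < d" "\<bar>z i\<bar> \<le> (1/2) ^ L" for i
      using small[OF that(1)] that(2) by fastforce
    then have "small_norm ((1/2) ^ L) z = 0" unfolding small_norm_def by (simp add: sum.neutral)
    moreover have "h \<omega> (cutoff ((1/2) ^ L) z) j k = h \<omega> z j k" for j k
      using small by (intro h_cong) (force simp: cutoff_def)
    ultimately show ?thesis unfolding V_def by simp
  qed
  moreover have "V 0 = real m * real d * gauss_smooth f (sqrt (\<Sum>i<d. (z i)\<^sup>2)) 0"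
  proof -
    have z1: "\<bar>z i\<bar> \<le> 1" if "i < d" for i
    proof -
      have "(z i)\<^sup>2 \<le> (\<Sum>i<d. (z i)\<^sup>2)" using that by (intro member_le_sum) auto
      with z have "(z i)\<^sup>2 \<le> 1" by simp
      then show ?thesis by (simp add: abs_square_le_1)
    qed
    then have "{i. i < d \<and> \<bar>z i\<bar> \<le> 1} = {..<d}" by auto
    moreover have "h \<omega> (cutoff 1 z) j k = 0" for j k
      using z1 by (intro h_zero) (auto simp: cutoff_def)
    ultimately show ?thesis unfolding V_def small_norm_def by simp
  qed
  ultimately show ?thesis by simp
qed

text \<open>Integer coordinates \<kappa> of the vectors s \<kappa>. Extensional functions on the
  first d indices make the set finite.\<close>

definition grid :: "nat \<Rightarrow> int \<Rightarrow> (nat \<Rightarrow> int) set" where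
  "grid n M = {\<kappa> \<in> {..<d} \<rightarrow>\<^sub>E {-M..M}. card {i. i < d \<and> \<kappa> i \<noteq> 0} \<le> n}"

lemma finite_grid: "finite (grid n M)"
  unfolding grid_def by (rule finite_subset[OF _ finite_PiE[of "{..<d}" "\<lambda>_. {-M..M}"]]) auto

text \<open>
  The weight \<open>q\<close> per nonzero coordinate takes the place of counting the grid vectors of given support size.
\<close>

lemma sum_grid_weight:
  assumes q: "0 \<le> q" and M: "M \<ge> 0"
  shows "(\<Sum>\<kappa>\<in>grid n M. q ^ card {i. i < d \<and> \<kappa> i \<noteq> 0}) \<le> exp (2 * real_of_int M * q * real d)"
proof -
  define w where "w a = (if a = (0::int) then 1 else q)" for a
  have w: "w a \<ge> 0" for a using q by (auto simp: w_def)
  have eq: "q ^ card {i. i < d \<and> \<kappa> i \<noteq> 0} = (\<Prod>i<d. w (\<kappa> i))" for \<kappa>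
  proof -
    have "(\<Prod>i<d. w (\<kappa> i)) = (\<Prod>i | i < d \<and> \<kappa> i \<noteq> 0. q)"
      by (intro prod.mono_neutral_cong_right) (auto simp: w_def)
    then show ?thesis by simp
  qed
  have "(\<Sum>\<kappa>\<in>grid n M. q ^ card {i. i < d \<and> \<kappa> i \<noteq> 0}) = (\<Sum>\<kappa>\<in>grid n M. \<Prod>i<d. w (\<kappa> i))"
    unfolding eq ..
  also have "\<dots> \<le> (\<Sum>\<kappa>\<in>{..<d} \<rightarrow>\<^sub>E {-M..M}. \<Prod>i<d. w (\<kappa> i))"
    by (intro sum_mono2 finite_PiE prod_nonneg) (auto simp: grid_def w)
  also have "\<dots> = (\<Prod>i<d. \<Sum>a\<in>{-M..M}. w a)"
    by (rule prod_sum_PiE[symmetric]) auto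
  also have "(\<Sum>a\<in>{-M..M}. w a) = 1 + 2 * real_of_int M * q"
  proof -
    have "(\<Sum>a\<in>{-M..M}. w a) = w 0 + (\<Sum>a\<in>{-M..M} - {0}. w a)"
      using M by (subst sum.remove[of _ 0]) auto
    also have "(\<Sum>a\<in>{-M..M} - {0}. w a) = (\<Sum>a\<in>{-M..M} - {0}. q)"
      by (intro sum.cong) (auto simp: w_def)
    finally show ?thesis using M by (simp add: w_def)
  qed
  also have "(\<Prod>i<d. 1 + 2 * real_of_int M * q) = (1 + 2 * real_of_int M * q) ^ d" by simp
  also have "\<dots> \<le> exp (2 * real_of_int M * q) ^ d"
    using q M exp_ge_add_one_self[of "2 * real_of_int M * q"] by (intro power_mono) auto
  finally show ?thesis by (simp flip: exp_of_nat2_mult add: mult_ac)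
qed

lemma prob_diags: "prob_space (diags m)"
  by (rule prob_space_gauss_prod)

text \<open>At level l the vector s \<kappa> stands for the entries not yet averaged out. The
  smaller ones survive only in the variance s^2 n of the smoothing, so n is an independent parameter
  and the small entries themselves are not enumerated.\<close>

definition grid_bad :: "nat \<Rightarrow> (real \<Rightarrow> real) \<Rightarrow> real \<Rightarrow> real \<Rightarrow> int \<Rightarrow> nat \<Rightarrow> nat \<Rightarrow> (nat \<times> nat \<Rightarrow> real) set" where
  "grid_bad m f t s M N L = {\<omega> \<in> space (diags m). \<exists>l<L. \<exists>n\<le>N. \<exists>\<kappa>\<in>grid (4 ^ Suc l) M.
     real m * real d * t \<le> \<bar>level_dev m (gauss_smooth f (s * sqrt (real n))) (\<lambda>i. s * real_of_int (\<kappa> i)) ((1/2) ^ l) \<omega>\<bar>}"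

text \<open>The hypothesis \<open>small\<close> is the budget at level 0. Level l raises it to the
  power 4^l and turns q^4 into q^(4^(l+1)), at least one factor q for each nonzero coordinate. The
  choice of q makes the weighted sum over the grid at most e < 3. With the factor 2 for the two
  tails this gives 6 \<rho> for each pair (l, n).\<close>

lemma grid_bad_prob:
  assumes f: "diff_lip f" and t: "t > 0" and M: "M \<ge> 1"
    and \<rho>: "0 \<le> \<rho>" "\<rho> \<le> 1"
    and q: "q = 1 / (2 * real_of_int M * real d)"
    and small: "exp (- (real m * t\<^sup>2 / 8)) \<le> q ^ 4 * \<rho>"
  shows "grid_bad m f t s M N L \<in> sets (diags m)"
    and "measure (diags m) (grid_bad m f t s M N L) \<le> 6 * real L * real (Suc N) * \<rho>"
proof -
  define B where "B = (\<lambda>(l, n, \<kappa>). {\<omega> \<in> space (diags m).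
     real m * real d * t \<le> \<bar>level_dev m (gauss_smooth f (s * sqrt (real n))) (\<lambda>i. s * real_of_int (\<kappa> i)) ((1/2) ^ l) \<omega>\<bar>})"
  define X where "X = (SIGMA l:{..<L}. {..N} \<times> grid (4 ^ Suc l) M)"
  have finX: "finite X" unfolding X_def using finite_grid by (intro finite_SigmaI finite_cartesian_product) auto
  have eq: "grid_bad m f t s M N L = (\<Union>x\<in>X. B x)"
    unfolding grid_bad_def X_def B_def by fastforce
  have B: "B x \<in> sets (diags m)" for x
  proof -
    obtain l n \<kappa> where x: "x = (l, n, \<kappa>)" by (cases x)
    note [measurable] = measurable_level_dev[OF diff_lip_gauss_smooth[OF f], of m "s * sqrt (real n)" "\<lambda>i. s * real_of_int (\<kappa> i)" "(1/2) ^ l"]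
    show ?thesis unfolding B_def x by simp
  qed
  show "grid_bad m f t s M N L \<in> sets (diags m)"
    unfolding eq using finX B by (intro sets.finite_UN) auto
  have q01: "0 \<le> q" "q \<le> 1" 
  proof -
    have "1 * 1 \<le> (2 * real_of_int M) * real d" using M d_pos by (intro mult_mono) auto
    then show "0 \<le> q" "q \<le> 1" using M unfolding q by simp_all
  qed
  have PB: "measure (diags m) (B (l, n, \<kappa>)) \<le> 2 * \<rho> * q ^ card {i. i < d \<and> \<kappa> i \<noteq> 0}"
    if \<kappa>: "\<kappa> \<in> grid (4 ^ Suc l) M" for l n \<kappa>
  proof -
    have "emeasure (diags m) (B (l, n, \<kappa>)) \<le> ennreal (2 * exp (- (real m * t\<^sup>2 / (8 * ((1/2) ^ l)\<^sup>2))))"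
      unfolding B_def case_prod_conv by (intro level_dev_tail diff_lip_gauss_smooth f t) auto
    then have "measure (diags m) (B (l, n, \<kappa>)) \<le> 2 * exp (- (real m * t\<^sup>2 / (8 * ((1/2) ^ l)\<^sup>2)))"
      unfolding finite_measure.emeasure_eq_measure[OF prob_space.finite_measure[OF prob_diags]] by (simp add: ennreal_le_iff)
    also have "- (real m * t\<^sup>2 / (8 * ((1/2) ^ l)\<^sup>2)) = real (4 ^ l) * (- (real m * t\<^sup>2 / 8))"
    proof -
      have "((1/2::real) ^ l)\<^sup>2 = 1 / 4 ^ l" by (simp add: power_one_over power2_eq_square flip: power_mult_distrib)
      then show ?thesis by simp
    qed
    also have "exp \<dots> = exp (- (real m * t\<^sup>2 / 8)) ^ (4 ^ l)" by (rule exp_of_nat_mult)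
    also have "\<dots> \<le> (q ^ 4 * \<rho>) ^ (4 ^ l)" by (intro power_mono small) auto
    also have "\<dots> = q ^ (4 ^ Suc l) * \<rho> ^ (4 ^ l)" by (simp add: power_mult_distrib flip: power_mult)
    also have "\<dots> \<le> q ^ card {i. i < d \<and> \<kappa> i \<noteq> 0} * \<rho> ^ 1"
      using \<kappa> q01 \<rho> by (intro mult_mono power_decreasing) (auto simp: grid_def)
    finally show ?thesis by (simp add: mult_ac)
  qed
  have "measure (diags m) (grid_bad m f t s M N L) \<le> (\<Sum>x\<in>X. measure (diags m) (B x))"
    unfolding eq using finX B by (intro finite_measure.finite_measure_subadditive_finite[OF prob_space.finite_measure[OF prob_diags]]) auto
  also have "\<dots> = (\<Sum>l<L. \<Sum>x\<in>{..N} \<times> grid (4 ^ Suc l) M. measure (diags m) (B (l, x)))"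
    unfolding X_def by (subst sum.Sigma) (auto simp: finite_grid)
  also have "\<dots> = (\<Sum>l<L. \<Sum>n\<le>N. \<Sum>\<kappa>\<in>grid (4 ^ Suc l) M. measure (diags m) (B (l, n, \<kappa>)))"
    by (intro sum.cong refl) (subst sum.cartesian_product, simp add: case_prod_unfold)
  also have "\<dots> \<le> (\<Sum>l<L. \<Sum>n\<le>N. 2 * \<rho> * 3)"
  proof (intro sum_mono)
    fix l n
    have "(\<Sum>\<kappa>\<in>grid (4 ^ Suc l) M. measure (diags m) (B (l, n, \<kappa>))) \<le> (\<Sum>\<kappa>\<in>grid (4 ^ Suc l) M. 2 * \<rho> * q ^ card {i. i < d \<and> \<kappa> i \<noteq> 0})"
      by (intro sum_mono PB)
    also have "\<dots> = 2 * \<rho> * (\<Sum>\<kappa>\<in>grid (4 ^ Suc l) M. q ^ card {i. i < d \<and> \<kappa> i \<noteq> 0})"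
      by (simp add: sum_distrib_left)
    also have "\<dots> \<le> 2 * \<rho> * exp (2 * real_of_int M * q * real d)"
      using q01 M \<rho> by (intro mult_left_mono sum_grid_weight) auto
    also have "2 * real_of_int M * q * real d = 1" using M d_pos by (simp add: q)
    also have "2 * \<rho> * exp 1 \<le> 2 * \<rho> * 3" using \<rho> exp_le by (intro mult_left_mono) auto
    finally show "(\<Sum>\<kappa>\<in>grid (4 ^ Suc l) M. measure (diags m) (B (l, n, \<kappa>))) \<le> 2 * \<rho> * 3" .
  qed
  finally show "measure (diags m) (grid_bad m f t s M N L) \<le> 6 * real L * real (Suc N) * \<rho>"
    by (simp add: mult_ac)
qed

section \<open>Euclidean size of the transform, uniformly in z\<close>

lemma h_l2: "(\<Sum>j<m. \<Sum>k<d. (h \<omega> z j k)\<^sup>2) = real d * (\<Sum>i<d. (z i)\<^sup>2 * (\<Sum>j<m. (\<omega> (j, i))\<^sup>2))"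
proof -
  have "(\<Sum>j<m. \<Sum>k<d. (h \<omega> z j k)\<^sup>2) = real d * (\<Sum>j<m. \<Sum>i<d. (z i)\<^sup>2 * (\<omega> (j, i))\<^sup>2)"
    unfolding h_def cols by (simp add: sum_distrib_left power_mult_distrib)
  also have "(\<Sum>j<m. \<Sum>i<d. (z i)\<^sup>2 * (\<omega> (j, i))\<^sup>2) = (\<Sum>i<d. \<Sum>j<m. (z i)\<^sup>2 * (\<omega> (j, i))\<^sup>2)"
    by (rule sum.swap)
  finally show ?thesis by (simp add: sum_distrib_left)
qed

text \<open>Cauchy-Schwarz over the m d coordinates. The hypothesis does not mention z, so a single
  event bounds the transform of every rounding error.\<close>

lemma h_l1:
  assumes "\<And>i. i < d \<Longrightarrow> (\<Sum>j<m. (\<omega> (j, i))\<^sup>2) \<le> 4 * real m"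
  shows "(\<Sum>j<m. \<Sum>k<d. \<bar>h \<omega> z j k\<bar>) \<le> 2 * (real m * real d) * sqrt (\<Sum>i<d. (z i)\<^sup>2)"
proof -
  have "(\<Sum>j<m. \<Sum>k<d. \<bar>h \<omega> z j k\<bar>)\<^sup>2 = (\<Sum>p\<in>{..<m} \<times> {..<d}. \<bar>h \<omega> z (fst p) (snd p)\<bar>)\<^sup>2"
    by (subst sum.cartesian_product) (simp add: case_prod_unfold)
  also have "\<dots> \<le> (\<Sum>p\<in>{..<m} \<times> {..<d}. \<bar>h \<omega> z (fst p) (snd p)\<bar>\<^sup>2) * real (card ({..<m} \<times> {..<d}))"
    by (rule sum_squared_le_sum_of_squares)
  also have "(\<Sum>p\<in>{..<m} \<times> {..<d}. \<bar>h \<omega> z (fst p) (snd p)\<bar>\<^sup>2) = (\<Sum>j<m. \<Sum>k<d. (h \<omega> z j k)\<^sup>2)"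
    by (subst sum.cartesian_product) (simp add: case_prod_unfold)
  also have "\<dots> * real (card ({..<m} \<times> {..<d})) \<le> real d * (\<Sum>i<d. (z i)\<^sup>2 * (4 * real m)) * real (card ({..<m} \<times> {..<d}))"
    unfolding h_l2 using assms by (intro mult_right_mono mult_left_mono sum_mono) auto
  also have "real d * (\<Sum>i<d. (z i)\<^sup>2 * (4 * real m)) * real (card ({..<m} \<times> {..<d})) = (2 * (real m * real d) * sqrt (\<Sum>i<d. (z i)\<^sup>2))\<^sup>2"
    by (simp add: power_mult_distrib sum_nonneg flip: sum_distrib_right) (simp add: power2_eq_square)
  finally show ?thesis
    by (rule power2_le_imp_le) (auto intro!: mult_nonneg_nonneg sum_nonneg)
qed

definition diag_bad :: "nat \<Rightarrow> (nat \<times> nat \<Rightarrow> real) set" where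
  "diag_bad m = {\<omega> \<in> space (diags m). \<exists>i<d. 4 * real m \<le> (\<Sum>j<m. (\<omega> (j, i))\<^sup>2)}"

text \<open>Chernoff with parameter 1/4: exp(x^2/4) has mean sqrt 2 \<le> exp(1/2), and the
  threshold 4m contributes exp(-m), which leaves exp(-m/2) for each of the d columns.\<close>

lemma diag_bad_prob:
  shows "diag_bad m \<in> sets (diags m)"
    and "measure (diags m) (diag_bad m) \<le> real d * exp (- (real m / 2))"
proof -
  define B where "B i = {\<omega> \<in> space (diags m). 4 * real m \<le> (\<Sum>j<m. (\<omega> (j, i))\<^sup>2)}" for i
  have comp: "(\<lambda>\<omega>. \<omega> (j, i)) \<in> borel_measurable (diags m)" if "i < d" "j < m" for i j
    using that by (intro measurable_gauss_prod_component[where I = "{..<m} \<times> {..<d}" and f = "\<lambda>\<omega>. \<omega>"]) auto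
  have ms: "(\<lambda>\<omega>. \<Sum>j<m. (\<omega> (j, i))\<^sup>2) \<in> borel_measurable (diags m)" if "i < d" for i
    using that by (intro borel_measurable_sum borel_measurable_power comp) auto
  have B: "B i \<in> sets (diags m)" if "i < d" for i
    unfolding B_def using ms[OF that] by measurable
  have eq: "diag_bad m = (\<Union>i<d. B i)" by (auto simp: diag_bad_def B_def)
  show "diag_bad m \<in> sets (diags m)" unfolding eq using B by (intro sets.finite_UN) auto
  have PB: "measure (diags m) (B i) \<le> exp (- (real m / 2))" if i: "i < d" for i
  proof -
    have "emeasure (diags m) (B i) \<le> ennreal (exp (- (1/4) * (4 * real m))) * (\<integral>\<^sup>+\<omega>. ennreal (exp ((1/4) * (\<Sum>j<m. (\<omega> (j, i))\<^sup>2))) * indicator (space (diags m)) \<omega> \<partial>diags m)"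
      unfolding B_def by (rule Chernoff_ineq_nn_integral_ge) (use ms[OF i] in auto)
    also have "(\<integral>\<^sup>+\<omega>. ennreal (exp ((1/4) * (\<Sum>j<m. (\<omega> (j, i))\<^sup>2))) * indicator (space (diags m)) \<omega> \<partial>diags m) =
      (\<integral>\<^sup>+\<omega>. (\<Prod>p\<in>{..<m} \<times> {..<d}. ennreal (if snd p = i then exp ((\<omega> p)\<^sup>2 / 4) else 1)) \<partial>diags m)"
    proof (rule nn_integral_cong)
      fix \<omega> assume "\<omega> \<in> space (diags m)"
      \<comment> \<open>Padding with factors 1 outside column i yields a product over all index
        pairs, the form in which the product measure factorizes.\<close>
      have "(\<Prod>p\<in>{..<m} \<times> {..<d}. ennreal (if snd p = i then exp ((\<omega> p)\<^sup>2 / 4) else 1)) =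
         (\<Prod>p\<in>(\<lambda>j. (j, i)) ` {..<m}. ennreal (exp ((\<omega> p)\<^sup>2 / 4)))"
        using i by (intro prod.mono_neutral_cong_right) auto
      also have "\<dots> = (\<Prod>j<m. ennreal (exp ((\<omega> (j, i))\<^sup>2 / 4)))"
        by (subst prod.reindex) (auto simp: inj_on_def)
      also have "\<dots> = ennreal (exp (\<Sum>j<m. (\<omega> (j, i))\<^sup>2 / 4))"
        by (rule exp_sum_eq_prod[symmetric]) simp
      finally show "ennreal (exp ((1/4) * (\<Sum>j<m. (\<omega> (j, i))\<^sup>2))) * indicator (space (diags m)) \<omega> =
        (\<Prod>p\<in>{..<m} \<times> {..<d}. ennreal (if snd p = i then exp ((\<omega> p)\<^sup>2 / 4) else 1))"
        using \<open>\<omega> \<in> space (diags m)\<close> by (simp add: sum_divide_distrib)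
    qed
    also have "\<dots> = (\<Prod>p\<in>{..<m} \<times> {..<d}. \<integral>\<^sup>+x. ennreal (if snd p = i then exp (x\<^sup>2 / 4) else 1) \<partial>std_gauss)"
      by (rule gauss_prod.product_nn_integral_prod) measurable
    also have "\<dots> = (\<Prod>p\<in>{..<m} \<times> {..<d}. if snd p = i then ennreal (sqrt 2) else 1)"
      by (intro prod.cong refl) (auto simp: nn_integral_std_gauss_exp_square std_gauss.emeasure_space_1[simplified])
    also have "\<dots> = (\<Prod>p\<in>(\<lambda>j. (j, i)) ` {..<m}. ennreal (sqrt 2))"
      using i by (intro prod.mono_neutral_cong_right) auto
    also have "\<dots> = ennreal (sqrt 2 ^ m)"
      by (subst prod.reindex) (auto simp: inj_on_def ennreal_power)
    also have "ennreal (exp (- (1/4) * (4 * real m))) * \<dots> = ennreal (exp (- real m) * sqrt 2 ^ m)"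
      by (simp add: ennreal_mult')
    finally have "measure (diags m) (B i) \<le> exp (- real m) * sqrt 2 ^ m"
      unfolding finite_measure.emeasure_eq_measure[OF prob_space.finite_measure[OF prob_diags]] by (simp add: ennreal_le_iff)
    also have "\<dots> \<le> exp (- real m) * exp (1/2) ^ m"
    proof (intro mult_left_mono power_mono)
      have "sqrt 2 \<le> 1 + 1/2" by (rule real_le_lsqrt) (auto simp: power2_eq_square)
      also have "\<dots> \<le> exp (1/2)" by (rule exp_ge_add_one_self)
      finally show "sqrt 2 \<le> exp (1/2)" .
    qed auto
    also have "\<dots> = exp (- (real m / 2))"
      by (simp flip: exp_of_nat_mult exp_add)
    finally show ?thesis .
  qed
  have "measure (diags m) (diag_bad m) \<le> (\<Sum>i<d. measure (diags m) (B i))"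
    unfolding eq using B by (intro finite_measure.finite_measure_subadditive_finite[OF prob_space.finite_measure[OF prob_diags]]) auto
  also have "\<dots> \<le> (\<Sum>i<d. exp (- (real m / 2)))" by (intro sum_mono PB) auto
  finally show "measure (diags m) (diag_bad m) \<le> real d * exp (- (real m / 2))" by simp
qed

end

section \<open>Uniformity over the unit ball\<close>

text \<open>Rounding towards zero keeps the grid approximation inside the unit ball.\<close>

definition round0 :: "real \<Rightarrow> real \<Rightarrow> int" where
  "round0 s x = (if x \<ge> 0 then \<lfloor>x / s\<rfloor> else - \<lfloor>- x / s\<rfloor>)"

lemma round0_uminus: "x > 0 \<Longrightarrow> round0 s (- x) = - round0 s x"
  by (simp add: round0_def)

lemma round0_nonneg:
  assumes "s > 0" "x \<ge> 0"
  shows "0 \<le> s * round0 s x" "s * round0 s x \<le> x" "x - s * round0 s x \<le> s"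
proof -
  have f: "real_of_int \<lfloor>x / s\<rfloor> \<le> x / s" "x / s < real_of_int \<lfloor>x / s\<rfloor> + 1"
    by linarith+
  have "s * real_of_int \<lfloor>x / s\<rfloor> \<le> s * (x / s)" "s * (x / s) \<le> s * (real_of_int \<lfloor>x / s\<rfloor> + 1)"
    using assms(1) f by (intro mult_left_mono; simp)+
  then show "s * round0 s x \<le> x" "x - s * round0 s x \<le> s"
    using assms by (simp_all add: round0_def algebra_simps)
  show "0 \<le> s * round0 s x" using assms by (simp add: round0_def)
qed

lemma round0:
  assumes s: "s > 0"
  shows "\<bar>s * round0 s x\<bar> \<le> \<bar>x\<bar>" "\<bar>x - s * round0 s x\<bar> \<le> s"
proof -
  have "\<bar>s * round0 s x\<bar> \<le> \<bar>x\<bar> \<and> \<bar>x - s * round0 s x\<bar> \<le> s"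
  proof (cases "x \<ge> 0")
    case True
    with round0_nonneg[OF s True] show ?thesis by simp
  next
    case False
    then have e: "round0 s x = - round0 s (- x)" using round0_uminus[of "- x" s] by simp
    show ?thesis using round0_nonneg[OF s, of "- x"] False unfolding e by simp
  qed
  then show "\<bar>s * round0 s x\<bar> \<le> \<bar>x\<bar>" "\<bar>x - s * round0 s x\<bar> \<le> s" by auto
qed

lemma abs_le_of_scaled: "c > 0 \<Longrightarrow> \<bar>c * x\<bar> \<le> c * e \<Longrightarrow> \<bar>x\<bar> \<le> e" for c :: real
  by (simp add: abs_mult)

lemma L2_set_dist_le:
  assumes "\<And>i. i < d \<Longrightarrow> \<bar>z i - w i\<bar> \<le> s"
  shows "L2_set (\<lambda>i. z i - w i) {..<d} \<le> real d * s"
proof -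
  have "L2_set (\<lambda>i. z i - w i) {..<d} \<le> (\<Sum>i<d. \<bar>z i - w i\<bar>)" by (rule L2_set_le_sum_abs)
  also have "\<dots> \<le> (\<Sum>i<d. s)" using assms by (intro sum_mono) auto
  finally show ?thesis by simp
qed

lemma L2_set_diff_abs: "\<bar>L2_set z A - L2_set w A\<bar> \<le> L2_set (\<lambda>i. z i - w i) A"
proof -
  have "L2_set z A \<le> L2_set (\<lambda>i. z i - w i) A + L2_set w A"
    using L2_set_triangle_ineq[of "\<lambda>i. z i - w i" w A] by simp
  moreover have "L2_set w A \<le> L2_set (\<lambda>i. w i - z i) A + L2_set z A"
    using L2_set_triangle_ineq[of "\<lambda>i. w i - z i" z A] by simp
  moreover have "L2_set (\<lambda>i. w i - z i) A = L2_set (\<lambda>i. z i - w i) A"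
    by (simp add: L2_set_def power2_commute)
  ultimately show ?thesis by simp
qed

context flat_orthogonal
begin

lemma level_dev_cong:
  assumes "\<And>i. i < d \<Longrightarrow> z i = z' i"
  shows "level_dev m \<phi> z r \<omega> = level_dev m \<phi> z' r \<omega>"
proof -
  have "h \<omega> z j k = h \<omega> z' j k" "h \<omega> (cutoff r z) j k = h \<omega> (cutoff r z') j k" for j k
    using assms by (auto intro!: h_cong simp: cutoff_def)
  moreover have "small_norm r z = small_norm r z'"
    unfolding small_norm_def using assms by (intro arg_cong[where f = sqrt] sum.cong) auto
  ultimately show ?thesis by (simp add: level_dev_def)
qed

lemma h_diff: "h \<omega> z j k - h \<omega> w j k = h \<omega> (\<lambda>i. z i - w i) j k"
  by (simp add: h_def sum_subtractf[symmetric] algebra_simps)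

text \<open>Replace z by its rounding w. The levels cost L t by \<open>chain\<close>. Since z - w
  has norm at most d s, the empirical mean changes by at most 2 d s and the Gaussian mean by at most
  d s.\<close>

lemma uniform_good:
  assumes f: "1-lipschitz_on UNIV f" and s: "s > 0" and L: "(1/2) ^ L < s"
    and M: "M = \<lfloor>1 / s\<rfloor>" and N: "1 / s\<^sup>2 < real N + 1"
    and good: "\<omega> \<in> space (diags m)" "\<omega> \<notin> grid_bad m f t s M N L" "\<omega> \<notin> diag_bad m"
    and z: "L2_set z {..<d} \<le> 1"
  shows "\<bar>(\<Sum>j<m. \<Sum>k<d. f (h \<omega> z j k)) - real m * real d * gauss_smooth f (L2_set z {..<d}) 0\<bar> \<le>
    real m * real d * (real L * t + 3 * real d * s)"
proof -
  define \<kappa> where "\<kappa> i = (if i < d then round0 s (z i) else undefined)" for i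
  define w where "w i = s * real_of_int (\<kappa> i)" for i
  have wz: "\<bar>w i\<bar> \<le> \<bar>z i\<bar>" "\<bar>z i - w i\<bar> \<le> s" if "i < d" for i
    using round0[OF s, of "z i"] that by (simp_all add: w_def \<kappa>_def)
  have zsq: "(\<Sum>i<d. (z i)\<^sup>2) \<le> 1"
    using z by (simp add: L2_set_def)
  have "(w i)\<^sup>2 \<le> (z i)\<^sup>2" if "i < d" for i using wz(1)[OF that] by (simp add: abs_le_square_iff)
  then have "(\<Sum>i<d. (w i)\<^sup>2) \<le> (\<Sum>i<d. (z i)\<^sup>2)" by (intro sum_mono) auto
  with zsq have wsq: "(\<Sum>i<d. (w i)\<^sup>2) \<le> 1" by simp
  have z1: "\<bar>z i\<bar> \<le> 1" if "i < d" for i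
  proof -
    have "(z i)\<^sup>2 \<le> (\<Sum>i<d. (z i)\<^sup>2)" using that by (intro member_le_sum) auto
    with zsq have "(z i)\<^sup>2 \<le> 1" by simp
    then show ?thesis by (simp add: abs_square_le_1)
  qed
  have \<kappa>M: "\<kappa> i \<in> {-M..M}" if "i < d" for i
  proof -
    have "s * real_of_int \<bar>\<kappa> i\<bar> \<le> 1" using wz(1)[OF that] z1[OF that] s by (simp add: w_def abs_mult)
    then have "real_of_int \<bar>\<kappa> i\<bar> \<le> 1 / s" using s by (simp add: field_simps)
    then have "\<bar>\<kappa> i\<bar> \<le> M" unfolding M by (simp add: le_floor_iff)
    then show ?thesis by auto
  qed
  have "\<bar>(\<Sum>j<m. \<Sum>k<d. f (h \<omega> w j k)) - real m * real d * gauss_smooth f (sqrt (\<Sum>i<d. (w i)\<^sup>2)) 0\<bar> \<le> real L * (real m * real d * t)"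
  proof (rule chain[OF f wsq])
    \<comment> \<open>A nonzero grid entry has size at least s, so it lies above the last threshold
      2^-L.\<close>
    fix i assume i: "i < d" "w i \<noteq> 0"
    then have "\<kappa> i \<noteq> 0" by (simp add: w_def)
    then have "\<bar>\<kappa> i\<bar> \<ge> 1" by linarith
    then have "s * 1 \<le> s * real_of_int \<bar>\<kappa> i\<bar>" using s by (intro mult_left_mono) linarith+
    moreover have "\<bar>w i\<bar> = s * real_of_int \<bar>\<kappa> i\<bar>" using s by (simp add: w_def abs_mult)
    ultimately show "(1/2) ^ L < \<bar>w i\<bar>" using L by linarith
  next
    fix l assume l: "l < L"
    define a :: real where "a = (1/2) ^ Suc l"
    have a: "a > 0" by (simp add: a_def)
    \<comment> \<open>The coordinates still alive at this level. The value \<open>undefined\<close>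
      beyond d makes \<kappa>' extensional, as \<open>grid\<close> requires; the removed coordinates
      are kept only through the integer n below.\<close>
    define \<kappa>' where "\<kappa>' i = (if i < d then if \<bar>w i\<bar> \<le> a then 0 else \<kappa> i else undefined)" for i
    define n where "n = nat (\<Sum>i | i < d \<and> \<bar>w i\<bar> \<le> a. (\<kappa> i)\<^sup>2)"
    have rn: "real n = (\<Sum>i | i < d \<and> \<bar>w i\<bar> \<le> a. (real_of_int (\<kappa> i))\<^sup>2)"
      unfolding n_def by (simp add: sum_nonneg)
    have sn: "s\<^sup>2 * real n = (\<Sum>i | i < d \<and> \<bar>w i\<bar> \<le> a. (w i)\<^sup>2)"
      unfolding rn by (simp add: w_def power_mult_distrib sum_distrib_left)
    have small: "small_norm a w = s * sqrt (real n)"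
      unfolding small_norm_def sn[symmetric] using s by (simp add: real_sqrt_mult)
    have "s\<^sup>2 * real n \<le> 1"
    proof -
      have "(\<Sum>i | i < d \<and> \<bar>w i\<bar> \<le> a. (w i)\<^sup>2) \<le> (\<Sum>i<d. (w i)\<^sup>2)" by (intro sum_mono2) auto
      then show ?thesis unfolding sn using wsq by simp
    qed
    then have "real n \<le> 1 / s\<^sup>2" using s by (simp add: field_simps)
    with N have "n \<le> N" by linarith
    \<comment> \<open>Each surviving entry contributes more than a^2 to a squared norm of at most 1,
      and 1/a^2 = 4^(l+1).\<close>
    have card: "card {i. i < d \<and> \<kappa>' i \<noteq> 0} \<le> 4 ^ Suc l"
    proof -
      have "real (card {i. i < d \<and> \<kappa>' i \<noteq> 0}) * a\<^sup>2 = (\<Sum>i | i < d \<and> \<kappa>' i \<noteq> 0. a\<^sup>2)" by simp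
      also have "\<dots> \<le> (\<Sum>i | i < d \<and> \<kappa>' i \<noteq> 0. (w i)\<^sup>2)"
      proof (rule sum_mono)
        fix i assume "i \<in> {i. i < d \<and> \<kappa>' i \<noteq> 0}"
        then have "a < \<bar>w i\<bar>" by (auto simp: \<kappa>'_def split: if_splits)
        then have "a\<^sup>2 \<le> \<bar>w i\<bar>\<^sup>2" using a by (intro power_mono) auto
        then show "a\<^sup>2 \<le> (w i)\<^sup>2" by simp
      qed
      also have "\<dots> \<le> (\<Sum>i<d. (w i)\<^sup>2)" by (intro sum_mono2) auto
      also have "\<dots> \<le> 1" by (rule wsq)
      finally have "real (card {i. i < d \<and> \<kappa>' i \<noteq> 0}) \<le> 1 / a\<^sup>2" using a by (simp add: field_simps)
      also have "1 / a\<^sup>2 = real (4 ^ Suc l)"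
      proof -
        have "a\<^sup>2 = (1/4) ^ Suc l"
          unfolding a_def power2_eq_square power_mult_distrib[symmetric] by simp
        then show ?thesis by (simp add: power_one_over)
      qed
      finally show ?thesis by linarith
    qed
    have "\<kappa>' \<in> grid (4 ^ Suc l) M"
      unfolding grid_def using \<kappa>M card by (auto simp: \<kappa>'_def PiE_def extensional_def)
        (smt (verit) atLeastAtMost_iff)+
    moreover have "level_dev m (gauss_smooth f (small_norm a w)) (cutoff a w) ((1/2) ^ l) \<omega> =
        level_dev m (gauss_smooth f (s * sqrt (real n))) (\<lambda>i. s * real_of_int (\<kappa>' i)) ((1/2) ^ l) \<omega>"
      unfolding small by (rule level_dev_cong) (simp add: cutoff_def \<kappa>'_def w_def)
    moreover have "\<not> real m * real d * t \<le> \<bar>level_dev m (gauss_smooth f (s * sqrt (real n))) (\<lambda>i. s * real_of_int (\<kappa>' i)) ((1/2) ^ l) \<omega>\<bar>"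
      if "\<kappa>' \<in> grid (4 ^ Suc l) M"
      using good(1,2) l \<open>n \<le> N\<close> that unfolding grid_bad_def by blast
    ultimately have "\<bar>level_dev m (gauss_smooth f (small_norm a w)) (cutoff a w) ((1/2) ^ l) \<omega>\<bar> < real m * real d * t"
      by simp
    then show "\<bar>level_dev m (gauss_smooth f (small_norm ((1/2) ^ Suc l) w)) (cutoff ((1/2) ^ Suc l) w) ((1/2) ^ l) \<omega>\<bar> \<le> real m * real d * t"
      unfolding a_def by simp
  qed
  then have 1: "\<bar>(\<Sum>j<m. \<Sum>k<d. f (h \<omega> w j k)) - real m * real d * gauss_smooth f (L2_set w {..<d}) 0\<bar> \<le> real L * (real m * real d * t)"
    by (simp add: L2_set_def)
  have dist: "L2_set (\<lambda>i. z i - w i) {..<d} \<le> real d * s"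
    using wz by (intro L2_set_dist_le) auto
  have 2: "\<bar>(\<Sum>j<m. \<Sum>k<d. f (h \<omega> z j k)) - (\<Sum>j<m. \<Sum>k<d. f (h \<omega> w j k))\<bar> \<le> 2 * (real m * real d) * (real d * s)"
  proof -
    have "\<bar>(\<Sum>j<m. \<Sum>k<d. f (h \<omega> z j k)) - (\<Sum>j<m. \<Sum>k<d. f (h \<omega> w j k))\<bar> \<le>
        (\<Sum>j<m. \<bar>\<Sum>k<d. f (h \<omega> z j k) - f (h \<omega> w j k)\<bar>)"
      unfolding sum_subtractf[symmetric] by (rule sum_abs)
    also have "\<dots> \<le> (\<Sum>j<m. \<Sum>k<d. \<bar>f (h \<omega> z j k) - f (h \<omega> w j k)\<bar>)"
      by (intro sum_mono sum_abs)
    also have "\<dots> \<le> (\<Sum>j<m. \<Sum>k<d. \<bar>h \<omega> (\<lambda>i. z i - w i) j k\<bar>)"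
      unfolding h_diff[symmetric] by (intro sum_mono lip_abs[OF f])
    also have "\<dots> \<le> 2 * (real m * real d) * sqrt (\<Sum>i<d. (z i - w i)\<^sup>2)"
      using good(1,3) by (intro h_l1) (force simp: diag_bad_def not_le)
    also have "\<dots> \<le> 2 * (real m * real d) * (real d * s)"
      using dist by (intro mult_left_mono) (auto simp: L2_set_def)
    finally show ?thesis .
  qed
  have "\<bar>gauss_smooth f (L2_set w {..<d}) 0 - gauss_smooth f (L2_set z {..<d}) 0\<bar> \<le> real d * s"
    using gauss_smooth_diff[OF f, of "L2_set w {..<d}" 0 "L2_set z {..<d}"] L2_set_diff_abs[of z "{..<d}" w] dist
    by (simp add: abs_minus_commute)
  then have 3: "\<bar>real m * real d * gauss_smooth f (L2_set w {..<d}) 0 - real m * real d * gauss_smooth f (L2_set z {..<d}) 0\<bar> \<le> real m * real d * (real d * s)"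
    unfolding right_diff_distrib[symmetric] abs_mult[of "real m * real d"] by (simp add: mult_left_mono)
  have "real m * real d * (real L * t + 3 * real d * s) =
    real L * (real m * real d * t) + 2 * (real m * real d) * (real d * s) + real m * real d * (real d * s)"
    by (simp add: algebra_simps)
  then show ?thesis using 1 2 3 by linarith
qed

definition uniform_event :: "nat \<Rightarrow> (real \<Rightarrow> real) \<Rightarrow> real \<Rightarrow> (nat \<times> nat \<Rightarrow> real) set" where
  "uniform_event m f \<epsilon> = {\<omega> \<in> space (diags m). \<forall>z. L2_set z {..<d} \<le> 1 \<longrightarrow>
     \<bar>(1 / (real m * real d)) * (\<Sum>j<m. \<Sum>k<d. f (h \<omega> z j k)) - gauss_smooth f (L2_set z {..<d}) 0\<bar> \<le> \<epsilon>}"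

text \<open>The deviation is continuous in z, so the uncountable intersection reduces to a countable
  family of rational points. Rounding towards zero with step 1/(n+1) approximates z by such points
  without leaving the ball.\<close>

lemma measurable_uniform_event:
  assumes f: "1-lipschitz_on UNIV f"
  shows "uniform_event m f \<epsilon> \<in> sets (diags m)"
proof -
  define F where "F \<omega> z = \<bar>(1 / (real m * real d)) * (\<Sum>j<m. \<Sum>k<d. f (h \<omega> z j k)) - gauss_smooth f (L2_set z {..<d}) 0\<bar>" for \<omega> z
  define D where "D = (\<lambda>(n, \<kappa>) i. (1 / real (Suc n)) * real_of_int (\<kappa> i)) ` (UNIV \<times> ({..<d} \<rightarrow>\<^sub>E (UNIV :: int set)))"
  have "countable D"
    unfolding D_def by (intro countable_image countable_SIGMA countable_PiE) auto
  then have D': "countable (D \<inter> {z. L2_set z {..<d} \<le> 1})" by blast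
  have "F \<omega> z \<le> \<epsilon>" if z: "L2_set z {..<d} \<le> 1" and D: "\<forall>z\<in>D \<inter> {z. L2_set z {..<d} \<le> 1}. F \<omega> z \<le> \<epsilon>" for \<omega> z
  proof -
    define y where "y n i = (1 / real (Suc n)) * real_of_int (if i < d then round0 (1 / real (Suc n)) (z i) else undefined)" for n i
    have y: "\<bar>y n i\<bar> \<le> \<bar>z i\<bar>" "\<bar>z i - y n i\<bar> \<le> 1 / real (Suc n)" if "i < d" for i n
      using round0[of "1 / real (Suc n)" "z i"] that by (simp_all add: y_def)
    have "y n \<in> D" for n
      unfolding D_def y_def
      by (rule image_eqI[of _ _ "(n, \<lambda>i. if i < d then round0 (1 / real (Suc n)) (z i) else undefined)"])
         (auto simp: PiE_def extensional_def)
    moreover have "L2_set (y n) {..<d} \<le> 1" for n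
    proof -
      have "L2_set (y n) {..<d} \<le> L2_set z {..<d}"
        unfolding L2_set_def using y(1) by (intro real_sqrt_le_mono sum_mono) (auto simp: abs_le_square_iff)
      with z show ?thesis by simp
    qed
    ultimately have le: "F \<omega> (y n) \<le> \<epsilon>" for n using D by auto
    have yi: "(\<lambda>n. y n i) \<longlonglongrightarrow> z i" if "i < d" for i
    proof (rule LIM_zero_cancel, rule Lim_null_comparison)
      show "\<forall>\<^sub>F n in sequentially. norm (y n i - z i) \<le> inverse (real (Suc n))"
        using y(2)[OF that] by (simp add: abs_minus_commute inverse_eq_divide)
      show "(\<lambda>n. inverse (real (Suc n))) \<longlonglongrightarrow> 0" by (rule LIMSEQ_inverse_real_of_nat)
    qed
    have "(\<lambda>n. h \<omega> (y n) j k) \<longlonglongrightarrow> h \<omega> z j k" for j k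
      unfolding h_def by (intro tendsto_intros yi) auto
    moreover have lip_tendsto: "(\<lambda>n. g (u n)) \<longlonglongrightarrow> g v" if "1-lipschitz_on UNIV g" "u \<longlonglongrightarrow> v" for g :: "real \<Rightarrow> real" and u v
      using continuous_on_tendsto_compose[OF lipschitz_on_continuous_on[OF that(1)] that(2)] by simp
    moreover have "(\<lambda>n. L2_set (y n) {..<d}) \<longlonglongrightarrow> L2_set z {..<d}"
      unfolding L2_set_def by (intro tendsto_intros yi) auto
    moreover have "1-lipschitz_on UNIV (\<lambda>\<sigma>. gauss_smooth f \<sigma> 0)"
      using gauss_smooth_diff[OF f] by (intro lip_I)
    ultimately have "(\<lambda>n. F \<omega> (y n)) \<longlonglongrightarrow> F \<omega> z"
      unfolding F_def by (intro tendsto_intros lip_tendsto[OF f] lip_tendsto[of "\<lambda>\<sigma>. gauss_smooth f \<sigma> 0"]) auto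
    then show ?thesis using le by (intro LIMSEQ_le_const2) auto
  qed
  then have "uniform_event m f \<epsilon> = {\<omega> \<in> space (diags m). \<forall>z\<in>D \<inter> {z. L2_set z {..<d} \<le> 1}. F \<omega> z \<le> \<epsilon>}"
    unfolding uniform_event_def F_def[symmetric] by auto
  also have "\<dots> \<in> sets (diags m)"
  proof (rule sets.sets_Collect_countable_All'[OF _ D'])
    fix z
    have "(\<lambda>\<omega>. F \<omega> z) \<in> borel_measurable (diags m)"
      unfolding F_def
      by (intro borel_measurable_abs borel_measurable_diff borel_measurable_times borel_measurable_const
          borel_measurable_sum measurable_compose[OF measurable_h] lip_measurable f) auto
    then show "{\<omega> \<in> space (diags m). F \<omega> z \<le> \<epsilon>} \<in> sets (diags m)" by measurable
  qed
  finally show ?thesis .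
qed

lemma uniform_event_prob:
  assumes f: "diff_lip f" and s: "s > 0" "s \<le> 1" and L: "(1/2) ^ L < s"
    and t: "t > 0" and m: "m > 0"
    and M: "M = \<lfloor>1 / s\<rfloor>" and N: "1 / s\<^sup>2 < real N + 1"
    and \<rho>: "0 \<le> \<rho>" "\<rho> \<le> 1"
    and q: "q = 1 / (2 * real_of_int M * real d)"
    and small: "exp (- (real m * t\<^sup>2 / 8)) \<le> q ^ 4 * \<rho>"
    and \<epsilon>: "real L * t + 3 * real d * s \<le> \<epsilon>"
  shows "measure (diags m) (uniform_event m f \<epsilon>) \<ge>
    1 - (6 * real L * real (Suc N) * \<rho> + real d * exp (- (real m / 2)))"
proof -
  note lip = diff_lip_imp_lip[OF f]
  have M1: "M \<ge> 1" unfolding M using s by (simp add: le_floor_iff)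
  define B where "B = grid_bad m f t s M N L \<union> diag_bad m"
  note gb = grid_bad_prob[OF f t M1 \<rho> q small, of s N L]
  note fin = prob_space.finite_measure[OF prob_diags]
  have B: "B \<in> sets (diags m)" unfolding B_def using gb(1) diag_bad_prob(1) by auto
  have "space (diags m) - B \<subseteq> uniform_event m f \<epsilon>"
  proof
    fix \<omega> assume \<omega>: "\<omega> \<in> space (diags m) - B"
    have "\<bar>(1 / (real m * real d)) * (\<Sum>j<m. \<Sum>k<d. f (h \<omega> z j k)) - gauss_smooth f (L2_set z {..<d}) 0\<bar> \<le> \<epsilon>"
      if z: "L2_set z {..<d} \<le> 1" for z
    proof -
      define c where "c = real m * real d"
      have c: "c > 0" using m d_pos by (simp add: c_def)
      define X Y where "X = (\<Sum>j<m. \<Sum>k<d. f (h \<omega> z j k))" and "Y = gauss_smooth f (L2_set z {..<d}) 0"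
      have "\<bar>X - c * Y\<bar> \<le> c * (real L * t + 3 * real d * s)"
        unfolding X_def Y_def c_def using \<omega> by (intro uniform_good[OF lip s(1) L M N _ _ _ z]) (auto simp: B_def)
      also have "\<dots> \<le> c * \<epsilon>" using c \<epsilon> by (intro mult_left_mono) auto
      finally have "\<bar>X - c * Y\<bar> \<le> c * \<epsilon>" .
      moreover have "X - c * Y = c * (1 / c * X - Y)" using c by (simp add: field_simps)
      ultimately have "\<bar>1 / c * X - Y\<bar> \<le> \<epsilon>"
        by (metis abs_le_of_scaled c)
      then show ?thesis by (simp only: X_def Y_def c_def)
    qed
    then show "\<omega> \<in> uniform_event m f \<epsilon>" using \<omega> unfolding uniform_event_def by blast
  qed
  then have "measure (diags m) (space (diags m) - B) \<le> measure (diags m) (uniform_event m f \<epsilon>)"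
    by (intro finite_measure.finite_measure_mono[OF fin] measurable_uniform_event lip)
  moreover have "measure (diags m) (space (diags m) - B) = 1 - measure (diags m) B"
    by (rule prob_space.prob_compl[OF prob_diags B])
  moreover have "measure (diags m) B \<le> measure (diags m) (grid_bad m f t s M N L) + measure (diags m) (diag_bad m)"
    unfolding B_def by (intro measure_Un_le gb diag_bad_prob)
  ultimately show ?thesis using gb(2) diag_bad_prob(2)[of m] by linarith
qed

text \<open>The distance \<eta> enters twice, once in the empirical mean and once in the Gaussian
  mean.\<close>

lemma uniform_event_approx:
  assumes f: "1-lipschitz_on UNIV f" and g: "1-lipschitz_on UNIV g"
    and fg: "\<And>x. \<bar>f x - g x\<bar> \<le> \<eta>" and m: "m > 0"
  shows "uniform_event m g \<epsilon> \<subseteq> uniform_event m f (\<epsilon> + 2 * \<eta>)"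
proof
  fix \<omega> assume \<omega>: "\<omega> \<in> uniform_event m g \<epsilon>"
  have "\<bar>(1 / (real m * real d)) * (\<Sum>j<m. \<Sum>k<d. f (h \<omega> z j k)) - gauss_smooth f (L2_set z {..<d}) 0\<bar> \<le> \<epsilon> + 2 * \<eta>"
    if z: "L2_set z {..<d} \<le> 1" for z
  proof -
    define c where "c = real m * real d"
    have c: "c > 0" using m d_pos by (simp add: c_def)
    define X Y where "X = (\<Sum>j<m. \<Sum>k<d. f (h \<omega> z j k))" and "Y = (\<Sum>j<m. \<Sum>k<d. g (h \<omega> z j k))"
    have "\<bar>X - Y\<bar> \<le> (\<Sum>j<m. \<bar>\<Sum>k<d. f (h \<omega> z j k) - g (h \<omega> z j k)\<bar>)"
      unfolding X_def Y_def sum_subtractf[symmetric] by (rule sum_abs)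
    also have "\<dots> \<le> (\<Sum>j<m. \<Sum>k<d. \<bar>f (h \<omega> z j k) - g (h \<omega> z j k)\<bar>)"
      by (intro sum_mono sum_abs)
    also have "\<dots> \<le> (\<Sum>j<m. \<Sum>k<d. \<eta>)" by (intro sum_mono fg)
    also have "\<dots> = c * \<eta>" by (simp add: c_def)
    finally have "\<bar>c * (1 / c * X - 1 / c * Y)\<bar> \<le> c * \<eta>" using c by (simp add: right_diff_distrib)
    then have "\<bar>1 / c * X - 1 / c * Y\<bar> \<le> \<eta>"
      by (rule abs_le_of_scaled[OF c])
    moreover have "\<bar>1 / c * Y - gauss_smooth g (L2_set z {..<d}) 0\<bar> \<le> \<epsilon>"
      using \<omega> z unfolding uniform_event_def c_def Y_def by blast
    moreover have "\<bar>gauss_smooth f (L2_set z {..<d}) 0 - gauss_smooth g (L2_set z {..<d}) 0\<bar> \<le> \<eta>"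
      by (rule gauss_smooth_close[OF f g fg])
    ultimately show ?thesis unfolding X_def[symmetric] c_def[symmetric] by linarith
  qed
  then show "\<omega> \<in> uniform_event m f (\<epsilon> + 2 * \<eta>)" using \<omega> unfolding uniform_event_def by blast
qed

end

section \<open>Hadamard matrices\<close>

lemma hadamard_mat_Suc:
  "hadamard_mat (2 ^ Suc n) = four_block_mat (hadamard_mat (2 ^ n)) (hadamard_mat (2 ^ n))
     (hadamard_mat (2 ^ n)) (- hadamard_mat (2 ^ n))"
proof -
  have "\<not> (2::nat) ^ Suc n \<le> 1"
    using one_less_power[of "2::nat" "Suc n"] by linarith
  then show ?thesis by (subst hadamard_mat.simps) simp
qed

lemma hadamard_mat_1: "hadamard_mat 1 = 1\<^sub>m 1"
  by (subst hadamard_mat.simps) simp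

lemma hadamard_mat_carrier: "hadamard_mat (2 ^ n) \<in> carrier_mat (2 ^ n) (2 ^ n)"
proof (induction n)
  case (Suc n)
  have "hadamard_mat (2 ^ Suc n) \<in> carrier_mat (2 ^ n + 2 ^ n) (2 ^ n + 2 ^ n)"
    unfolding hadamard_mat_Suc using Suc by (intro four_block_carrier_mat) auto
  then show ?case by (simp add: mult_2)
qed (use hadamard_mat_1 in simp)

lemma four_block_entries:
  fixes A :: "real mat"
  assumes "A \<in> carrier_mat N N" "k < N" "i < N"
  shows "four_block_mat A A A (- A) $$ (k, i) = A $$ (k, i)"
    "four_block_mat A A A (- A) $$ (k, N + i) = A $$ (k, i)"
    "four_block_mat A A A (- A) $$ (N + k, i) = A $$ (k, i)"
    "four_block_mat A A A (- A) $$ (N + k, N + i) = - A $$ (k, i)"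
proof -
  have dims: "dim_row A = N" "dim_col A = N" using assms(1) by auto
  have u: "(- A) $$ (k, i) = - A $$ (k, i)" using assms by (intro index_uminus_mat(1)) auto
  note four = index_mat_four_block(1)[of _ A "- A" _ A A, unfolded index_uminus_mat(2,3) dims]
  show "four_block_mat A A A (- A) $$ (k, i) = A $$ (k, i)"
    using assms(2,3) by (subst four) simp_all
  show "four_block_mat A A A (- A) $$ (k, N + i) = A $$ (k, i)"
    using assms(2,3) by (subst four) simp_all
  show "four_block_mat A A A (- A) $$ (N + k, i) = A $$ (k, i)"
    using assms(2,3) by (subst four) simp_all
  show "four_block_mat A A A (- A) $$ (N + k, N + i) = - A $$ (k, i)"
    using assms(2,3) u by (subst four) simp_all
qed

lemma hadamard_entry_Suc:
  assumes "k < 2 ^ n" "i < 2 ^ n"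
  shows "hadamard_mat (2 ^ Suc n) $$ (k, i) = hadamard_mat (2 ^ n) $$ (k, i)"
    "hadamard_mat (2 ^ Suc n) $$ (k, 2 ^ n + i) = hadamard_mat (2 ^ n) $$ (k, i)"
    "hadamard_mat (2 ^ Suc n) $$ (2 ^ n + k, i) = hadamard_mat (2 ^ n) $$ (k, i)"
    "hadamard_mat (2 ^ Suc n) $$ (2 ^ n + k, 2 ^ n + i) = - hadamard_mat (2 ^ n) $$ (k, i)"
  unfolding hadamard_mat_Suc using four_block_entries[OF hadamard_mat_carrier assms] .

lemma sum_lessThan_add: "(\<Sum>i<m + n. f i) = (\<Sum>i<m. f i) + (\<Sum>i<n. f (m + i))"
  for f :: "nat \<Rightarrow> real"
  by (induction n) (simp_all add: add.assoc)

lemma less_two_power_SucE: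
  fixes k :: nat
  assumes "k < 2 ^ Suc n"
  obtains "k < 2 ^ n" | k' where "k = 2 ^ n + k'" "k' < 2 ^ n"
proof (cases "k < 2 ^ n")
  case False
  with assms that(2)[of "k - 2 ^ n"] show ?thesis by simp
qed (rule that)

lemma hadamard_entry_square: "k < 2 ^ n \<Longrightarrow> i < 2 ^ n \<Longrightarrow> (hadamard_mat (2 ^ n) $$ (k, i))\<^sup>2 = 1"
proof (induction n arbitrary: k i)
  case 0
  then show ?case using hadamard_mat_1 by simp
next
  case (Suc n)
  show ?case
    by (rule less_two_power_SucE[OF Suc.prems(1)]; rule less_two_power_SucE[OF Suc.prems(2)])
       (simp_all add: hadamard_entry_Suc Suc.IH del: power_Suc)
qed

lemma hadamard_entry_sym: "k < 2 ^ n \<Longrightarrow> i < 2 ^ n \<Longrightarrow> hadamard_mat (2 ^ n) $$ (k, i) = hadamard_mat (2 ^ n) $$ (i, k)"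
proof (induction n arbitrary: k i)
  case 0
  then show ?case using hadamard_mat_1 by simp
next
  case (Suc n)
  show ?case
    by (rule less_two_power_SucE[OF Suc.prems(1)]; rule less_two_power_SucE[OF Suc.prems(2)])
       (auto simp add: hadamard_entry_Suc simp del: power_Suc intro: Suc.IH)
qed

lemma hadamard_isometry:
  "(\<Sum>k<2 ^ n. (\<Sum>i<2 ^ n. hadamard_mat (2 ^ n) $$ (k, i) * y i)\<^sup>2) = 2 ^ n * (\<Sum>i<2 ^ n. (y i)\<^sup>2)"
proof (induction n arbitrary: y)
  case 0
  show ?case using hadamard_mat_1 by simp
next
  case (Suc n)
  define N :: nat where "N = 2 ^ n"
  have S: "2 ^ Suc n = N + N" by (simp add: N_def)
  define a b where "a k = (\<Sum>i<N. hadamard_mat N $$ (k, i) * y i)"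
    and "b k = (\<Sum>i<N. hadamard_mat N $$ (k, i) * y (N + i))" for k
  have 1: "(\<Sum>i<2 ^ Suc n. hadamard_mat (2 ^ Suc n) $$ (k, i) * y i) = a k + b k" if "k < N" for k
    using that unfolding a_def b_def S sum_lessThan_add
    unfolding S[symmetric] by (intro arg_cong2[where f = "(+)"] sum.cong) (auto simp: N_def hadamard_entry_Suc simp del: power_Suc)
  have 2: "(\<Sum>i<2 ^ Suc n. hadamard_mat (2 ^ Suc n) $$ (N + k, i) * y i) = a k - b k" if "k < N" for k
  proof -
    have "(\<Sum>i<2 ^ Suc n. hadamard_mat (2 ^ Suc n) $$ (N + k, i) * y i) = a k + (\<Sum>i<N. - (hadamard_mat N $$ (k, i) * y (N + i)))"
      using that unfolding a_def S sum_lessThan_add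
      unfolding S[symmetric] by (intro arg_cong2[where f = "(+)"] sum.cong) (auto simp: N_def hadamard_entry_Suc simp del: power_Suc)
    then show ?thesis by (simp add: b_def sum_negf)
  qed
  have "(\<Sum>k<2 ^ Suc n. (\<Sum>i<2 ^ Suc n. hadamard_mat (2 ^ Suc n) $$ (k, i) * y i)\<^sup>2) =
      (\<Sum>k<N. (\<Sum>i<2 ^ Suc n. hadamard_mat (2 ^ Suc n) $$ (k, i) * y i)\<^sup>2) +
      (\<Sum>k<N. (\<Sum>i<2 ^ Suc n. hadamard_mat (2 ^ Suc n) $$ (N + k, i) * y i)\<^sup>2)"
    using sum_lessThan_add[of "\<lambda>k. (\<Sum>i<2 ^ Suc n. hadamard_mat (2 ^ Suc n) $$ (k, i) * y i)\<^sup>2" N N]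
    by (simp only: S)
  also have "\<dots> = (\<Sum>k<N. (a k + b k)\<^sup>2) + (\<Sum>k<N. (a k - b k)\<^sup>2)"
    by (intro arg_cong2[where f = "(+)"] sum.cong refl) (simp_all only: 1 2 lessThan_iff)
  \<comment> \<open>Parallelogram law for the two halves of the block matrix.\<close>
  also have "\<dots> = 2 * (\<Sum>k<N. (a k)\<^sup>2) + 2 * (\<Sum>k<N. (b k)\<^sup>2)"
    unfolding sum.distrib[symmetric] sum_distrib_left by (intro sum.cong refl) (simp add: power2_eq_square algebra_simps)
  also have "(\<Sum>k<N. (a k)\<^sup>2) = 2 ^ n * (\<Sum>i<N. (y i)\<^sup>2)"
    unfolding a_def N_def by (rule Suc.IH)
  also have "(\<Sum>k<N. (b k)\<^sup>2) = 2 ^ n * (\<Sum>i<N. (y (N + i))\<^sup>2)"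
    unfolding b_def unfolding N_def by (rule Suc.IH)
  also have "2 * (2 ^ n * (\<Sum>i<N. (y i)\<^sup>2)) + 2 * (2 ^ n * (\<Sum>i<N. (y (N + i))\<^sup>2)) = 2 ^ Suc n * (\<Sum>i<2 ^ Suc n. (y i)\<^sup>2)"
    unfolding S sum_lessThan_add by (simp add: algebra_simps)
  finally show ?case .
qed

lemma flat_orthogonal_hadamard:
  assumes "d = 2 ^ n"
  shows "flat_orthogonal d (\<lambda>k i. hadamard_mat d $$ (k, i))"
proof
  show "(hadamard_mat d $$ (k, i))\<^sup>2 = 1" if "k < d" "i < d" for k i
    using that unfolding assms by (rule hadamard_entry_square)
  show c: "(\<Sum>k<d. (\<Sum>i<d. hadamard_mat d $$ (k, i) * y i)\<^sup>2) = real d * (\<Sum>i<d. (y i)\<^sup>2)" for y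
    unfolding assms hadamard_isometry by simp
  \<comment> \<open>The matrix is symmetric, so the identity for the transpose is the one just
    shown.\<close>
  have "(\<Sum>i<d. (\<Sum>k<d. hadamard_mat d $$ (k, i) * y k)\<^sup>2) = (\<Sum>i<d. (\<Sum>k<d. hadamard_mat d $$ (i, k) * y k)\<^sup>2)" for y
    unfolding assms by (intro sum.cong arg_cong[where f = "\<lambda>x. x\<^sup>2"] refl) (simp add: hadamard_entry_sym)
  then show "(\<Sum>i<d. (\<Sum>k<d. hadamard_mat d $$ (k, i) * y k)\<^sup>2) = real d * (\<Sum>k<d. (y k)\<^sup>2)" for y
    using c by simp
qed (simp add: assms)

lemma rand_hadamard_eq:
  assumes d: "d = 2 ^ n" and z: "z \<in> carrier_vec d" and k: "k < d"
  shows "rand_hadamard d \<omega> j k z = flat_orthogonal.h d (\<lambda>k i. hadamard_mat d $$ (k, i)) \<omega> (vec_index z) j k"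
proof -
  interpret flat_orthogonal d "\<lambda>k i. hadamard_mat d $$ (k, i)"
    by (rule flat_orthogonal_hadamard[OF d])
  have "hadamard_mat d \<in> carrier_mat d d" unfolding d by (rule hadamard_mat_carrier)
  then have H: "dim_row (hadamard_mat d) = d" "dim_col (hadamard_mat d) = d" by auto
  have dz: "dim_vec z = d" using z by auto
  have D: "vec_index (rand_diag d \<omega> j *\<^sub>v z) i = vec_index z i * \<omega> (j, i)" if "i < d" for i
  proof -
    have "vec_index (rand_diag d \<omega> j *\<^sub>v z) i = (\<Sum>l<d. (if i = l then \<omega> (j, l) else 0) * vec_index z l)"
      using that dz by (simp add: rand_diag_def mat_diag_def scalar_prod_def lessThan_atLeast0)
    also have "\<dots> = (\<Sum>l<d. if i = l then \<omega> (j, l) * vec_index z l else 0)"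
      by (intro sum.cong) auto
    finally show ?thesis using that by simp
  qed
  have "rand_hadamard d \<omega> j k z = (\<Sum>i<d. hadamard_mat d $$ (k, i) * vec_index (rand_diag d \<omega> j *\<^sub>v z) i)"
    using H k unfolding rand_hadamard_def
    by (simp add: scalar_prod_def lessThan_atLeast0 rand_diag_def mat_diag_def)
  then show ?thesis unfolding h_def by (simp add: D)
qed

text \<open>Vectors of dimension d and functions on the naturals give the same event, because
  transform and norm only see the first d values and every function restricts to a vector.\<close>

lemma uniform_event_hadamard:
  assumes d: "d = 2 ^ n" and f: "1-lipschitz_on UNIV f"
  shows "{\<omega> \<in> space (diag_space m d). \<forall>z \<in> carrier_vec d. euclid_norm z \<le> 1 \<longrightarrow>
      \<bar>(1 / (real m * real d)) * (\<Sum>j<m. \<Sum>k<d. f (rand_hadamard d \<omega> j k z))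
        - integral\<^sup>L (gaussian_measure (euclid_norm z)) f\<bar> \<le> \<epsilon>} =
    flat_orthogonal.uniform_event d (\<lambda>k i. hadamard_mat d $$ (k, i)) m f \<epsilon>"
proof -
  interpret flat_orthogonal d "\<lambda>k i. hadamard_mat d $$ (k, i)"
    by (rule flat_orthogonal_hadamard[OF d])
  define F where "F \<omega> z = \<bar>(1 / (real m * real d)) * (\<Sum>j<m. \<Sum>k<d. f (h \<omega> z j k)) - gauss_smooth f (L2_set z {..<d}) 0\<bar>" for \<omega> z
  have vec: "\<bar>(1 / (real m * real d)) * (\<Sum>j<m. \<Sum>k<d. f (rand_hadamard d \<omega> j k z))
        - integral\<^sup>L (gaussian_measure (euclid_norm z)) f\<bar> = F \<omega> (vec_index z)"
    "euclid_norm z = L2_set (vec_index z) {..<d}" if "z \<in> carrier_vec d" for z \<omega>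
  proof -
    show e: "euclid_norm z = L2_set (vec_index z) {..<d}"
      using carrier_vecD[OF that] by (simp add: euclid_norm_def)
    show "\<bar>(1 / (real m * real d)) * (\<Sum>j<m. \<Sum>k<d. f (rand_hadamard d \<omega> j k z))
        - integral\<^sup>L (gaussian_measure (euclid_norm z)) f\<bar> = F \<omega> (vec_index z)"
    proof -
      have "(\<Sum>j<m. \<Sum>k<d. f (rand_hadamard d \<omega> j k z)) = (\<Sum>j<m. \<Sum>k<d. f (h \<omega> (vec_index z) j k))"
        by (intro sum.cong refl) (simp add: rand_hadamard_eq[OF d that])
      then show ?thesis
        unfolding F_def e by (simp add: integral_gaussian_measure lip_measurable[OF f])
    qed
  qed
  have "(\<forall>z \<in> carrier_vec d. L2_set (vec_index z) {..<d} \<le> 1 \<longrightarrow> F \<omega> (vec_index z) \<le> \<epsilon>) \<longleftrightarrow>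
     (\<forall>z. L2_set z {..<d} \<le> 1 \<longrightarrow> F \<omega> z \<le> \<epsilon>)" for \<omega>
  proof (intro iffI allI impI)
    fix z assume all: "\<forall>z \<in> carrier_vec d. L2_set (vec_index z) {..<d} \<le> 1 \<longrightarrow> F \<omega> (vec_index z) \<le> \<epsilon>"
      and z: "L2_set z {..<d} \<le> 1"
    have n: "L2_set (vec_index (vec d z)) {..<d} = L2_set z {..<d}"
      by (intro L2_set_cong) auto
    have "h \<omega> (vec_index (vec d z)) j k = h \<omega> z j k" for j k
      by (rule h_cong) simp
    then have "F \<omega> (vec_index (vec d z)) = F \<omega> z" unfolding F_def n by simp
    then show "F \<omega> z \<le> \<epsilon>" using all z n vec_carrier[of d z] by metis
  qed auto
  then show ?thesis
    unfolding uniform_event_def F_def[symmetric] diag_space_def using vec by (auto cong: ball_cong)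
qed

section \<open>Choice of parameters\<close>

text \<open>Half of \<epsilon> is spent here: L t = \<epsilon>/4 on the levels and 3 d s =
  3\<epsilon>/16 on rounding. The other half is left for making f differentiable. Each of the two
  bad events receives \<delta>/2.\<close>

lemma parameter_choice:
  fixes d m :: nat and \<delta> \<epsilon> :: real
  assumes d: "d > 0" and \<delta>: "0 < \<delta>" "\<delta> < 1/2" and \<epsilon>: "0 < \<epsilon>" "\<epsilon> < 1/2"
    and m: "real m \<ge> 10 ^ 7 * (1 / \<epsilon>\<^sup>2) * (ln (real d / \<epsilon>)) ^ 5 * ln (1 / \<delta>)"
  obtains s t \<rho> q :: real and L N :: nat and M :: int where
    "m > 0" "s > 0" "s \<le> 1" "(1/2) ^ L < s" "t > 0" "M = \<lfloor>1 / s\<rfloor>" "1 / s\<^sup>2 < real N + 1"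
    "0 \<le> \<rho>" "\<rho> \<le> 1" "q = 1 / (2 * real_of_int M * real d)"
    "exp (- (real m * t\<^sup>2 / 8)) \<le> q ^ 4 * \<rho>"
    "real L * t + 3 * real d * s \<le> \<epsilon> / 2"
    "6 * real L * real (Suc N) * \<rho> + real d * exp (- (real m / 2)) \<le> \<delta>"
proof -
  define l where "l = ln (real d / \<epsilon>)"
  define D where "D = ln (1 / \<delta>)"
  have ln2: "2/3 \<le> ln (2::real)" "ln (2::real) \<le> 1" using ln2_ge_two_thirds ln_2_less_1 by auto
  have d1: "real d \<ge> 1" using d by simp
  have de: "real d / \<epsilon> \<ge> 2"
  proof -
    have "2 * \<epsilon> \<le> real d" using \<epsilon> d1 by linarith
    then show ?thesis using \<epsilon> by (simp add: field_simps)
  qed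
  have l2: "ln 2 \<le> l" unfolding l_def using de by (intro ln_mono) auto
  then have l: "l \<ge> 2/3" using ln2 by simp
  have D: "D \<ge> 2/3"
  proof -
    have "ln 2 \<le> D" unfolding D_def using \<delta> by (intro ln_mono) (auto simp: field_simps)
    then show ?thesis using ln2 by simp
  qed
  have lD: "l \<le> 3/2 * (l * D)" "D \<le> 3/2 * (l * D)"
    using mult_left_mono[OF D, of l] mult_right_mono[OF l, of D] l D by linarith+
  define s where "s = \<epsilon> / (16 * real d)"
  have s: "s > 0" using \<epsilon> d by (simp add: s_def)
  have s1: "s \<le> 1" using \<epsilon> d1 by (simp add: s_def field_simps)
  have inv_s: "1 / s = 16 * (real d / \<epsilon>)" by (simp add: s_def)
  have lns: "ln (1 / s) \<le> 5 * l"
  proof -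
    have "ln (1 / s) = ln (2 ^ 4) + l" unfolding inv_s l_def using de d \<epsilon>(1) by (subst ln_mult) auto
    also have "ln (2 ^ 4 :: real) = 4 * ln 2" by (subst ln_realpow) auto
    finally show ?thesis using l2 by simp
  qed
  \<comment> \<open>The additional level makes log 2 (1/s) < L strict.\<close>
  define L where "L = Suc (nat \<lceil>log 2 (1 / s)\<rceil>)"
  have "log 2 (1 / s) \<ge> 0" using s s1 by (subst zero_le_log_cancel_iff) auto
  then have Lr: "log 2 (1 / s) < real L" "real L \<le> log 2 (1 / s) + 2"
    unfolding L_def by linarith+
  have L1: "(1/2) ^ L < s"
  proof -
    have "1 / s < 2 powr real L" using Lr(1) s by (subst (asm) log_less_iff) auto
    then have "1 / s < 2 ^ L" by (simp add: powr_realpow)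
    then show ?thesis using s by (simp add: power_one_over field_simps)
  qed
  have Ll: "real L \<le> 11 * l"
  proof -
    have "log 2 (1 / s) = ln (1 / s) / ln 2" by (simp add: log_def)
    also have "\<dots> \<le> 5 * l / (2/3)"
      using lns ln2 l by (intro frac_le) auto
    finally show ?thesis using Lr(2) l by simp
  qed
  have Lpos: "real L \<ge> 1" by (simp add: L_def)
  define t where "t = \<epsilon> / (4 * real L)"
  have t: "t > 0" using \<epsilon> Lpos by (simp add: t_def)
  define M where "M = \<lfloor>1 / s\<rfloor>"
  have M: "1 \<le> real_of_int M" "real_of_int M \<le> 1 / s"
    using s s1 unfolding M_def by (simp_all add: le_floor_iff)
  define N where "N = nat \<lfloor>1 / s\<^sup>2\<rfloor>"
  have N: "1 / s\<^sup>2 < real N + 1" "real N \<le> 1 / s\<^sup>2"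
    unfolding N_def using s by (simp_all add: real_of_int_floor_add_one_gt)
  define q where "q = 1 / (2 * real_of_int M * real d)"
  have q: "q > 0" using M d by (simp add: q_def)
  define \<rho> where "\<rho> = \<delta> / (12 * real L * real (Suc N))"
  have \<rho>: "\<rho> > 0" using \<delta> Lpos by (simp add: \<rho>_def)
  have \<rho>1: "\<rho> \<le> 1"
  proof -
    have "1 * 1 \<le> (12 * real L) * real (Suc N)" using Lpos by (intro mult_mono) auto
    then show ?thesis using \<delta> Lpos unfolding \<rho>_def by (subst divide_le_eq_1_pos) auto
  qed
  have lnq: "- ln q \<le> 7 * l"
  proof -
    have "2 * real_of_int M * real d \<le> 2 * (1 / s) * (real d / \<epsilon>)"
      using M \<epsilon> d1 s by (intro mult_mono) (auto simp: field_simps)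
    also have "\<dots> = 2 ^ 5 * (real d / \<epsilon>) ^ 2" unfolding inv_s by (simp add: power2_eq_square)
    finally have "ln (2 * real_of_int M * real d) \<le> ln (2 ^ 5 * (real d / \<epsilon>) ^ 2)"
      using M d by (intro ln_mono) auto
    also have "\<dots> = 5 * ln 2 + 2 * l"
      unfolding l_def using de d \<epsilon>(1) ln_realpow[of "2::real" 5] by (subst ln_mult) (auto simp: ln_realpow)
    finally show ?thesis using l2 unfolding q_def using M d by (simp add: ln_div)
  qed
  have ln\<rho>: "- ln \<rho> \<le> 27 * l + D"
  proof -
    have "- ln \<rho> = ln (12 * real L * real (Suc N)) + D"
      unfolding \<rho>_def D_def using \<delta> Lpos by (simp add: ln_div)
    moreover have "ln (12 * real L * real (Suc N)) = ln 12 + ln (real L) + ln (real (Suc N))"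
      using Lpos by (simp add: ln_mult)
    moreover have "ln (12::real) \<le> 4 * ln 2"
    proof -
      have "ln (12::real) \<le> ln (2 ^ 4)" by (intro ln_mono) auto
      then show ?thesis by (subst (asm) ln_realpow) auto
    qed
    \<comment> \<open>A crude bound is enough, as only a multiple of l is wanted.\<close>
    moreover have "ln (real L) \<le> 11 * l" using ln_le_minus_one[of "real L"] Lpos Ll by linarith
    moreover have "ln (real (Suc N)) \<le> 11 * l"
    proof -
      have "1 \<le> 1 / s\<^sup>2" using s s1 by (simp add: power_le_one)
      with N have "real (Suc N) \<le> 2 * (1 / s) ^ 2" by (simp add: power_divide)
      then have "ln (real (Suc N)) \<le> ln (2 * (1 / s) ^ 2)" by (intro ln_mono) auto
      also have "\<dots> = ln 2 + 2 * ln (1 / s)" using s by (subst ln_mult) (auto simp: ln_realpow)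
      finally show ?thesis using lns l2 by linarith
    qed
    ultimately show ?thesis using l2 l by linarith
  qed
  \<comment> \<open>Four times 7 l plus 27 l + D is 55 l + D. As l and D are at least 2/3, each of
    these 56 terms is at most 3/2 l D, and 56 * 3/2 = 84.\<close>
  have total: "- (4 * ln q + ln \<rho>) \<le> 84 * (l * D)"
    using lnq ln\<rho> lD by linarith
  have mt: "84 * (l * D) \<le> real m * t\<^sup>2 / 8"
  proof -
    have "l * (l * D) \<ge> 0" using l D by simp
    have sq: "4/9 \<le> l\<^sup>2" using power_mono[OF l, of 2] by (simp add: power2_eq_square)
    have "84 * (l * D) * (16 * (real L)\<^sup>2 * 8) \<le> 84 * (l * D) * (16 * (11 * l)\<^sup>2 * 8)"
      using Ll Lpos l D by (intro mult_left_mono mult_right_mono power_mono) auto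
    also have "\<dots> = 1300992 * (l ^ 3 * D)" by (simp add: power2_eq_square power3_eq_cube)
    \<comment> \<open>Two of the three powers of l come from L^2, the third from the entropy. The
      inequality 1 \<le> 9/4 l^2 passes to l^5, and the resulting 2927232 stays below 10^7.\<close>
    also have "\<dots> \<le> 1300992 * (l ^ 3 * D) * (9/4 * l\<^sup>2)"
      using sq l D mult_left_mono[of 1 "9/4 * l\<^sup>2" "1300992 * (l ^ 3 * D)"] by simp
    also have "\<dots> = 2927232 * (l ^ 5 * D)" by (simp add: power2_eq_square power3_eq_cube eval_nat_numeral)
    also have "\<dots> \<le> 10 ^ 7 * (l ^ 5 * D)" using l D by (intro mult_right_mono) auto
    also have "\<dots> \<le> real m * \<epsilon>\<^sup>2"
      using m \<epsilon> unfolding l_def[symmetric] D_def[symmetric] by (simp add: field_simps)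
    finally have "84 * (l * D) * (16 * (real L)\<^sup>2 * 8) \<le> real m * \<epsilon>\<^sup>2" .
    then have "84 * (l * D) \<le> real m * \<epsilon>\<^sup>2 / (16 * (real L)\<^sup>2 * 8)"
      using Lpos by (subst pos_le_divide_eq) auto
    then show ?thesis unfolding t_def by (simp add: power_divide power_mult_distrib)
  qed
  have small: "exp (- (real m * t\<^sup>2 / 8)) \<le> q ^ 4 * \<rho>"
  proof -
    have "exp (- (real m * t\<^sup>2 / 8)) \<le> exp (4 * ln q + ln \<rho>)" using total mt by simp
    also have "\<dots> = q ^ 4 * \<rho>" using q \<rho> by (simp add: exp_add exp_of_nat_mult[of 4, simplified])
    finally show ?thesis .
  qed
  have t1: "t \<le> 1" using \<epsilon> Lpos unfolding t_def by (subst divide_le_eq_1_pos) auto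
  \<comment> \<open>For the diagonal event: ln (2 d) + D \<le> l + D \<le> 3 l D has to stay below
    m/2.\<close>
  have mbig: "real m \<ge> 6 * (l * D)"
  proof -
    have "t\<^sup>2 \<le> 1" using t t1 by (simp add: power_le_one)
    then have "real m * t\<^sup>2 \<le> real m * 1" by (intro mult_left_mono) auto
    moreover have "l * D \<ge> 0" using l D by simp
    ultimately show ?thesis using mt by linarith
  qed
  have "m > 0"
  proof -
    have "6 * (l * D) > 0" using l D by simp
    with mbig have "real m > 0" by linarith
    then show ?thesis by simp
  qed
  have diag: "real d * exp (- (real m / 2)) \<le> \<delta> / 2"
  proof -
    have "ln (2 * real d) \<le> l"
      unfolding l_def using \<epsilon> d1 by (intro ln_mono) (auto simp: field_simps)
    then have "ln (2 * real d) + D \<le> real m / 2" using mbig lD by linarith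
    moreover have "ln (2 * real d) + D = ln (2 * real d / \<delta>)"
      unfolding D_def using \<delta> d by (simp add: ln_div ln_mult)
    ultimately have "exp (- (real m / 2)) \<le> exp (- ln (2 * real d / \<delta>))" by simp
    also have "\<dots> = \<delta> / (2 * real d)" using \<delta> d by (simp add: exp_minus)
    finally have "real d * exp (- (real m / 2)) \<le> real d * (\<delta> / (2 * real d))"
      by (intro mult_left_mono) auto
    then show ?thesis using d by simp
  qed
  show ?thesis
  proof (rule that[OF \<open>m > 0\<close> s s1 L1 t M_def N(1) less_imp_le[OF \<rho>] \<rho>1 q_def small])
    show "real L * t + 3 * real d * s \<le> \<epsilon> / 2"
      unfolding t_def s_def using Lpos d \<epsilon> by (simp add: field_simps)
    have "6 * real L * real (Suc N) * \<rho> = \<delta> / 2"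
      unfolding \<rho>_def using Lpos by (simp add: field_simps del: of_nat_Suc)
    then show "6 * real L * real (Suc N) * \<rho> + real d * exp (- (real m / 2)) \<le> \<delta>"
      using diag by simp
  qed
qed

theorem theorem1p1:
  shows "\<exists>C::real. C > 0 \<and>
    (\<forall>(d::nat) (m::nat) (\<delta>::real) (\<epsilon>::real) (f::real \<Rightarrow> real).
       (\<exists>n. d = 2 ^ n) \<longrightarrow>
       0 < \<delta> \<longrightarrow> \<delta> < 1/2 \<longrightarrow> 0 < \<epsilon> \<longrightarrow> \<epsilon> < 1/2 \<longrightarrow>
       1-lipschitz_on UNIV f \<longrightarrow>
       real m \<ge> C * (1 / \<epsilon>\<^sup>2) * (ln (real d / \<epsilon>)) ^ 5 * ln (1 / \<delta>) \<longrightarrow>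
       measure (diag_space m d)
         {\<omega> \<in> space (diag_space m d).
            \<forall>z \<in> carrier_vec d. euclid_norm z \<le> 1 \<longrightarrow>
              \<bar>(1 / (real m * real d)) * (\<Sum>j<m. \<Sum>k<d. f (rand_hadamard d \<omega> j k z))
                - integral\<^sup>L (gaussian_measure (euclid_norm z)) f\<bar> \<le> \<epsilon>}
       \<ge> 1 - \<delta>)"
proof (intro exI[of _ "10 ^ 7 :: real"] conjI allI impI)
  fix d m :: nat and \<delta> \<epsilon> :: real and f :: "real \<Rightarrow> real"
  assume "\<exists>n. d = 2 ^ n" and \<delta>: "0 < \<delta>" "\<delta> < 1/2" and \<epsilon>: "0 < \<epsilon>" "\<epsilon> < 1/2"
    and f: "1-lipschitz_on UNIV f"
    and m: "real m \<ge> 10 ^ 7 * (1 / \<epsilon>\<^sup>2) * (ln (real d / \<epsilon>)) ^ 5 * ln (1 / \<delta>)"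
  then obtain n where d: "d = 2 ^ n" by auto
  interpret flat_orthogonal d "\<lambda>k i. hadamard_mat d $$ (k, i)"
    by (rule flat_orthogonal_hadamard[OF d])
  \<comment> \<open>Distance \<epsilon>/4 from f turns accuracy \<epsilon>/2 for g into \<epsilon>/2
    + 2 * \<epsilon>/4 = \<epsilon> for f.\<close>
  obtain g where g: "diff_lip g" "\<And>x. \<bar>f x - g x\<bar> \<le> \<epsilon> / 4"
    using diff_lip_approx[OF f, of "\<epsilon> / 4"] \<epsilon> by auto
  obtain s t \<rho> q L N M where p: "m > 0" "s > 0" "s \<le> 1" "(1/2) ^ L < s" "t > 0" "M = \<lfloor>1 / s\<rfloor>"
    "1 / s\<^sup>2 < real N + 1" "0 \<le> \<rho>" "\<rho> \<le> 1" "q = 1 / (2 * real_of_int M * real d)"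
    "exp (- (real m * t\<^sup>2 / 8)) \<le> q ^ 4 * \<rho>" "real L * t + 3 * real d * s \<le> \<epsilon> / 2"
    "6 * real L * real (Suc N) * \<rho> + real d * exp (- (real m / 2)) \<le> \<delta>"
    using parameter_choice[OF d_pos \<delta> \<epsilon> m] by metis
  have "1 - \<delta> \<le> measure (diags m) (uniform_event m g (\<epsilon> / 2))"
    using uniform_event_prob[OF g(1) p(2,3,4,5,1,6,7,8,9,10,11,12)] p(13) by linarith
  also have "\<dots> \<le> measure (diags m) (uniform_event m f \<epsilon>)"
    using uniform_event_approx[OF f diff_lip_imp_lip[OF g(1)] g(2) p(1), of "\<epsilon> / 2"]
    by (intro finite_measure.finite_measure_mono[OF prob_space.finite_measure[OF prob_diags]] measurable_uniform_event f) simp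
  finally show "measure (diag_space m d)
         {\<omega> \<in> space (diag_space m d).
            \<forall>z \<in> carrier_vec d. euclid_norm z \<le> 1 \<longrightarrow>
              \<bar>(1 / (real m * real d)) * (\<Sum>j<m. \<Sum>k<d. f (rand_hadamard d \<omega> j k z))
                - integral\<^sup>L (gaussian_measure (euclid_norm z)) f\<bar> \<le> \<epsilon>}
       \<ge> 1 - \<delta>"
    unfolding uniform_event_hadamard[OF d f] by (simp add: diag_space_def)
qed simp

end
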